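(* Let $(Q(t))_{t\ge0}$ be a stochastically continuous HA-semigroup on $D$ and let $(\gamma(t))_{t\ge0}$ be a stochastically continuous SC-semigroup associated with $(Q(t))_{t\ge0}$. Suppose that $\int_D|\xi|\,Q(t,x,d\xi)<\infty$ for all $t\ge0$, $x\in D$, and that $\int_D|\xi|\,\gamma(t,d\xi)<\infty$ for all $t\ge0$. Let $h_2(t)=\int_D\xi_2\,\gamma(t,d\xi)$. Then $(\gamma(t))_{t\ge0}$ is regular if and only if $t\mapsto h_2(t)$ is absolutely continuous on $[0,\infty)$.
   Context: $D=\mathbb{R}_+\times\mathbb{R}$ with $\mathbb{R}_+=[0,\infty)$; $U=\mathbb{C}_-\times(i\mathbb{R})$, where $\mathbb{C}_-=\{a+ib: a\le 0,\ b\in\mathbb{R}\}$ and $i\mathbb{R}=\{ib:b\in\mathbb{R}\}$; $\langle u,\xi\rangle=u_1\xi_1+u_2\xi_2$ (bilinear). HA-semigroup: a transition semigroup $(Q(t))_{t\ge0}$ with state space $D$ such that for each $t\ge0$ there is a continuous two-dimensional complex-valued function $\psi(t,\cdot)=(\psi_1(t,\cdot),\psi_2(t,\cdot))$ on $U$ with $\int_D \exp\{\langle u,\xi\rangle\}Q(t,x,d\xi)=\exp\{\langle x,\psi(t,u)\rangle\}$ for all $x\in D$, $u\in U$ (one always has $\psi(t,u)\in U$). It is stochastically continuous if $t\mapsto Q(t,x,\cdot)$ is weakly continuous on $[0,\infty)$ for each $x\in D$. SC-semigroup associated with $(Q(t))_{t\ge0}$: a family of probability measures $(\gamma(t))_{t\ge0}$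 on $D$ with $\gamma(r+t)=(\gamma(r)Q(t))*\gamma(t)$ for all $r,t\ge0$, where $*$ is convolution and $\gamma(r)Q(t)(B)=\int_D Q(t,\xi,B)\gamma(r,d\xi)$. It is stochastically continuous if $t\mapsto\gamma(t)$ is weakly continuous on $[0,\infty)$. The SC-semigroup $(\gamma(t))_{t\ge0}$ is regular if $\phi(t,u)=\log\hat\gamma(t,u)$ has the representation $\phi(t,u)=\int_0^t F(\psi(s,u))\,ds$ for $t\ge0$, $u\in U$, where $F=\log\hat\nu$ for some infinitely divisible probability measure $\nu$ on $D$. Here $\hat\nu(u)=\int_D e^{\langle u,\xi\rangle}\nu(d\xi)$, $u\in U$, and the logarithm is the continuous one vanishing at $u=0$. Absolute continuity on $[0,\infty)$ means absolute continuity on every bounded interval. *)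

theory Defs
  imports "HOL-Probability.Probability"
begin

definition D :: "(real \<times> real) set" where
  "D = {0..} \<times> UNIV"

definition U :: "(complex \<times> complex) set" where
  "U = {a. Re a \<le> 0} \<times> {b. Re b = 0}"

abbreviation MD :: "(real \<times> real) measure" where
  "MD \<equiv> restrict_space borel D"

text \<open>The bilinear pairing \<open>\<langle>u, \<xi>\<rangle>\<close>; there is no complex conjugation.\<close>

definition pairing :: "complex \<times> complex \<Rightarrow> real \<times> real \<Rightarrow> complex" where
  "pairing u \<xi> = fst u * of_real (fst \<xi>) + snd u * of_real (snd \<xi>)"

text \<open>The transform \<open>u \<mapsto> \<integral> exp \<langle>u, \<xi>\<rangle> \<mu>(d\<xi>)\<close>; the integrand is bounded on \<open>D\<close> for \<open>u \<in> U\<close>.\<close>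

definition transform :: "(real \<times> real) measure \<Rightarrow> complex \<times> complex \<Rightarrow> complex" where
  "transform \<mu> u = (LINT \<xi>|\<mu>. exp (pairing u \<xi>))"

text \<open>
  Convolution of measures on \<open>D\<close>, again as a measure on \<open>D\<close>.  The library's \<^const>\<open>convolution\<close>
  would yield a measure on the whole plane instead.
\<close>

definition conv_D :: "(real \<times> real) measure \<Rightarrow> (real \<times> real) measure \<Rightarrow> (real \<times> real) measure" where
  "conv_D \<mu> \<nu> = distr (\<mu> \<Otimes>\<^sub>M \<nu>) MD (\<lambda>(x, y). x + y)"

primrec conv_power :: "(real \<times> real) measure \<Rightarrow> nat \<Rightarrow> (real \<times> real) measure" where
  "conv_power \<mu> 0 = return MD 0"
| "conv_power \<mu> (Suc n) = conv_D (conv_power \<mu> n) \<mu>"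

definition infinitely_divisible :: "(real \<times> real) measure \<Rightarrow> bool" where
  "infinitely_divisible \<nu> \<longleftrightarrow> \<nu> \<in> space (prob_algebra MD) \<and>
    (\<forall>n\<ge>1. \<exists>\<mu>\<in>space (prob_algebra MD). conv_power \<mu> n = \<nu>)"

definition weakly_continuous :: "(real \<Rightarrow> (real \<times> real) measure) \<Rightarrow> bool" where
  "weakly_continuous \<mu> \<longleftrightarrow>
    (\<forall>f :: real \<times> real \<Rightarrow> real. continuous_on D f \<and> bounded (f ` D) \<longrightarrow>
      continuous_on {0..} (\<lambda>t. LINT \<xi>|\<mu> t. f \<xi>))"

text \<open>
  \<open>Q t x\<close> is \<open>Q(t, x, \<cdot>)\<close>; only \<open>t \<ge> 0\<close> and \<open>x \<in> D\<close> are meaningful.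
\<close>

definition transition_semigroup :: "(real \<Rightarrow> real \<times> real \<Rightarrow> (real \<times> real) measure) \<Rightarrow> bool" where
  "transition_semigroup Q \<longleftrightarrow>
    (\<forall>t\<ge>0. Q t \<in> MD \<rightarrow>\<^sub>M prob_algebra MD) \<and>
    (\<forall>x\<in>D. Q 0 x = return MD x) \<and>
    (\<forall>r\<ge>0. \<forall>t\<ge>0. \<forall>x\<in>D. Q (r + t) x = (Q r x \<bind> Q t))"

text \<open>
  \<open>HA_semigroup Q \<psi>\<close>: \<open>Q\<close> is an HA-semigroup, with \<open>\<psi>\<close> the witnessing family of functions on \<open>U\<close>.
  The defining identity for all \<open>x \<in> D\<close> determines \<open>\<psi> t u\<close> for \<open>t \<ge> 0\<close>, \<open>u \<in> U\<close> uniquely and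
  implies \<open>\<psi> t u \<in> U\<close>.
\<close>

definition HA_semigroup :: "(real \<Rightarrow> real \<times> real \<Rightarrow> (real \<times> real) measure) \<Rightarrow>
    (real \<Rightarrow> complex \<times> complex \<Rightarrow> complex \<times> complex) \<Rightarrow> bool" where
  "HA_semigroup Q \<psi> \<longleftrightarrow> transition_semigroup Q \<and>
    (\<forall>t\<ge>0. continuous_on U (\<psi> t) \<and>
      (\<forall>x\<in>D. \<forall>u\<in>U. transform (Q t x) u = exp (pairing (\<psi> t u) x)))"

definition SC_semigroup :: "(real \<Rightarrow> real \<times> real \<Rightarrow> (real \<times> real) measure) \<Rightarrow>
    (real \<Rightarrow> (real \<times> real) measure) \<Rightarrow> bool" where
  "SC_semigroup Q \<gamma> \<longleftrightarrow>
    (\<forall>t\<ge>0. \<gamma> t \<in> space (prob_algebra MD)) \<and>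
    (\<forall>r\<ge>0. \<forall>t\<ge>0. \<gamma> (r + t) = conv_D (\<gamma> r \<bind> Q t) (\<gamma> t))"

text \<open>
  \<open>g\<close> is the continuous logarithm on \<open>U\<close> of \<open>f\<close> vanishing at \<open>0\<close>.  As \<open>U\<close> is connected, there is at
  most one such \<open>g\<close> up to its values outside \<open>U\<close>.
\<close>

definition continuous_log_on_U ::
    "(complex \<times> complex \<Rightarrow> complex) \<Rightarrow> (complex \<times> complex \<Rightarrow> complex) \<Rightarrow> bool" where
  "continuous_log_on_U f g \<longleftrightarrow> continuous_on U g \<and> g 0 = 0 \<and> (\<forall>u\<in>U. exp (g u) = f u)"

definition regular :: "(real \<Rightarrow> complex \<times> complex \<Rightarrow> complex \<times> complex) \<Rightarrow>
    (real \<Rightarrow> (real \<times> real) measure) \<Rightarrow> bool" where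
  "regular \<psi> \<gamma> \<longleftrightarrow>
    (\<exists>\<nu> F \<phi>. infinitely_divisible \<nu> \<and> continuous_log_on_U (transform \<nu>) F \<and>
      (\<forall>t\<ge>0. continuous_log_on_U (transform (\<gamma> t)) (\<phi> t)) \<and>
      (\<forall>t\<ge>0. \<forall>u\<in>U. set_integrable lborel {0..t} (\<lambda>s. F (\<psi> s u)) \<and>
        \<phi> t u = (LINT s:{0..t}|lborel. F (\<psi> s u))))"

definition absolutely_continuous_on_interval :: "real \<Rightarrow> real \<Rightarrow> (real \<Rightarrow> real) \<Rightarrow> bool" where
  "absolutely_continuous_on_interval a b h \<longleftrightarrow>
    (\<forall>\<epsilon>>0. \<exists>\<delta>>0. \<forall>(n :: nat) l r.
      (\<forall>i<n. a \<le> l i \<and> l i \<le> r i \<and> r i \<le> b) \<and>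
      disjoint_family_on (\<lambda>i. {l i<..<r i}) {..<n} \<and>
      (\<Sum>i<n. r i - l i) < \<delta> \<longrightarrow>
      (\<Sum>i<n. \<bar>h (r i) - h (l i)\<bar>) < \<epsilon>)"

definition absolutely_continuous_on_nonneg :: "(real \<Rightarrow> real) \<Rightarrow> bool" where
  "absolutely_continuous_on_nonneg h \<longleftrightarrow>
    (\<forall>a b. 0 \<le> a \<and> a \<le> b \<longrightarrow> absolutely_continuous_on_interval a b h)"

end

theory Submission
  imports Defs
begin

text \<open>
  Both sides of the equivalence turn out to hold always. Differentiating the transforms at \<open>u = 0\<close> gives
  functional equations for the first moments, such as
  \<open>h2 (r + t) = h1 r * q2 t + h2 r * drift t + h2 t\<close>; the moments are measurable in time, and measurable
  solutions of such equations are explicit exponential polynomials, so \<open>h2\<close> is continuously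
  differentiable.

  For regularity, first moments make the transforms differentiable up to the boundary of \<open>U\<close>. Let \<open>G\<close> be
  the transform of the average of the \<open>\<gamma> r\<close> over \<open>r \<in> [0, \<epsilon>]\<close>. Integrating
  \<open>transform (\<gamma> (r + t)) u = transform (\<gamma> r) (\<psi> t u) * transform (\<gamma> t) u\<close> over \<open>r\<close> exhibits
  \<open>G (\<psi> t u) * transform (\<gamma> t) u\<close> as a moving average, which is differentiable in \<open>t\<close>; the same argument
  for \<open>Q\<close> shows that \<open>t \<mapsto> \<psi> t u\<close> is differentiable. With \<open>F\<close> the time derivative at \<open>0\<close> of the
  transform of \<open>\<gamma>\<close>, the skew convolution equation becomes the linear equation
  \<open>y' = F (\<psi> t u) * y\<close>. Finally \<open>exp (F / k)\<close> is the limit of the transforms of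
  \<open>\<gamma> (1 / (n * k))\<close> convolved \<open>n\<close> times, so the continuity theorem yields the infinitely divisible \<open>\<nu>\<close>.

  The continuity theorem in the plane is reduced to the library's theorem on the line by transporting
  measures along a space-filling curve.
\<close>

section \<open>Sequential compactness of tight measures on the plane\<close>

text \<open>Weak continuity in time says nothing about derivatives of \<open>\<psi>\<close> in
  \<open>t\<close>, nor does it bound first moments near time 0. Both obstacles shape the order of
  the argument. A time average inherits a finite first moment, and hence a transform differentiable
  up to the boundary of \<open>U\<close>, from a bound on the absolute moments of
  \<open>Q s (1, 0)\<close> and \<open>\<gamma> s\<close> for small \<open>s\<close>; that bound is
  drawn from the explicit form of the signed moments. So the moment computation serves regularity as
  well as absolute continuity. The moving average gives one scalar equation for the two coordinates
  of \<open>\<psi> t u\<close>. It can be solved because the second coordinate ranges over the whole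
  line in \<open>D\<close>: this forces \<open>snd (\<psi> t u)\<close> to be a real multiple of
  \<open>snd u\<close>, and only the first coordinate is left unknown. A nonzero derivative in the
  first direction then isolates it.\<close>

definition tooth :: "real \<Rightarrow> real" where
  "tooth t = arccos (cos (pi * t)) / pi"

text \<open>\<open>tooth t\<close> is the distance from \<open>t\<close> to the nearest even
  integer. Hence \<open>clip\<close> has period 2, is 0 where this distance is at most 1/3 and 1
  where it is at least 2/3: the kind of function from which Schoenberg built his space-filling
  curve.\<close>

definition clip :: "real \<Rightarrow> real" where
  "clip t = max 0 (min 1 (3 * tooth t - 1))"

lemma continuous_on_tooth [continuous_intros]:
  "continuous_on A f \<Longrightarrow> continuous_on A (\<lambda>x. tooth (f x))"
proof (erule continuous_on_compose2[rotated])
  show "continuous_on UNIV tooth"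
    unfolding tooth_def by (intro continuous_intros) auto
qed auto

lemma continuous_on_clip [continuous_intros]:
  "continuous_on A f \<Longrightarrow> continuous_on A (\<lambda>x. clip (f x))"
  unfolding clip_def by (intro continuous_intros)

lemma tooth_add_even: "tooth (2 * of_int m + r) = tooth r"
proof -
  have "cos (pi * (2 * of_int m + r)) = cos (pi * r)"
    using cos_int_2pin[of m] sin_int_2pin[of m] by (simp add: distrib_left cos_add mult_ac)
  then show ?thesis by (simp add: tooth_def)
qed

lemma tooth_eq_self: "0 \<le> r \<Longrightarrow> r \<le> 1 \<Longrightarrow> tooth r = r"
  by (simp add: tooth_def arccos_cos)

lemma clip_bounds: "0 \<le> clip t" "clip t \<le> 1"
  by (auto simp: clip_def)

text \<open>Modulo 2 the argument lies in [0, 1/3] or in [2/3, 1], according to \<open>c\<close>,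
  and \<open>clip\<close> is constant on both intervals.\<close>

lemma clip_digit:
  assumes "c \<in> {0, 1::real}" "0 \<le> r" "r \<le> 1/3"
  shows "clip (2 * of_int m + (2/3) * c + r) = c"
  using assms tooth_add_even[of m "(2/3) * c + r"] tooth_eq_self[of "(2/3) * c + r"]
  by (auto simp: clip_def add.assoc)

text \<open>The terms read the ternary digits of \<open>t\<close> at the positions
  \<open>2 * k + i\<close>, counted from 0, and reuse them as binary digits; \<open>i = 0\<close>
  and \<open>i = 1\<close> give the two coordinates.\<close>

definition schoenberg :: "nat \<Rightarrow> real \<Rightarrow> real" where
  "schoenberg i t = (\<Sum>k. clip (3 ^ (2 * k + i) * t) / 2 ^ Suc k)"

lemma continuous_on_schoenberg: "continuous_on A (schoenberg i)"
proof -
  have "uniform_limit A (\<lambda>n t. \<Sum>k<n. clip (3 ^ (2 * k + i) * t) / 2 ^ Suc k) (schoenberg i) sequentially"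
    unfolding schoenberg_def
  proof (rule Weierstrass_m_test)
    show "summable (\<lambda>n. (1/2::real) ^ Suc n)"
      by (simp add: summable_mult)
  qed (use clip_bounds in \<open>auto simp: power_one_over divide_simps\<close>)
  then show ?thesis
    by (rule uniform_limit_theorem[rotated])
      (auto intro!: continuous_intros always_eventually)
qed

text \<open>The digit sums telescope to \<open>b n / 2 ^ n - b 0\<close>, and \<open>x < 1\<close>
  makes \<open>b 0\<close> vanish.\<close>

lemma binary_expansion:
  fixes x :: real
  assumes "0 \<le> x" "x < 1"
  obtains a :: "nat \<Rightarrow> real" where "\<And>k. a k \<in> {0, 1}" "(\<lambda>k. a k / 2 ^ Suc k) sums x"
proof
  define b where "b k = real_of_int \<lfloor>2 ^ k * x\<rfloor>" for k
  define a where "a k = b (Suc k) - 2 * b k" for k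
  show "a k \<in> {0, 1}" for k
  proof -
    have "\<lfloor>2 * (2 ^ k * x)\<rfloor> = 2 * \<lfloor>2 ^ k * x\<rfloor> \<or> \<lfloor>2 * (2 ^ k * x)\<rfloor> = 2 * \<lfloor>2 ^ k * x\<rfloor> + 1"
      by linarith
    then show ?thesis by (auto simp: a_def b_def mult.assoc)
  qed
  have sum: "(\<Sum>k<n. a k / 2 ^ Suc k) = b n / 2 ^ n" for n
  proof (induction n)
    case 0
    then show ?case using assms by (simp add: b_def floor_eq_iff)
  next
    case (Suc n)
    then show ?case by (simp add: a_def field_simps)
  qed
  have "(\<lambda>n. b n / 2 ^ n) \<longlonglongrightarrow> x"
  proof (rule real_tendsto_sandwich)
    show "\<forall>\<^sub>F n in sequentially. x - (1/2) ^ n \<le> b n / 2 ^ n"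
    proof (intro always_eventually allI)
      fix n
      have "2 ^ n * x - 1 \<le> b n" unfolding b_def by linarith
      then have "(2 ^ n * x - 1) / 2 ^ n \<le> b n / 2 ^ n" by (intro divide_right_mono) auto
      then show "x - (1/2) ^ n \<le> b n / 2 ^ n" by (simp add: diff_divide_distrib power_one_over)
    qed
    show "\<forall>\<^sub>F n in sequentially. b n / 2 ^ n \<le> x"
      by (auto simp: b_def field_simps)
    have "(\<lambda>n. (1/2 :: real) ^ n) \<longlonglongrightarrow> 0" by (rule LIMSEQ_power_zero) simp
    then have "(\<lambda>n. x - (1/2) ^ n) \<longlonglongrightarrow> x - 0"
      by (intro tendsto_diff tendsto_const)
    then show "(\<lambda>n. x - (1/2) ^ n) \<longlonglongrightarrow> x" by simp
  qed simp
  then show "(\<lambda>k. a k / 2 ^ Suc k) sums x"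
    unfolding sums_def sum .
qed

text \<open>Schoenberg's argument: if \<open>t\<close> has ternary digits \<open>2 * c k\<close>, then the fractional part of
  \<open>3 ^ k * t\<close> reveals \<open>c k\<close>, and the even and odd digits can be prescribed independently.\<close>

lemma schoenberg_onto:
  fixes x y :: real
  assumes x: "0 \<le> x" "x < 1" and y: "0 \<le> y" "y < 1"
  obtains t where "0 \<le> t" "t \<le> 1" "\<And>m. schoenberg 0 (2 * of_nat m + t) = x"
    "\<And>m. schoenberg 1 (2 * of_nat m + t) = y"
proof -
  obtain a where a: "\<And>k. a k \<in> {0, 1::real}" "(\<lambda>k. a k / 2 ^ Suc k) sums x"
    using binary_expansion[OF x] by metis
  obtain b where b: "\<And>k. b k \<in> {0, 1::real}" "(\<lambda>k. b k / 2 ^ Suc k) sums y"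
    using binary_expansion[OF y] by metis
  define c where "c k = (if even k then a (k div 2) else b (k div 2))" for k
  have c: "c k \<in> {0, 1}" for k using a b by (auto simp: c_def)
  define d where "d k = 2 * c k / 3 ^ Suc k" for k
  have geo: "summable (\<lambda>k. 2 / (3::real) ^ Suc k)" "(\<Sum>k. 2 / (3::real) ^ Suc k) = 1"
  proof -
    have "(\<lambda>k. (2/3) * (1/3::real) ^ k) sums ((2/3) * (1 / (1 - 1/3)))"
      by (intro sums_mult geometric_sums) auto
    then have "(\<lambda>k. 2 / (3::real) ^ Suc k) sums 1" by (simp add: power_one_over field_simps)
    then show "summable (\<lambda>k. 2 / (3::real) ^ Suc k)" "(\<Sum>k. 2 / (3::real) ^ Suc k) = 1"
      by (auto simp: sums_iff)
  qed
  have c01: "0 \<le> c k" "c k \<le> 1" for k using c[of k] by auto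
  have d_nonneg: "0 \<le> d k" and d_le: "d k \<le> 2 / 3 ^ Suc k" for k
    using c01[of k] by (auto simp: d_def divide_simps)
  have d_summable: "summable d"
    by (rule summable_comparison_test'[OF geo(1), of 0]) (use d_nonneg d_le in auto)
  define t where "t = suminf d"
  have "0 \<le> t" unfolding t_def using d_summable d_nonneg by (rule suminf_nonneg)
  moreover have "t \<le> 1" unfolding t_def using suminf_le[OF d_le d_summable geo(1)] geo(2) by simp
  moreover have digit: "clip (3 ^ k * (2 * of_nat m + t)) = c k" for k m
  proof -
    \<comment> \<open>The part of \<open>3 ^ k * t\<close> behind the digit \<open>k\<close>: all
      later digits together contribute at most \<open>1 / 3\<close>.\<close>
    define r where "r = 3 ^ k * (\<Sum>j. d (j + Suc k))"
    have sk: "summable (\<lambda>j. d (j + Suc k))" using d_summable by (rule summable_ignore_initial_segment)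
    have "0 \<le> r" unfolding r_def using suminf_nonneg[OF sk] d_nonneg by simp
    moreover have "r \<le> 1/3"
    proof -
      have "d (j + Suc k) \<le> (1 / 3 ^ Suc k) * (2 / 3 ^ Suc j)" for j
        using d_le[of "j + Suc k"] by (simp add: power_add mult_ac)
      then have "(\<Sum>j. d (j + Suc k)) \<le> (\<Sum>j. (1 / 3 ^ Suc k) * (2 / 3 ^ Suc j))"
        by (intro suminf_le sk summable_mult geo)
      also have "\<dots> = 1 / 3 ^ Suc k" using geo by (subst suminf_mult) auto
      finally show ?thesis by (simp add: r_def field_simps)
    qed
    \<comment> \<open>The digits before \<open>k\<close> are twice integers after the scaling and
      vanish modulo the period 2, as does the shift by \<open>2 * m\<close>.\<close>
    moreover have "\<exists>z::int. 3 ^ k * (\<Sum>j<k. d j) = 2 * of_int z"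
    proof (intro exI)
      have "3 ^ k * d j = 2 * of_int (3 ^ (k - Suc j) * \<lfloor>c j\<rfloor>)" if "j < k" for j
      proof -
        have "(3::real) ^ k = 3 ^ (k - Suc j) * 3 ^ Suc j"
          using that by (simp flip: power_add power_Suc)
        moreover have "c j = of_int \<lfloor>c j\<rfloor>" using c[of j] by auto
        ultimately show ?thesis by (simp add: d_def)
      qed
      then have "(\<Sum>j<k. 3 ^ k * d j) = (\<Sum>j<k. 2 * of_int (3 ^ (k - Suc j) * \<lfloor>c j\<rfloor>))"
        by (intro sum.cong) auto
      then show "3 ^ k * (\<Sum>j<k. d j) = 2 * of_int (\<Sum>j<k. 3 ^ (k - Suc j) * \<lfloor>c j\<rfloor>)"
        by (simp add: sum_distrib_left)
    qed
    then obtain z :: int where z: "3 ^ k * (\<Sum>j<k. d j) = 2 * of_int z" by blast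
    have "t = (\<Sum>j. d (j + Suc k)) + ((\<Sum>j<k. d j) + d k)"
      unfolding t_def using suminf_split_initial_segment[OF d_summable, of "Suc k"] by simp
    then have "3 ^ k * (2 * of_nat m + t) = 2 * of_int (3 ^ k * int m + z) + (2/3) * c k + r"
      using z by (simp add: r_def d_def algebra_simps)
    ultimately show ?thesis using clip_digit[OF c] by presburger
  qed
  moreover have "schoenberg 0 (2 * of_nat m + t) = x" for m
    unfolding schoenberg_def add_0_right digit using a(2) by (simp add: c_def sums_iff)
  moreover have "schoenberg 1 (2 * of_nat m + t) = y" for m
    unfolding schoenberg_def digit using b(2) by (simp add: c_def sums_iff)
  ultimately show ?thesis using that by blast
qed

section \<open>A continuous curve onto the plane and a Borel section of it\<close>

definition plane_curve :: "real \<Rightarrow> real \<times> real" where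
  "plane_curve t =
    ((t - tooth t) * (2 * schoenberg 0 t - 1), (t - tooth t) * (2 * schoenberg 1 t - 1))"

lemma continuous_on_plane_curve: "continuous_on A plane_curve"
  unfolding plane_curve_def
  by (intro continuous_intros continuous_on_schoenberg continuous_on_subset[OF continuous_on_schoenberg])

text \<open>On \<open>[2 * m, 2 * m + 1]\<close> the factor \<open>t - tooth t\<close> is constantly \<open>2 * m\<close>, so the curve fills
  \<open>[-2 * m, 2 * m)\<close> squared there.\<close>

lemma plane_curve_onto:
  fixes x :: "real \<times> real"
  assumes "norm x < 2 * real m"
  obtains t where "0 \<le> t" "t \<le> 2 * real m + 1" "plane_curve t = x"
proof -
  have m: "0 < real m" using assms norm_ge_zero[of x] by linarith
  have "\<bar>fst x\<bar> < 2 * real m" "\<bar>snd x\<bar> < 2 * real m"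
    using norm_fst_le[of "fst x" "snd x"] norm_snd_le[of "snd x" "fst x"] assms by auto
  then have *: "0 \<le> (fst x / (2 * real m) + 1) / 2" "(fst x / (2 * real m) + 1) / 2 < 1"
     "0 \<le> (snd x / (2 * real m) + 1) / 2" "(snd x / (2 * real m) + 1) / 2 < 1"
    using m by (auto simp: divide_simps)
  obtain t where t: "0 \<le> t" "t \<le> 1" "schoenberg 0 (2 * of_nat m + t) = (fst x / (2 * real m) + 1) / 2"
    "schoenberg 1 (2 * of_nat m + t) = (snd x / (2 * real m) + 1) / 2"
    using schoenberg_onto[OF *] by metis
  have "tooth (2 * real m + t) = t" using tooth_add_even[of "int m" t] tooth_eq_self t by simp
  then have "plane_curve (2 * real m + t) = x"
    using t m by (cases x) (simp add: plane_curve_def field_simps)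
  then show ?thesis using that[of "2 * real m + t"] t by simp
qed

text \<open>The least parameter is taken because its sublevel sets are images of compact intervals
  under the curve, which makes this right inverse Borel measurable.\<close>

definition plane_param :: "real \<times> real \<Rightarrow> real" where
  "plane_param x = Inf {t. 0 \<le> t \<and> plane_curve t = x}"

lemma plane_param_attained:
  "0 \<le> plane_param x \<and> plane_curve (plane_param x) = x"
proof -
  define S where "S = {t. 0 \<le> t \<and> plane_curve t = x}"
  obtain m :: nat where "norm x / 2 < real m" using reals_Archimedean2 by blast
  then have "norm x < 2 * real m" by simp
  then have "S \<noteq> {}" using plane_curve_onto[of x m] by (auto simp: S_def)
  moreover have "closed S"
    unfolding S_def by (intro closed_Collect_conj closed_Collect_le closed_Collect_eq continuous_intros
       continuous_on_plane_curve)
  moreover have "bdd_below S" by (auto simp: S_def bdd_below_def)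
  ultimately have "Inf S \<in> S" by (intro closed_contains_Inf)
  then show ?thesis by (simp add: S_def plane_param_def)
qed

lemma plane_param_le_iff: "plane_param x \<le> a \<longleftrightarrow> x \<in> plane_curve ` {0..a}"
proof
  assume "plane_param x \<le> a"
  then show "x \<in> plane_curve ` {0..a}" using plane_param_attained[of x] by (metis atLeastAtMost_iff imageI)
next
  assume "x \<in> plane_curve ` {0..a}"
  then obtain t where t: "0 \<le> t" "t \<le> a" "plane_curve t = x" by auto
  then have "plane_param x \<le> t" unfolding plane_param_def by (intro cInf_lower) (auto simp: bdd_below_def)
  then show "plane_param x \<le> a" using t by simp
qed

text \<open>Bounded sets of the plane have bounded parameters, so tightness passes to the
  line.\<close>

lemma plane_param_bound:
  assumes "norm x < 2 * real m" shows "plane_param x \<le> 2 * real m + 1"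
  using plane_curve_onto[OF assms] plane_param_le_iff by (metis atLeastAtMost_iff imageI)

lemma borel_measurable_plane_curve [measurable]: "plane_curve \<in> borel_measurable borel"
  by (intro borel_measurable_continuous_onI continuous_on_plane_curve)

lemma borel_measurable_plane_param [measurable]: "plane_param \<in> borel_measurable borel"
proof (subst borel_measurable_iff_le, intro allI)
  fix a
  have "compact (plane_curve ` {0..a})"
    by (intro compact_continuous_image continuous_on_plane_curve compact_Icc)
  then show "{w \<in> space borel. plane_param w \<le> a} \<in> sets borel"
    by (simp add: plane_param_le_iff borel_compact)
qed

text \<open>The measures are carried to the line by \<open>plane_param\<close>, a subsequence is
  extracted there, and its limit is carried back by \<open>plane_curve\<close>. The discontinuity of
  \<open>plane_param\<close> does no harm: a test function \<open>f\<close> enters as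
  \<open>f \<circ> plane_curve\<close>, which is continuous, and
  \<open>plane_curve (plane_param x) = x\<close>.\<close>

lemma tight_plane_imp_convergent_subsequence:
  fixes M :: "nat \<Rightarrow> (real \<times> real) measure"
  assumes sets [measurable_cong]: "\<And>n. sets (M n) = sets borel" and prob: "\<And>n. prob_space (M n)"
    and tight: "\<And>\<epsilon>. 0 < \<epsilon> \<Longrightarrow> \<exists>K. \<forall>n. 1 - \<epsilon> < measure (M n) {x. norm x < K}"
  obtains r N where "strict_mono (r :: nat \<Rightarrow> nat)" "prob_space N" "sets N = sets borel"
    "\<And>(f :: real \<times> real \<Rightarrow> complex) B. continuous_on UNIV f \<Longrightarrow> (\<And>x. norm (f x) \<le> B) \<Longrightarrow>
      (\<lambda>n. integral\<^sup>L (M (r n)) f) \<longlonglongrightarrow> integral\<^sup>L N f"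
proof -
  interpret M: prob_space "M n" for n by (rule prob)
  have spM: "space (M n) = UNIV" for n using sets_eq_imp_space_eq[OF sets[of n]] by simp
  define L where "L n = distr (M n) borel plane_param" for n
  have real_distr: "real_distribution (L n)" for n
    unfolding L_def by (intro M.real_distribution_distr) measurable
  have "tight L"
    unfolding tight_def
  proof (intro conjI allI impI real_distr)
    fix \<epsilon> :: real assume "0 < \<epsilon>"
    then obtain K where K: "\<And>n. 1 - \<epsilon> < measure (M n) {x. norm x < K}" using tight by metis
    obtain m :: nat where m: "K < real m" using reals_Archimedean2 by blast
    have "1 - \<epsilon> < measure (L n) {-1<..2 * real m + 1}" for n
    proof -
      have "plane_param x \<in> {-1<..2 * real m + 1}" if "norm x < K" for x
        using plane_param_bound[of x m] plane_param_attained[of x] that m by auto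
      then have "{x. norm x < K} \<subseteq> plane_param -` {-1<..2 * real m + 1} \<inter> space (M n)"
        by (auto simp: spM)
      then have "measure (M n) {x. norm x < K} \<le> measure (M n) (plane_param -` {-1<..2 * real m + 1} \<inter> space (M n))"
        by (intro M.finite_measure_mono) measurable
      also have "\<dots> = measure (L n) {-1<..2 * real m + 1}"
        unfolding L_def by (subst measure_distr) auto
      finally show ?thesis using K[of n] by linarith
    qed
    then show "\<exists>a b. a < b \<and> (\<forall>n. 1 - \<epsilon> < measure (L n) {a<..b})"
      by (intro exI[of _ "-1"] exI[of _ "2 * real m + 1"]) auto
  qed
  then obtain r N where r: "strict_mono r" "real_distribution N" "weak_conv_m (L \<circ> r) N"
    using tight_imp_convergent_subsubsequence[of L id] by (auto simp: strict_mono_def)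
  interpret N: real_distribution N by (rule r)
  define N' where "N' = distr N borel plane_curve"
  have "(\<lambda>n. integral\<^sup>L (M (r n)) f) \<longlonglongrightarrow> integral\<^sup>L N' f"
    if f: "continuous_on UNIV f" "\<And>x. norm (f x) \<le> B" for f :: "real \<times> real \<Rightarrow> complex" and B
  proof -
    have [measurable]: "f \<in> borel_measurable borel" by (intro borel_measurable_continuous_onI f)
    have cont: "continuous_on UNIV (f \<circ> plane_curve)"
      by (intro continuous_on_compose continuous_on_plane_curve continuous_on_subset[OF f(1)]) auto
    have "(\<lambda>n. integral\<^sup>L ((L \<circ> r) n) (f \<circ> plane_curve)) \<longlonglongrightarrow> integral\<^sup>L N (f \<circ> plane_curve)"
    proof (rule weak_conv_imp_integral_bdd_continuous_conv[where B = B])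
      show "real_distribution ((L \<circ> r) n)" for n using real_distr by simp
      show "isCont (f \<circ> plane_curve) x" for x
        using cont by (simp add: continuous_on_eq_continuous_at o_def)
    qed (use r f in \<open>simp_all add: o_def\<close>)
    moreover have "integral\<^sup>L ((L \<circ> r) n) (f \<circ> plane_curve) = integral\<^sup>L (M (r n)) f" for n
      unfolding L_def using plane_param_attained by (simp add: integral_distr)
    moreover have "integral\<^sup>L N (f \<circ> plane_curve) = integral\<^sup>L N' f"
      unfolding N'_def by (simp add: integral_distr o_def)
    ultimately show ?thesis by simp
  qed
  moreover have "prob_space N'" unfolding N'_def by (intro N.prob_space_distr) measurable
  moreover have "sets N' = sets borel" by (simp add: N'_def)
  ultimately show ?thesis using that r by blast
qed

section \<open>The transform on the half plane\<close>

lemma space_MD [simp]: "space MD = D"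
  by (simp add: space_restrict_space)

lemma measurable_MD_borel [measurable (raw)]: "f \<in> borel_measurable borel \<Longrightarrow> f \<in> borel_measurable MD"
  by (rule measurable_restrict_space1)

lemma D_sets [measurable]: "D \<in> sets borel"
  unfolding D_def by (intro borel_closed closed_Times) auto

lemma zero_mem_D [simp]: "0 \<in> D"
  by (simp add: D_def zero_prod_def)

lemma zero_mem_U [simp]: "0 \<in> U"
  by (simp add: U_def zero_prod_def)

lemma borel_measurable_pairing [measurable]: "pairing u \<in> borel_measurable borel"
  unfolding pairing_def[abs_def] by (intro borel_measurable_continuous_onI continuous_intros)

lemma pairing_0 [simp]: "pairing 0 \<xi> = 0" "pairing u 0 = 0"
  by (simp_all add: pairing_def)

lemma pairing_diff_left: "pairing (u - v) \<xi> = pairing u \<xi> - pairing v \<xi>"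
  by (simp add: pairing_def algebra_simps)

lemma pairing_add_right: "pairing u (\<xi> + \<eta>) = pairing u \<xi> + pairing u \<eta>"
  by (simp add: pairing_def algebra_simps)

lemma Re_pairing_nonpos: "u \<in> U \<Longrightarrow> \<xi> \<in> D \<Longrightarrow> Re (pairing u \<xi>) \<le> 0"
  by (auto simp: U_def D_def pairing_def mult_nonpos_nonneg)

lemma norm_exp_pairing_le: "u \<in> U \<Longrightarrow> \<xi> \<in> D \<Longrightarrow> norm (exp (pairing u \<xi>)) \<le> 1"
  by (simp add: Re_pairing_nonpos)

lemma prob_algebra_MDD:
  assumes "\<mu> \<in> space (prob_algebra MD)"
  shows "prob_space \<mu>" "sets \<mu> = sets MD" "space \<mu> = D"
  using assms sets_eq_imp_space_eq[of \<mu> MD] by (auto simp: space_prob_algebra)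

lemma borel_measurable_prob_MD:
  assumes \<mu>: "\<mu> \<in> space (prob_algebra MD)" and f: "f \<in> borel_measurable borel"
  shows "f \<in> borel_measurable \<mu>"
  using measurable_MD_borel[OF f] measurable_cong_sets[OF prob_algebra_MDD(2)[OF \<mu>] refl] by blast

lemma borel_measurable_fst_snd [measurable]:
  "(fst :: real \<times> real \<Rightarrow> real) \<in> borel_measurable borel"
  "(snd :: real \<times> real \<Rightarrow> real) \<in> borel_measurable borel"
  by (intro borel_measurable_continuous_onI continuous_intros)+

lemma integrable_bounded_MD:
  fixes f :: "_ \<Rightarrow> 'b :: {banach, second_countable_topology}"
  assumes \<mu>: "\<mu> \<in> space (prob_algebra MD)" and f: "f \<in> borel_measurable MD" "\<And>\<xi>. \<xi> \<in> D \<Longrightarrow> norm (f \<xi>) \<le> B"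
  shows "integrable \<mu> f"
proof -
  interpret prob_space \<mu> using \<mu> by (rule prob_algebra_MDD)
  have "f \<in> borel_measurable \<mu>" using f prob_algebra_MDD(2)[OF \<mu>] measurable_cong_sets by blast
  then show ?thesis
    by (intro integrable_const_bound[where B = B] AE_I2) (use f prob_algebra_MDD[OF \<mu>] in auto)
qed

lemma integrable_exp_pairing:
  assumes "\<mu> \<in> space (prob_algebra MD)" "u \<in> U"
  shows "integrable \<mu> (\<lambda>\<xi>. exp (pairing u \<xi>))"
  by (rule integrable_bounded_MD[where B = 1]) (use assms norm_exp_pairing_le in auto)

lemma norm_transform_le:
  assumes \<mu>: "\<mu> \<in> space (prob_algebra MD)" and u: "u \<in> U"
  shows "norm (transform \<mu> u) \<le> 1"
proof -
  interpret prob_space \<mu> using \<mu> by (rule prob_algebra_MDD)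
  have "norm (transform \<mu> u) \<le> (LINT \<xi>|\<mu>. norm (exp (pairing u \<xi>)))"
    unfolding transform_def by (rule integral_norm_bound)
  also have "\<dots> \<le> (LINT \<xi>|\<mu>. 1)"
    using u prob_algebra_MDD[OF \<mu>] norm_exp_pairing_le
    by (intro integral_mono integrable_norm integrable_exp_pairing \<mu>) auto
  finally show ?thesis by (simp add: prob_space)
qed

lemma transform_0: "\<mu> \<in> space (prob_algebra MD) \<Longrightarrow> transform \<mu> 0 = 1"
  using prob_space.prob_space[OF prob_algebra_MDD(1)] by (simp add: transform_def)

section \<open>The transform determines the measure\<close>

text \<open>Levy's theorem is applied to the law of \<open>X\<close> under the density
  \<open>w / c\<close>. The total masses \<open>c\<close> agree by the case \<theta> = 0; if they
  are 0, then \<open>w\<close> vanishes almost everywhere for both measures.\<close>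

lemma weighted_char_unique:
  fixes w X :: "'a \<Rightarrow> real"
  assumes M: "finite_measure M" and N: "finite_measure N" and sets: "sets N = sets M"
    and w [measurable]: "w \<in> borel_measurable M" and X [measurable]: "X \<in> borel_measurable M"
    and w_bounds: "\<And>x. x \<in> space M \<Longrightarrow> 0 \<le> w x" "\<And>x. x \<in> space M \<Longrightarrow> w x \<le> B"
    and eq: "\<And>\<theta>. (CLINT x|M. w x * iexp (\<theta> * X x)) = (CLINT x|N. w x * iexp (\<theta> * X x))"
    and A [measurable]: "A \<in> sets borel"
  shows "(LINT x|M. w x * indicator A (X x)) = (LINT x|N. w x * indicator A (X x))"
proof -
  note [measurable_cong] = sets
  interpret M: finite_measure M by fact
  interpret N: finite_measure N by fact
  have sp: "space N = space M" using sets by (rule sets_eq_imp_space_eq)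
  have int: "integrable M w" "integrable N w"
    by (auto intro!: M.integrable_const_bound[where B = B] N.integrable_const_bound[where B = B]
        AE_I2 simp: w_bounds sp)
  define c where "c = (LINT x|M. w x)"
  have cN: "c = (LINT x|N. w x)"
    using eq[of 0] by (simp add: c_def)
  have c_nonneg: "0 \<le> c" unfolding c_def using w_bounds by (intro integral_nonneg_AE AE_I2) auto
  show ?thesis
  proof (cases "c = 0")
    case True
    have "AE x in M. w x = 0"
      using True int w_bounds by (subst integral_nonneg_eq_0_iff_AE[symmetric]) (auto simp: c_def)
    moreover have "AE x in N. w x = 0"
      using True cN int w_bounds sp by (subst integral_nonneg_eq_0_iff_AE[symmetric]) auto
    ultimately have "(LINT x|M. w x * indicator A (X x)) = 0" "(LINT x|N. w x * indicator A (X x)) = 0"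
      by (auto intro!: integral_eq_zero_AE)
    then show ?thesis by simp
  next
    case False
    with c_nonneg have c: "0 < c" by simp
    define T where "T K = distr (density K (\<lambda>x. ennreal (w x / c))) borel X" for K
    have T: "real_distribution (T K) \<and> (\<forall>\<theta>. char (T K) \<theta> = (CLINT x|K. w x * iexp (\<theta> * X x)) / c)
        \<and> measure (T K) A = (LINT x|K. w x * indicator A (X x)) / c"
      if K: "finite_measure K" "sets K = sets M" "integrable K w" "(LINT x|K. w x) = c" for K
    proof -
      note [measurable_cong] = K(2)
      have spK: "space K = space M" using K(2) by (rule sets_eq_imp_space_eq)
      have nn: "\<And>x. x \<in> space K \<Longrightarrow> 0 \<le> w x / c" using w_bounds c spK by auto
      have "emeasure (density K (\<lambda>x. ennreal (w x / c))) (space K) = (\<integral>\<^sup>+x. ennreal (w x / c) \<partial>K)"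
        by (subst emeasure_density) (auto intro!: nn_integral_cong)
      also have "\<dots> = ennreal (LINT x|K. w x / c)"
        using K nn by (intro nn_integral_eq_integral integrable_divide AE_I2) auto
      finally have em: "emeasure (density K (\<lambda>x. ennreal (w x / c))) (space K) = 1"
        using K c by simp
      interpret P: prob_space "density K (\<lambda>x. ennreal (w x / c))"
        by (rule prob_spaceI) (simp add: em)
      have rd: "real_distribution (T K)"
        unfolding T_def by (intro P.real_distribution_distr) simp
      have "char (T K) \<theta> = (CLINT x|K. (w x / c) *\<^sub>R iexp (\<theta> * X x))" for \<theta>
        unfolding char_def T_def
        by (subst integral_distr, simp, simp, subst integral_density) (use nn in \<open>auto intro!: AE_I2\<close>)
      also have "(CLINT x|K. (w x / c) *\<^sub>R iexp (\<theta> * X x)) = (CLINT x|K. w x * iexp (\<theta> * X x)) / c" for \<theta>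
        by (subst integral_divide_zero[symmetric]) (simp add: scaleR_conv_of_real)
      finally have ch: "char (T K) \<theta> = (CLINT x|K. w x * iexp (\<theta> * X x)) / c" for \<theta> .
      have "measure (T K) A = (LINT x|T K. indicator A x)"
        by (simp add: T_def)
      also have "\<dots> = (LINT x|K. (w x / c) *\<^sub>R indicator A (X x))"
        unfolding T_def
        by (subst integral_distr, simp, simp, subst integral_density) (use nn in \<open>auto intro!: AE_I2\<close>)
      also have "\<dots> = (LINT x|K. w x * indicator A (X x)) / c"
        by (subst integral_divide_zero[symmetric]) simp
      finally show ?thesis using rd ch by blast
    qed
    have TM: "real_distribution (T M)" "\<And>\<theta>. char (T M) \<theta> = (CLINT x|M. w x * iexp (\<theta> * X x)) / c"
      "measure (T M) A = (LINT x|M. w x * indicator A (X x)) / c"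
      using T[of M] M int c_def by auto
    have TN: "real_distribution (T N)" "\<And>\<theta>. char (T N) \<theta> = (CLINT x|N. w x * iexp (\<theta> * X x)) / c"
      "measure (T N) A = (LINT x|N. w x * indicator A (X x)) / c"
      using T[of N] N int cN sets by auto
    have "T M = T N"
      by (rule Levy_uniqueness[OF TM(1) TN(1)]) (simp add: TM TN eq fun_eq_iff del: of_real_mult)
    then show ?thesis using TM TN c by simp
  qed
qed

text \<open>Reduction to Levy's one-dimensional uniqueness theorem by weighting with the
  nonnegative functions \<open>1 + cos (\<theta> * \<xi>\<^sub>2)\<close> and \<open>1 + sin (\<theta> * \<xi>\<^sub>2)\<close>.\<close>

lemma transform_unique:
  assumes \<mu>: "\<mu> \<in> space (prob_algebra MD)" and \<nu>: "\<nu> \<in> space (prob_algebra MD)"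
    and eq: "\<And>u. u \<in> U \<Longrightarrow> transform \<mu> u = transform \<nu> u"
  shows "\<mu> = \<nu>"
proof -
  interpret \<mu>: prob_space \<mu> using \<mu> by (rule prob_algebra_MDD)
  interpret \<nu>: prob_space \<nu> using \<nu> by (rule prob_algebra_MDD)
  note sp = prob_algebra_MDD(3)[OF \<mu>] prob_algebra_MDD(3)[OF \<nu>]
  note [measurable_cong] = prob_algebra_MDD(2)[OF \<mu>] prob_algebra_MDD(2)[OF \<nu>]
  have sets: "sets \<nu> = sets \<mu>" using prob_algebra_MDD(2)[OF \<mu>] prob_algebra_MDD(2)[OF \<nu>] by simp
  have fin: "finite_measure \<mu>" "finite_measure \<nu>" by unfold_locales
  \<comment> \<open>At imaginary arguments the transform is the characteristic function in the
    plane.\<close>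
  have E: "(CLINT \<xi>|\<mu>. iexp (a * fst \<xi> + b * snd \<xi>)) = (CLINT \<xi>|\<nu>. iexp (a * fst \<xi> + b * snd \<xi>))" for a b
    using eq[of "(\<i> * a, \<i> * b)"] by (simp add: transform_def pairing_def U_def algebra_simps)
  have E': "(CLINT \<xi>|\<mu>. iexp (a * fst \<xi>)) = (CLINT \<xi>|\<nu>. iexp (a * fst \<xi>))"
    "(CLINT \<xi>|\<mu>. iexp (a * fst \<xi> - b * snd \<xi>)) = (CLINT \<xi>|\<nu>. iexp (a * fst \<xi> - b * snd \<xi>))" for a b
    using E[of a 0] E[of a "-b"] by (simp_all del: of_real_add of_real_mult of_real_diff)
  have int_iexp: "complex_integrable \<mu> (\<lambda>\<xi>. iexp (f \<xi>))" "complex_integrable \<nu> (\<lambda>\<xi>. iexp (f \<xi>))"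
    if [measurable]: "f \<in> borel_measurable borel" for f
    by (auto intro!: \<mu>.integrable_const_bound[where B = 1] \<nu>.integrable_const_bound[where B = 1])
  have [simp]: "complex_integrable \<mu> (\<lambda>\<xi>. iexp (a * fst \<xi>))" "complex_integrable \<nu> (\<lambda>\<xi>. iexp (a * fst \<xi>))"
     "complex_integrable \<mu> (\<lambda>\<xi>. iexp (a * fst \<xi> + b * snd \<xi>))" "complex_integrable \<nu> (\<lambda>\<xi>. iexp (a * fst \<xi> + b * snd \<xi>))"
     "complex_integrable \<mu> (\<lambda>\<xi>. iexp (a * fst \<xi> - b * snd \<xi>))" "complex_integrable \<nu> (\<lambda>\<xi>. iexp (a * fst \<xi> - b * snd \<xi>))"
     for a b by (intro int_iexp borel_measurable_continuous_onI continuous_intros)+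
  \<comment> \<open>The weights are trigonometric polynomials, so the weighted integrals are
    combinations of values of the characteristic function.\<close>
  have exps: "complex_of_real (1 + cos (b * y)) * iexp (a * x)
      = iexp (a * x) + iexp (a * x + b * y) / 2 + iexp (a * x - b * y) / 2"
    "complex_of_real (1 + sin (b * y)) * iexp (a * x)
      = iexp (a * x) + iexp (a * x + b * y) / (2 * \<i>) - iexp (a * x - b * y) / (2 * \<i>)" for a b x y :: real
    by (auto simp: complex_eq_iff Re_exp Im_exp cos_add sin_add cos_diff sin_diff algebra_simps Re_divide Im_divide)
      (auto simp: field_simps)
  note bm = borel_measurable_prob_MD[OF \<mu>] borel_measurable_prob_MD[OF \<nu>]
  have bounds: "0 \<le> 1 + cos x" "1 + cos x \<le> 2" "0 \<le> 1 + sin x" "1 + sin x \<le> 2" for x :: real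
    using cos_ge_minus_one[of x] cos_le_one[of x] sin_ge_minus_one[of x] sin_le_one[of x] by linarith+
  have cos: "(LINT \<xi>|\<mu>. (1 + cos (b * snd \<xi>)) * indicator A (fst \<xi>))
      = (LINT \<xi>|\<nu>. (1 + cos (b * snd \<xi>)) * indicator A (fst \<xi>))" if "A \<in> sets borel" for A b
  proof (rule weighted_char_unique[where B = 2, OF fin sets])
    show "\<And>\<theta>. (CLINT \<xi>|\<mu>. complex_of_real (1 + cos (b * snd \<xi>)) * iexp (\<theta> * fst \<xi>))
        = (CLINT \<xi>|\<nu>. complex_of_real (1 + cos (b * snd \<xi>)) * iexp (\<theta> * fst \<xi>))"
      unfolding exps by (simp add: E E' del: of_real_add of_real_mult of_real_diff)
  qed (auto intro!: that bounds bm borel_measurable_continuous_onI continuous_intros)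
  have sin: "(LINT \<xi>|\<mu>. (1 + sin (b * snd \<xi>)) * indicator A (fst \<xi>))
      = (LINT \<xi>|\<nu>. (1 + sin (b * snd \<xi>)) * indicator A (fst \<xi>))" if "A \<in> sets borel" for A b
  proof (rule weighted_char_unique[where B = 2, OF fin sets])
    show "\<And>\<theta>. (CLINT \<xi>|\<mu>. complex_of_real (1 + sin (b * snd \<xi>)) * iexp (\<theta> * fst \<xi>))
        = (CLINT \<xi>|\<nu>. complex_of_real (1 + sin (b * snd \<xi>)) * iexp (\<theta> * fst \<xi>))"
      unfolding exps by (simp add: E E' del: of_real_add of_real_mult of_real_diff)
  qed (auto intro!: that bounds bm borel_measurable_continuous_onI continuous_intros)
  have rect: "measure \<mu> ((A \<times> B) \<inter> D) = measure \<nu> ((A \<times> B) \<inter> D)"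
    if A: "A \<in> sets borel" and B: "B \<in> sets borel" for A B
  proof -
    note [measurable] = A B
    have int_f [simp]: "integrable \<mu> (\<lambda>\<xi>. f \<xi> * indicator A (fst \<xi>))" "integrable \<nu> (\<lambda>\<xi>. f \<xi> * indicator A (fst \<xi>))"
      if [measurable]: "f \<in> borel_measurable borel" and f: "\<And>\<xi>. \<bar>f \<xi>\<bar> \<le> 1" for f :: "real \<times> real \<Rightarrow> real"
      by (auto intro!: \<mu>.integrable_const_bound[where B = 1] \<nu>.integrable_const_bound[where B = 1]
         AE_I2 mult_le_one f bm simp: abs_mult split: split_indicator)
    have int1 [simp]: "integrable \<mu> (\<lambda>\<xi>. indicator A (fst \<xi>) :: real)" "integrable \<nu> (\<lambda>\<xi>. indicator A (fst \<xi>) :: real)"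
      using int_f[of "\<lambda>_. 1"] by auto
    have 1: "(LINT \<xi>|\<mu>. indicator A (fst \<xi>) :: real) = (LINT \<xi>|\<nu>. indicator A (fst \<xi>))"
      using cos[OF A, of 0] by simp
    have c: "(LINT \<xi>|\<mu>. cos (b * snd \<xi>) * indicator A (fst \<xi>)) = (LINT \<xi>|\<nu>. cos (b * snd \<xi>) * indicator A (fst \<xi>))" for b
      using cos[OF A, of b] 1 by (simp add: distrib_right)
    have s: "(LINT \<xi>|\<mu>. sin (b * snd \<xi>) * indicator A (fst \<xi>)) = (LINT \<xi>|\<nu>. sin (b * snd \<xi>) * indicator A (fst \<xi>))" for b
      using sin[OF A, of b] 1 by (simp add: distrib_right)
    \<comment> \<open>The coordinates now change roles: \<open>indicator A (fst \<xi>)\<close> is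
      the weight, and its weighted characteristic function in \<open>snd \<xi>\<close> is known from
      the cosine and sine weights.\<close>
    have "(LINT \<xi>|\<mu>. indicator A (fst \<xi>) * indicator B (snd \<xi>) :: real) = (LINT \<xi>|\<nu>. indicator A (fst \<xi>) * indicator B (snd \<xi>))"
    proof (rule weighted_char_unique[where B = 1, OF fin sets])
      fix \<theta>
      have *: "complex_of_real (indicator A x) * iexp (\<theta> * y)
        = of_real (cos (\<theta> * y) * indicator A x) + \<i> * of_real (sin (\<theta> * y) * indicator A x)" for x y
        by (auto simp: complex_eq_iff Re_exp Im_exp)
      show "(CLINT \<xi>|\<mu>. complex_of_real (indicator A (fst \<xi>)) * iexp (\<theta> * snd \<xi>))
          = (CLINT \<xi>|\<nu>. complex_of_real (indicator A (fst \<xi>)) * iexp (\<theta> * snd \<xi>))"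
        unfolding * by (subst (1 2) Bochner_Integration.integral_add)
          (simp_all del: of_real_mult add: c s)
    qed auto
    moreover have "(LINT \<xi>|\<kappa>. indicator A (fst \<xi>) * indicator B (snd \<xi>) :: real) = measure \<kappa> ((A \<times> B) \<inter> D)"
      if "space \<kappa> = D" for \<kappa> :: "(real \<times> real) measure"
    proof -
      have "(LINT \<xi>|\<kappa>. indicator A (fst \<xi>) * indicator B (snd \<xi>) :: real) = (LINT \<xi>|\<kappa>. indicator (A \<times> B) \<xi>)"
        by (intro Bochner_Integration.integral_cong) (auto split: split_indicator)
      then show ?thesis by (simp add: that)
    qed
    ultimately show ?thesis using sp by metis
  qed
  have "distr \<mu> borel (\<lambda>x. x) = distr \<nu> borel (\<lambda>x. x)"
  proof (rule measure_eqI_generator_eq[where \<Omega> = UNIV and A = "\<lambda>_. UNIV"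
        and E = "{a \<times> b | a b. a \<in> sets (borel :: real measure) \<and> b \<in> sets (borel :: real measure)}"])
    show "Int_stable {a \<times> b | a b. a \<in> sets (borel :: real measure) \<and> b \<in> sets (borel :: real measure)}"
      by (rule Int_stable_pair_measure_generator)
    have "sets (borel :: (real \<times> real) measure) = sigma_sets UNIV {a \<times> b | a b. a \<in> sets (borel :: real measure) \<and> b \<in> sets (borel :: real measure)}"
      using sets_pair_measure[of "borel :: real measure" "borel :: real measure"] unfolding borel_prod by simp
    then show "sets (distr \<mu> borel (\<lambda>x. x)) = sigma_sets UNIV {a \<times> b | a b. a \<in> sets (borel :: real measure) \<and> b \<in> sets (borel :: real measure)}"
      "sets (distr \<nu> borel (\<lambda>x. x)) = sigma_sets UNIV {a \<times> b | a b. a \<in> sets (borel :: real measure) \<and> b \<in> sets (borel :: real measure)}"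
      by auto
    show "range (\<lambda>_. UNIV) \<subseteq> {a \<times> b | a b. a \<in> sets (borel :: real measure) \<and> b \<in> sets (borel :: real measure)}"
      by (auto intro!: exI[of _ UNIV])
    fix X :: "(real \<times> real) set"
    assume "X \<in> {a \<times> b | a b. a \<in> sets (borel :: real measure) \<and> b \<in> sets (borel :: real measure)}"
    then obtain A B where X: "X = A \<times> B" and [measurable]: "A \<in> sets borel" "B \<in> sets borel" by blast
    have "X \<in> sets borel" unfolding X borel_prod[symmetric] by measurable
    then show "emeasure (distr \<mu> borel (\<lambda>x. x)) X = emeasure (distr \<nu> borel (\<lambda>x. x)) X"
      using rect[of A B] sp by (simp add: emeasure_distr X \<mu>.emeasure_eq_measure \<nu>.emeasure_eq_measure)
  next
    have "emeasure (distr \<mu> borel (\<lambda>x. x)) UNIV \<le> 1"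
      using \<mu>.emeasure_space_1 by (subst emeasure_distr) auto
    then show "emeasure (distr \<mu> borel (\<lambda>x. x)) UNIV \<noteq> \<infinity>" by (auto simp: top_unique)
  qed auto
  then have eq_distr: "emeasure (distr \<mu> borel (\<lambda>x. x)) C = emeasure (distr \<nu> borel (\<lambda>x. x)) C" for C
    by simp
  have eq_borel: "emeasure \<mu> (C \<inter> D) = emeasure \<nu> (C \<inter> D)" if "C \<in> sets borel" for C
    using eq_distr[of C] that sp by (simp add: emeasure_distr)
  show ?thesis
  proof (rule measure_eqI)
    fix X assume "X \<in> sets \<mu>"
    then have "X \<in> (\<inter>) D ` sets borel"
      using prob_algebra_MDD(2)[OF \<mu>] by (simp add: sets_restrict_space)
    then show "emeasure \<mu> X = emeasure \<nu> X" using eq_borel by (auto simp: Int_commute)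
  qed (simp add: sets)
qed

section \<open>Tightness from characteristic functions and the continuity theorem\<close>

lemma integral_one_minus_cos:
  fixes u x :: real
  assumes "0 < u"
  shows "(LINT t|restrict_space lborel {0..u}. 1 - cos (t * x)) = (if x = 0 then 0 else u - sin (u * x) / x)"
proof (cases "x = 0")
  case False
  have "has_bochner_integral lborel (\<lambda>t. indicator {0..u} t *\<^sub>R (1 - cos (t * x)))
      ((u - sin (u * x) / x) - (0 - sin (0 * x) / x))"
    using assms False
    by (intro has_bochner_integral_FTC_Icc)
      (auto intro!: derivative_eq_intros continuous_intros simp flip: has_real_derivative_iff_has_vector_derivative)
  then show ?thesis using False by (simp add: integral_restrict_space has_bochner_integral_iff)
qed simp

text \<open>\<open>sin (u * x) / x\<close> has modulus at most \<open>u\<close>, and at most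
  \<open>u / 2\<close> as soon as \<open>2 / u\<close> is at most the modulus of
  \<open>x\<close>.\<close>

lemma one_minus_sinc_ge:
  fixes u x :: real
  assumes "0 < u"
  shows "u / 2 * indicator {x. 2 / u \<le> \<bar>x\<bar>} x \<le> (if x = 0 then 0 else u - sin (u * x) / x)"
proof (cases "x = 0")
  case False
  have *: "sin (u * x) / x \<le> u"
  proof -
    have "\<bar>sin (u * x)\<bar> \<le> u * \<bar>x\<bar>" using abs_sin_x_le_abs_x[of "u * x"] assms by (simp add: abs_mult)
    then have "\<bar>sin (u * x) / x\<bar> \<le> u" using False by (simp add: abs_divide divide_le_eq)
    then show ?thesis by linarith
  qed
  have "sin (u * x) / x \<le> u / 2" if "2 / u \<le> \<bar>x\<bar>"
  proof -
    have "\<bar>sin (u * x) / x\<bar> \<le> 1 / \<bar>x\<bar>" by (simp add: abs_divide divide_right_mono)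
    also have "\<dots> \<le> u / 2" using that assms False by (simp add: field_simps)
    finally show ?thesis by linarith
  qed
  moreover define s where "s = sin (u * x) / x"
  ultimately show ?thesis using * False unfolding s_def[symmetric] by (auto split: split_indicator)
qed (use assms in auto)

text \<open>The classical truncation inequality: exchanging the integrals over \<open>t\<close> and
  over the space turns the right side into the mean of \<open>u - sin (u * X) / X\<close>, which is
  at least \<open>u / 2\<close> on the tail and never negative.\<close>

lemma (in prob_space) char_tail_bound:
  fixes X :: "'a \<Rightarrow> real"
  assumes u: "0 < u" and X [measurable]: "X \<in> borel_measurable M"
  shows "u / 2 * measure M {x \<in> space M. 2 / u \<le> \<bar>X x\<bar>}
    \<le> (LINT t|restrict_space lborel {0..u}. 1 - Re (CLINT x|M. iexp (t * X x)))"
proof -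
  define N where "N = restrict_space lborel {0..u}"
  have setsN [measurable_cong]: "sets N = sets (restrict_space borel {0..u})"
    by (simp add: N_def sets_restrict_space)
  interpret N: finite_measure N
    by (rule finite_measureI) (use u in \<open>simp add: N_def space_restrict_space emeasure_restrict_space\<close>)
  interpret pair_sigma_finite M N by unfold_locales
  have [measurable]: "(\<lambda>p. cos (snd p * X (fst p))) \<in> borel_measurable (M \<Otimes>\<^sub>M N)"
  proof -
    have [measurable]: "(\<lambda>x. x) \<in> borel_measurable N" by (simp add: N_def measurable_restrict_space1)
    show ?thesis by measurable
  qed
  have fin: "finite_measure (M \<Otimes>\<^sub>M N)"
    by (intro finite_measure_pair_measure) unfold_locales
  have int: "integrable (M \<Otimes>\<^sub>M N) (\<lambda>(x, t). 1 - cos (t * X x))"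
    by (rule finite_measure.integrable_const_bound[OF fin, of _ 2])
      (auto intro!: AE_I2 simp: split_beta' intro: abs_leI simp del: diff_ge_0_iff_ge, smt (verit) cos_ge_minus_one cos_le_one)
  have re: "1 - Re (CLINT x|M. iexp (t * X x)) = (LINT x|M. 1 - cos (t * X x))" for t
  proof -
    have i: "complex_integrable M (\<lambda>x. iexp (t * X x))"
      by (intro integrable_const_bound[where B = 1]) auto
    have "Re (CLINT x|M. iexp (t * X x)) = (LINT x|M. cos (t * X x))"
      using integral_Re[OF i] by (simp add: Re_exp)
    moreover have "integrable M (\<lambda>x. cos (t * X x))"
      by (intro integrable_const_bound[where B = 1]) auto
    ultimately show ?thesis by (simp add: prob_space)
  qed
  have "u / 2 * measure M {x \<in> space M. 2 / u \<le> \<bar>X x\<bar>} = (LINT x|M. u / 2 * indicator {x. 2 / u \<le> \<bar>x\<bar>} (X x))"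
  proof -
    have "(LINT x|M. indicator {x. 2 / u \<le> \<bar>x\<bar>} (X x) :: real) = (LINT x|M. indicator {x \<in> space M. 2 / u \<le> \<bar>X x\<bar>} x)"
      by (intro Bochner_Integration.integral_cong) (auto split: split_indicator)
    also have "\<dots> = measure M {x \<in> space M. 2 / u \<le> \<bar>X x\<bar>}"
      by (simp add: Int_absorb2)
    finally show ?thesis by simp
  qed
  also have "\<dots> \<le> (LINT x|M. LINT t|N. 1 - cos (t * X x))"
  proof (rule integral_mono)
    show "integrable M (\<lambda>x. u / 2 * indicator {x. 2 / u \<le> \<bar>x\<bar>} (X x))"
      by (intro integrable_const_bound[where B = "u / 2"]) (use u in \<open>auto split: split_indicator\<close>)
    show "integrable M (\<lambda>x. LINT t|N. 1 - cos (t * X x))"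
      using integrable_fst[OF int] .
    show "u / 2 * indicator {x. 2 / u \<le> \<bar>x\<bar>} (X x) \<le> (LINT t|N. 1 - cos (t * X x))" for x
      unfolding N_def integral_one_minus_cos[OF u] by (rule one_minus_sinc_ge[OF u])
  qed
  also have "\<dots> = (LINT t|N. LINT x|M. 1 - cos (t * X x))"
    using Fubini_integral[OF int] by simp
  finally show ?thesis by (simp only: re N_def)
qed

text \<open>The truncation inequality bounds the tails by integrals that converge, by dominated
  convergence, to the one formed with \<open>g\<close>; continuity of \<open>g\<close> at 0 makes
  this limit small.\<close>

lemma eventually_char_tail_small:
  fixes M :: "nat \<Rightarrow> 'a measure" and X :: "'a \<Rightarrow> real" and g :: "real \<Rightarrow> complex"
  assumes M: "\<And>n. prob_space (M n)" and X: "\<And>n. X \<in> borel_measurable (M n)"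
    and g: "continuous_on UNIV g" "g 0 = 1" and lim: "\<And>t. (\<lambda>n. CLINT x|M n. iexp (t * X x)) \<longlonglongrightarrow> g t"
    and \<epsilon>: "0 < \<epsilon>"
  obtains K where "\<forall>\<^sub>F n in sequentially. measure (M n) {x \<in> space (M n). K \<le> \<bar>X x\<bar>} < \<epsilon>"
proof -
  have "isCont g 0" using g by (simp add: continuous_on_eq_continuous_at)
  \<comment> \<open>With \<open>\<epsilon> / 4\<close> the limiting integral is at most
    \<open>\<epsilon> / 4 * u\<close>, strictly below the \<open>\<epsilon> * u / 2\<close> that
    corresponds to a tail of probability \<epsilon>.\<close>
  then obtain d where d: "0 < d" "\<And>t. \<bar>t\<bar> < d \<Longrightarrow> norm (g t - 1) < \<epsilon> / 4"
    using \<epsilon> g(2) unfolding continuous_at_eps_delta by (metis diff_zero dist_norm divide_pos_pos real_norm_def zero_less_numeral)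
  define u where "u = d / 2"
  have u: "0 < u" "u < d" using d by (auto simp: u_def)
  define N where "N = restrict_space lborel {0..u}"
  have setsN [measurable_cong]: "sets N = sets (restrict_space borel {0..u})"
    by (simp add: N_def sets_restrict_space)
  have spN: "space N = {0..u}" by (simp add: N_def space_restrict_space)
  interpret N: finite_measure N
    by (rule finite_measureI) (use u in \<open>simp add: N_def space_restrict_space emeasure_restrict_space\<close>)
  have cN: "measure N (space N) = u"
    using u by (simp add: N_def space_restrict_space measure_restrict_space)
  define c where "c n t = (CLINT x|M n. iexp (t * X x))" for n t
  have c_bound: "norm (c n t) \<le> 1" for n t
  proof -
    interpret prob_space "M n" by (rule M)
    have "norm (c n t) \<le> (LINT x|M n. norm (iexp (t * X x)))" unfolding c_def by (rule integral_norm_bound)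
    then show ?thesis by (simp add: prob_space)
  qed
  have c_meas [measurable]: "c n \<in> borel_measurable borel" for n
  proof -
    interpret prob_space "M n" by (rule M)
    note [measurable] = X[of n]
    have "real_distribution (distr (M n) borel X)" by (intro real_distribution_distr) (rule X)
    then have "char (distr (M n) borel X) \<in> borel_measurable borel"
      by (rule real_distribution.char_measurable)
    moreover have "c n = char (distr (M n) borel X)" by (auto simp: c_def char_def integral_distr)
    ultimately show ?thesis by simp
  qed
  have g_meas [measurable]: "g \<in> borel_measurable borel" by (intro borel_measurable_continuous_onI g)
  have "(\<lambda>n. LINT t|N. 1 - Re (c n t)) \<longlonglongrightarrow> (LINT t|N. 1 - Re (g t))"
  proof (rule integral_dominated_convergence[where w = "\<lambda>_. 2"])
    show "AE t in N. (\<lambda>n. 1 - Re (c n t)) \<longlonglongrightarrow> 1 - Re (g t)"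
      using lim by (intro AE_I2 tendsto_intros) (auto simp: c_def)
    show "AE t in N. norm (1 - Re (c n t)) \<le> 2" for n
    proof (intro AE_I2)
      show "norm (1 - Re (c n t)) \<le> 2" for t
        using c_bound[of n t] abs_Re_le_cmod[of "c n t"] by auto
    qed
    show "(\<lambda>t. 1 - Re (g t)) \<in> borel_measurable N" "\<And>n. (\<lambda>t. 1 - Re (c n t)) \<in> borel_measurable N"
      by (simp_all add: N_def measurable_restrict_space1)
  qed simp
  moreover have "(LINT t|N. 1 - Re (g t)) < \<epsilon> * u / 2"
  proof -
    have "(LINT t|N. 1 - Re (g t)) \<le> (LINT t|N. \<epsilon> / 4)"
    proof (rule integral_mono_AE)
      have b: "\<bar>1 - Re (g t)\<bar> \<le> \<epsilon> / 4" if "t \<in> {0..u}" for t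
      proof -
        have "norm (1 - g t) < \<epsilon> / 4" using d(2)[of t] that u by (simp add: norm_minus_commute)
        then show ?thesis using abs_Re_le_cmod[of "1 - g t"] by simp
      qed
      show "integrable N (\<lambda>t. 1 - Re (g t))"
        by (rule N.integrable_const_bound[where B = "\<epsilon> / 4"]) (use b spN in \<open>auto intro!: AE_I2 simp: N_def measurable_restrict_space1\<close>)
      show "AE t in N. 1 - Re (g t) \<le> \<epsilon> / 4"
        using abs_ge_self order_trans[OF _ b] spN by (intro AE_I2) blast
    qed simp
    also have "\<dots> = \<epsilon> / 4 * u" using cN by simp
    also have "\<dots> < \<epsilon> * u / 2" using \<epsilon> u by simp
    finally show ?thesis .
  qed
  ultimately have "\<forall>\<^sub>F n in sequentially. (LINT t|N. 1 - Re (c n t)) < \<epsilon> * u / 2"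
    by (rule order_tendstoD)
  then have "\<forall>\<^sub>F n in sequentially. measure (M n) {x \<in> space (M n). 2 / u \<le> \<bar>X x\<bar>} < \<epsilon>"
  proof (rule eventually_mono)
    fix n assume *: "(LINT t|N. 1 - Re (c n t)) < \<epsilon> * u / 2"
    interpret prob_space "M n" by (rule M)
    have "u / 2 * measure (M n) {x \<in> space (M n). 2 / u \<le> \<bar>X x\<bar>} < \<epsilon> * u / 2"
      using char_tail_bound[OF u(1) X] * unfolding c_def N_def by linarith
    then show "measure (M n) {x \<in> space (M n). 2 / u \<le> \<bar>X x\<bar>} < \<epsilon>" using u by (simp add: field_simps)
  qed
  then show ?thesis using that by blast
qed

text \<open>Takes care of the finitely many measures that an eventual bound leaves out.\<close>

lemma (in prob_space) tail_small:
  fixes X :: "'a \<Rightarrow> real"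
  assumes [measurable]: "X \<in> borel_measurable M" and \<epsilon>: "0 < \<epsilon>"
  shows "\<forall>\<^sub>F k in sequentially. measure M {x \<in> space M. real k \<le> X x} < \<epsilon>"
proof -
  have "(\<lambda>k. measure M {x \<in> space M. real k \<le> X x}) \<longlonglongrightarrow> measure M (\<Inter>k. {x \<in> space M. real k \<le> X x})"
    by (rule finite_Lim_measure_decseq) (auto simp: decseq_def)
  moreover have "(\<Inter>k. {x \<in> space M. real k \<le> X x}) = {}"
  proof -
    have "\<exists>k::nat. \<not> real k \<le> X x" for x using reals_Archimedean2[of "X x"] by (meson not_le)
    then show ?thesis by auto
  qed
  ultimately show ?thesis using \<epsilon> by (auto dest: order_tendstoD)
qed

text \<open>A continuous retraction of the plane onto \<open>D\<close>. Composed with it,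
  \<open>exp (pairing u \<xi>)\<close> with \<open>u\<close> in \<open>U\<close> becomes bounded and
  continuous on the whole plane, and a limit law found in the plane is moved to
  \<open>D\<close>.\<close>

definition clip_D :: "real \<times> real \<Rightarrow> real \<times> real" where
  "clip_D \<xi> = (max 0 (fst \<xi>), snd \<xi>)"

lemma clip_D_eq: "\<xi> \<in> D \<Longrightarrow> clip_D \<xi> = \<xi>"
  by (cases \<xi>) (auto simp: clip_D_def D_def)

lemma clip_D_mem: "clip_D \<xi> \<in> D"
  by (simp add: clip_D_def D_def)

lemma continuous_on_clip_D: "continuous_on A clip_D"
  unfolding clip_D_def by (intro continuous_intros)

lemma measurable_clip_D [measurable]: "clip_D \<in> borel \<rightarrow>\<^sub>M MD"
  by (rule measurable_restrict_space2)
    (auto intro: clip_D_mem borel_measurable_continuous_onI continuous_on_clip_D)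

text \<open>Continuity of \<open>f\<close> along the two imaginary axes makes both coordinates
  tight; a subsequence then converges weakly, and its limit has transform \<open>f\<close>.\<close>

lemma transform_continuity:
  fixes \<mu> :: "nat \<Rightarrow> (real \<times> real) measure"
  assumes \<mu>: "\<And>n. \<mu> n \<in> space (prob_algebra MD)"
    and lim: "\<And>u. u \<in> U \<Longrightarrow> (\<lambda>n. transform (\<mu> n) u) \<longlonglongrightarrow> f u" and f: "continuous_on U f"
  obtains \<nu> where "\<nu> \<in> space (prob_algebra MD)" "\<And>u. u \<in> U \<Longrightarrow> transform \<nu> u = f u"
proof -
  interpret \<mu>: prob_space "\<mu> n" for n using \<mu> by (rule prob_algebra_MDD)
  note [measurable_cong] = prob_algebra_MDD(2)[OF \<mu>]
  note sp = prob_algebra_MDD(3)[OF \<mu>]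
  note bm = borel_measurable_prob_MD[OF \<mu>]
  have f0: "f 0 = 1" using lim[of 0] by (simp add: transform_0[OF \<mu>] LIMSEQ_const_iff)
  have lim_coord: "(\<lambda>n. CLINT \<xi>|\<mu> n. iexp (t * (a * fst \<xi> + b * snd \<xi>))) \<longlonglongrightarrow> f (\<i> * t * a, \<i> * t * b)" for a b t
    using lim[of "(\<i> * t * a, \<i> * t * b)"]
    by (simp add: U_def transform_def pairing_def algebra_simps)
  have cont_coord: "continuous_on UNIV (\<lambda>t. f (\<i> * complex_of_real t * complex_of_real a, \<i> * t * complex_of_real b))" for a b
    by (rule continuous_on_compose2[OF f]) (auto intro!: continuous_intros simp: U_def)
  have tight: "\<exists>K. \<forall>n. 1 - \<epsilon> < measure (\<mu> n) {\<xi> \<in> D. norm \<xi> < K}" if \<epsilon>: "0 < \<epsilon>" for \<epsilon>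
  proof -
    have "\<exists>K. \<forall>\<^sub>F n in sequentially. measure (\<mu> n) {\<xi> \<in> space (\<mu> n). K \<le> \<bar>a * fst \<xi> + b * snd \<xi>\<bar>} < \<epsilon> / 2" for a b
    proof (rule eventually_char_tail_small[where M = \<mu> and \<epsilon> = "\<epsilon> / 2" and X = "\<lambda>\<xi>. a * fst \<xi> + b * snd \<xi>"
          and g = "\<lambda>t. f (\<i> * complex_of_real t * a, \<i> * complex_of_real t * b)"])
      show "prob_space (\<mu> n)" for n by (rule \<mu>.prob_space_axioms)
      show "(\<lambda>\<xi>. a * fst \<xi> + b * snd \<xi>) \<in> borel_measurable (\<mu> n)" for n by (rule bm) simp
      show "f (\<i> * complex_of_real 0 * a, \<i> * complex_of_real 0 * b) = 1" using f0 by (simp add: zero_prod_def)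
    qed (use \<epsilon> cont_coord lim_coord in auto)
    from this[of 1 0] this[of 0 1] obtain K1 K2
      where K1: "\<forall>\<^sub>F n in sequentially. measure (\<mu> n) {\<xi> \<in> space (\<mu> n). K1 \<le> \<bar>fst \<xi>\<bar>} < \<epsilon> / 2"
      and K2: "\<forall>\<^sub>F n in sequentially. measure (\<mu> n) {\<xi> \<in> space (\<mu> n). K2 \<le> \<bar>snd \<xi>\<bar>} < \<epsilon> / 2"
      by auto
    obtain n0 where n0: "\<And>n. n \<ge> n0 \<Longrightarrow> measure (\<mu> n) {\<xi> \<in> D. K1 \<le> \<bar>fst \<xi>\<bar>} < \<epsilon> / 2 \<and> measure (\<mu> n) {\<xi> \<in> D. K2 \<le> \<bar>snd \<xi>\<bar>} < \<epsilon> / 2"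
      using eventually_conj[OF K1 K2] by (auto simp: eventually_sequentially sp)
    have "\<forall>\<^sub>F k in sequentially. \<forall>n\<in>{..<n0}. measure (\<mu> n) {\<xi> \<in> space (\<mu> n). real k \<le> norm \<xi>} < \<epsilon>"
      by (intro eventually_ball_finite finite_lessThan ballI \<mu>.tail_small bm \<epsilon>) simp
    then obtain k :: nat where k: "\<And>n. n < n0 \<Longrightarrow> measure (\<mu> n) {\<xi> \<in> D. real k \<le> norm \<xi>} < \<epsilon>"
      by (auto simp: eventually_sequentially sp)
    \<comment> \<open>The norm is at most the sum of the moduli of the coordinates, so beyond the
      sum of the moduli of \<open>K1\<close> and \<open>K2\<close> one coordinate exceeds its bound;
      \<open>k\<close> serves the measures before \<open>n0\<close>.\<close>
    define K where "K = max (real k) (\<bar>K1\<bar> + \<bar>K2\<bar>)"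
    have "measure (\<mu> n) {\<xi> \<in> D. K \<le> norm \<xi>} < \<epsilon>" for n
    proof (cases "n < n0")
      case True
      have "measure (\<mu> n) {\<xi> \<in> D. K \<le> norm \<xi>} \<le> measure (\<mu> n) {\<xi> \<in> D. real k \<le> norm \<xi>}"
        by (intro \<mu>.finite_measure_mono) (auto simp: K_def sp[of n, symmetric] intro: bm)
      with k[OF True] show ?thesis by simp
    next
      case False
      have "norm \<xi> \<le> \<bar>fst \<xi>\<bar> + \<bar>snd \<xi>\<bar>" for \<xi> :: "real \<times> real"
        using norm_Pair_le[of "fst \<xi>" "snd \<xi>"] by simp
      then have "{\<xi> \<in> D. K \<le> norm \<xi>} \<subseteq> {\<xi> \<in> D. K1 \<le> \<bar>fst \<xi>\<bar>} \<union> {\<xi> \<in> D. K2 \<le> \<bar>snd \<xi>\<bar>}"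
        unfolding K_def by (auto, smt (verit) fst_conv snd_conv)
      then have "measure (\<mu> n) {\<xi> \<in> D. K \<le> norm \<xi>} \<le> measure (\<mu> n) ({\<xi> \<in> D. K1 \<le> \<bar>fst \<xi>\<bar>} \<union> {\<xi> \<in> D. K2 \<le> \<bar>snd \<xi>\<bar>})"
        by (intro \<mu>.finite_measure_mono) (auto simp: sp[of n, symmetric] intro: bm)
      also have "\<dots> \<le> measure (\<mu> n) {\<xi> \<in> D. K1 \<le> \<bar>fst \<xi>\<bar>} + measure (\<mu> n) {\<xi> \<in> D. K2 \<le> \<bar>snd \<xi>\<bar>}"
        by (intro measure_Un_le) (auto simp: sp[of n, symmetric] intro: bm)
      also have "\<dots> < \<epsilon>" using n0[of n] False by simp
      finally show ?thesis .
    qed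
    moreover have "measure (\<mu> n) {\<xi> \<in> D. norm \<xi> < K} = 1 - measure (\<mu> n) {\<xi> \<in> D. K \<le> norm \<xi>}" for n
    proof -
      have "{\<xi> \<in> D. norm \<xi> < K} = space (\<mu> n) - {\<xi> \<in> D. K \<le> norm \<xi>}" by (auto simp: sp)
      moreover have "{\<xi> \<in> D. K \<le> norm \<xi>} \<in> sets (\<mu> n)" by (auto simp: sp[of n, symmetric] intro: bm)
      ultimately show ?thesis using \<mu>.prob_compl by simp
    qed
    ultimately have "1 - \<epsilon> < measure (\<mu> n) {\<xi> \<in> D. norm \<xi> < K}" for n by simp
    then show ?thesis by blast
  qed
  define M where "M n = distr (\<mu> n) borel (\<lambda>\<xi>. \<xi>)" for n
  have id_bm: "(\<lambda>\<xi>. \<xi>) \<in> borel_measurable (\<mu> n)" for n by (rule bm) simp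
  obtain r N where r: "strict_mono (r :: nat \<Rightarrow> nat)" and N: "prob_space N" "sets N = sets borel"
    and weak: "\<And>(f :: real \<times> real \<Rightarrow> complex) B. continuous_on UNIV f \<Longrightarrow> (\<And>x. norm (f x) \<le> B) \<Longrightarrow>
      (\<lambda>n. integral\<^sup>L (M (r n)) f) \<longlonglongrightarrow> integral\<^sup>L N f"
  proof (rule tight_plane_imp_convergent_subsequence[of M])
    show "prob_space (M n)" for n unfolding M_def by (rule \<mu>.prob_space_distr[OF id_bm])
    fix \<epsilon> :: real assume "0 < \<epsilon>"
    then obtain K where "\<And>n. 1 - \<epsilon> < measure (\<mu> n) {\<xi> \<in> D. norm \<xi> < K}" using tight by blast
    moreover have "measure (M n) {\<xi>. norm \<xi> < K} = measure (\<mu> n) {\<xi> \<in> D. norm \<xi> < K}" for n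
      unfolding M_def by (subst measure_distr[OF id_bm]) (auto simp: sp intro!: arg_cong[where f = "measure (\<mu> n)"])
    ultimately show "\<exists>K. \<forall>n. 1 - \<epsilon> < measure (M n) {x. norm x < K}" by (intro exI[of _ K]) simp
  qed (auto simp: M_def)
  interpret N: prob_space N by (rule N)
  note [measurable_cong] = N(2)
  define \<nu> where "\<nu> = distr N MD clip_D"
  have [measurable]: "clip_D \<in> N \<rightarrow>\<^sub>M MD" using measurable_cong_sets[OF N(2) refl] measurable_clip_D by blast
  have "\<nu> \<in> space (prob_algebra MD)"
    by (auto simp: space_prob_algebra \<nu>_def intro: N.prob_space_distr)
  moreover have "transform \<nu> u = f u" if u: "u \<in> U" for u
  proof (rule LIMSEQ_unique)
    have "continuous_on UNIV (\<lambda>\<xi>. exp (pairing u (clip_D \<xi>)))"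
      unfolding pairing_def by (intro continuous_intros continuous_on_clip_D)
    then have "(\<lambda>n. CLINT \<xi>|M (r n). exp (pairing u (clip_D \<xi>))) \<longlonglongrightarrow> (CLINT \<xi>|N. exp (pairing u (clip_D \<xi>)))"
      by (rule weak) (rule norm_exp_pairing_le[OF u clip_D_mem])
    moreover have "(CLINT \<xi>|N. exp (pairing u (clip_D \<xi>))) = transform \<nu> u"
      unfolding transform_def \<nu>_def by (subst integral_distr) auto
    moreover have "(CLINT \<xi>|M n. exp (pairing u (clip_D \<xi>))) = transform (\<mu> n) u" for n
    proof -
      have [measurable]: "clip_D \<in> borel_measurable borel"
        by (intro borel_measurable_continuous_onI continuous_on_clip_D)
      show ?thesis
        unfolding M_def transform_def
        by (subst integral_distr[OF id_bm], measurable, intro Bochner_Integration.integral_cong)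
         (auto simp: sp clip_D_eq)
    qed
    ultimately show "(\<lambda>n. transform (\<mu> (r n)) u) \<longlonglongrightarrow> transform \<nu> u" by simp
    show "(\<lambda>n. transform (\<mu> (r n)) u) \<longlonglongrightarrow> f u"
      using LIMSEQ_subseq_LIMSEQ[OF lim[OF u] r] by (simp add: o_def)
  qed
  ultimately show ?thesis using that by blast
qed

section \<open>Transforms of mixtures and convolutions\<close>

lemma integral_bind_complex:
  fixes f :: "_ \<Rightarrow> complex"
  assumes M: "prob_space M" and N: "N \<in> M \<rightarrow>\<^sub>M prob_algebra K"
    and f [measurable]: "f \<in> borel_measurable K" and B: "\<And>x. x \<in> space K \<Longrightarrow> norm (f x) \<le> B"
  shows "(CLINT x|(M \<bind> N). f x) = (CLINT x|M. CLINT y|N x. f y)"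
proof -
  interpret prob_space M by fact
  have N' [measurable]: "N \<in> M \<rightarrow>\<^sub>M subprob_algebra K" using N by (rule measurable_prob_algebraD)
  have Nx: "prob_space (N x)" "sets (N x) = sets K" "space (N x) = space K" if "x \<in> space M" for x
    using measurable_space[OF N that] by (auto simp: space_prob_algebra dest: sets_eq_imp_space_eq)
  have em: "AE x in M. emeasure (N x) (space (N x)) \<le> ennreal 1"
    by (intro AE_I2) (simp add: prob_space.emeasure_space_1[OF Nx(1)])
  have fin: "finite_measure M" by unfold_locales
  have bRe: "\<bar>Re (f x)\<bar> \<le> B" and bIm: "\<bar>Im (f x)\<bar> \<le> B" if "x \<in> space K" for x
    using B[OF that] abs_Re_le_cmod[of "f x"] abs_Im_le_cmod[of "f x"] by linarith+
  have [measurable]: "(\<lambda>x. Re (f x)) \<in> borel_measurable K" "(\<lambda>x. Im (f x)) \<in> borel_measurable K"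
    by measurable
  have eqs: "(LINT x|(M \<bind> N). Re (f x)) = (LINT x|M. LINT y|N x. Re (f y))"
    "(LINT x|(M \<bind> N). Im (f x)) = (LINT x|M. LINT y|N x. Im (f y))"
    by (rule integral_bind[OF _ bRe N' fin em] integral_bind[OF _ bIm N' fin em]; simp)+
  have i1: "integrable (M \<bind> N) (\<lambda>x. Re (f x))" "integrable (M \<bind> N) (\<lambda>x. Im (f x))"
    by (rule integrable_bind[OF _ bRe N' fin em] integrable_bind[OF _ bIm N' fin em]; simp)+
  have i: "complex_integrable (M \<bind> N) f"
    using Bochner_Integration.integrable_add[OF integrable_of_real[OF i1(1), where 'a = complex]
        integrable_mult_right[of \<i>, OF integrable_of_real[OF i1(2), where 'a = complex]]]
    by (simp flip: complex_eq)
  have iN: "complex_integrable (N x) f" if "x \<in> space M" for x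
  proof -
    interpret Nx: prob_space "N x" using Nx that by auto
    note [measurable_cong] = Nx(2)[OF that]
    show ?thesis by (rule Nx.integrable_const_bound[where B = B]) (use B Nx that in auto)
  qed
  have iM: "complex_integrable M (\<lambda>x. CLINT y|N x. f y)"
  proof (rule integrable_const_bound[where B = B])
    show "(\<lambda>x. CLINT y|N x. f y) \<in> borel_measurable M"
      using measurable_compose[OF N' integral_measurable_subprob_algebra[OF f]] .
    show "AE x in M. norm (CLINT y|N x. f y) \<le> B"
    proof (rule AE_I2)
      fix x assume x: "x \<in> space M"
      interpret Nx: prob_space "N x" using Nx x by auto
      have "norm (CLINT y|N x. f y) \<le> (LINT y|N x. norm (f y))" by (rule integral_norm_bound)
      also have "\<dots> \<le> (LINT y|N x. B)"
        using iN[OF x] B Nx[OF x] by (intro integral_mono) auto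
      finally show "norm (CLINT y|N x. f y) \<le> B" by (simp add: Nx.prob_space)
    qed
  qed
  show ?thesis
  proof (rule complex_eqI)
    have "Re (CLINT x|(M \<bind> N). f x) = (LINT x|M. LINT y|N x. Re (f y))" using i eqs by simp
    also have "\<dots> = (LINT x|M. Re (CLINT y|N x. f y))"
      using iN by (intro Bochner_Integration.integral_cong) auto
    finally show "Re (CLINT x|(M \<bind> N). f x) = Re (CLINT x|M. CLINT y|N x. f y)" using iM by simp
    have "Im (CLINT x|(M \<bind> N). f x) = (LINT x|M. LINT y|N x. Im (f y))" using i eqs by simp
    also have "\<dots> = (LINT x|M. Im (CLINT y|N x. f y))"
      using iN by (intro Bochner_Integration.integral_cong) auto
    finally show "Im (CLINT x|(M \<bind> N). f x) = Im (CLINT x|M. CLINT y|N x. f y)" using iM by simp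
  qed
qed

lemma bind_prob_algebra:
  assumes "M \<in> space (prob_algebra A)" "N \<in> A \<rightarrow>\<^sub>M prob_algebra B"
  shows "M \<bind> N \<in> space (prob_algebra B)"
  using prob_space_bind'[OF assms] sets_bind'[OF assms] by (simp add: space_prob_algebra)

lemma transform_bind:
  assumes M: "prob_space M" and N: "N \<in> M \<rightarrow>\<^sub>M prob_algebra MD" and u: "u \<in> U"
  shows "transform (M \<bind> N) u = (CLINT x|M. transform (N x) u)"
  unfolding transform_def
  by (rule integral_bind_complex[OF M N, where B = 1]) (use u norm_exp_pairing_le in auto)

lemma D_add: "x \<in> D \<Longrightarrow> y \<in> D \<Longrightarrow> x + y \<in> D"
  by (auto simp: D_def)

lemma measurable_add_MD: "(\<lambda>(x, y). x + y) \<in> MD \<Otimes>\<^sub>M MD \<rightarrow>\<^sub>M MD"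
proof (rule measurable_restrict_space2)
  have "(\<lambda>x. x) \<in> MD \<rightarrow>\<^sub>M borel" by (rule measurable_MD_borel) simp
  then have "fst \<in> MD \<Otimes>\<^sub>M MD \<rightarrow>\<^sub>M borel" "snd \<in> MD \<Otimes>\<^sub>M MD \<rightarrow>\<^sub>M borel"
    using measurable_compose[OF measurable_fst] measurable_compose[OF measurable_snd] by blast+
  then show "(\<lambda>(x, y). x + y) \<in> MD \<Otimes>\<^sub>M MD \<rightarrow>\<^sub>M (borel :: (real \<times> real) measure)"
    unfolding split_beta' by (rule borel_measurable_add)
qed (auto simp: space_pair_measure intro: D_add)

context
  fixes \<mu> \<nu> assumes \<mu>: "\<mu> \<in> space (prob_algebra MD)" and \<nu>: "\<nu> \<in> space (prob_algebra MD)"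
begin

lemma measurable_add_conv: "(\<lambda>(x, y). x + y) \<in> \<mu> \<Otimes>\<^sub>M \<nu> \<rightarrow>\<^sub>M MD"
  using measurable_add_MD
  by (subst measurable_cong_sets[OF sets_pair_measure_cong[OF prob_algebra_MDD(2)[OF \<mu>] prob_algebra_MDD(2)[OF \<nu>]] refl])

lemma conv_D_prob_algebra: "conv_D \<mu> \<nu> \<in> space (prob_algebra MD)"
proof -
  interpret pair_prob_space \<mu> \<nu>
    using prob_algebra_MDD(1)[OF \<mu>] prob_algebra_MDD(1)[OF \<nu>]
    by (auto simp: pair_prob_space_def pair_sigma_finite_def prob_space_imp_sigma_finite)
  show ?thesis
    unfolding conv_D_def using measurable_add_conv by (auto simp: space_prob_algebra intro: prob_space_distr)
qed

lemma nn_integral_conv_D: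
  assumes f: "f \<in> borel_measurable MD"
  shows "(\<integral>\<^sup>+\<xi>. f \<xi> \<partial>conv_D \<mu> \<nu>) = (\<integral>\<^sup>+x. \<integral>\<^sup>+y. f (x + y) \<partial>\<nu> \<partial>\<mu>)"
proof -
  interpret pair_prob_space \<mu> \<nu>
    using prob_algebra_MDD(1)[OF \<mu>] prob_algebra_MDD(1)[OF \<nu>]
    by (auto simp: pair_prob_space_def pair_sigma_finite_def prob_space_imp_sigma_finite)
  have "(\<integral>\<^sup>+\<xi>. f \<xi> \<partial>conv_D \<mu> \<nu>) = (\<integral>\<^sup>+z. f (case z of (x, y) \<Rightarrow> x + y) \<partial>(\<mu> \<Otimes>\<^sub>M \<nu>))"
    unfolding conv_D_def by (rule nn_integral_distr[OF measurable_add_conv]) (use f in simp)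
  also have "\<dots> = (\<integral>\<^sup>+x. \<integral>\<^sup>+y. f (x + y) \<partial>\<nu> \<partial>\<mu>)"
    by (subst M2.nn_integral_fst[symmetric]) (use measurable_compose[OF measurable_add_conv f] in auto)
  finally show ?thesis .
qed

lemma transform_conv_D:
  assumes u: "u \<in> U"
  shows "transform (conv_D \<mu> \<nu>) u = transform \<mu> u * transform \<nu> u"
proof -
  interpret pair_prob_space \<mu> \<nu>
    using prob_algebra_MDD(1)[OF \<mu>] prob_algebra_MDD(1)[OF \<nu>]
    by (auto simp: pair_prob_space_def pair_sigma_finite_def prob_space_imp_sigma_finite)
  have m: "(\<lambda>\<xi>. exp (pairing u \<xi>)) \<in> borel_measurable MD" by simp
  have "transform (conv_D \<mu> \<nu>) u = (CLINT z|\<mu> \<Otimes>\<^sub>M \<nu>. exp (pairing u (case z of (x, y) \<Rightarrow> x + y)))"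
    unfolding transform_def conv_D_def by (rule integral_distr[OF measurable_add_conv m])
  also have "\<dots> = (CLINT x|\<mu>. CLINT y|\<nu>. exp (pairing u (x + y)))"
  proof (subst integral_fst'[symmetric])
    show "complex_integrable (\<mu> \<Otimes>\<^sub>M \<nu>) (\<lambda>z. exp (pairing u (case z of (x, y) \<Rightarrow> x + y)))"
    proof (rule integrable_const_bound[where B = 1])
      show "AE z in \<mu> \<Otimes>\<^sub>M \<nu>. norm (exp (pairing u (case z of (x, y) \<Rightarrow> x + y))) \<le> 1"
        using norm_exp_pairing_le[OF u D_add] prob_algebra_MDD(3)[OF \<mu>] prob_algebra_MDD(3)[OF \<nu>]
        by (intro AE_I2) (auto simp: space_pair_measure simp del: norm_exp_eq_Re)
    qed (use measurable_compose[OF measurable_add_conv m] in simp)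
  qed simp
  also have "\<dots> = transform \<mu> u * transform \<nu> u"
    by (simp add: transform_def pairing_add_right exp_add)
  finally show ?thesis .
qed

end

lemma conv_power_prob_algebra:
  "\<mu> \<in> space (prob_algebra MD) \<Longrightarrow> conv_power \<mu> n \<in> space (prob_algebra MD)"
proof (induction n)
  case 0
  show ?case by (simp add: space_prob_algebra prob_space_return)
qed (simp add: conv_D_prob_algebra)

lemma transform_conv_power:
  "\<mu> \<in> space (prob_algebra MD) \<Longrightarrow> u \<in> U \<Longrightarrow> transform (conv_power \<mu> n) u = transform \<mu> u ^ n"
proof (induction n)
  case 0
  then show ?case by (simp add: transform_def integral_return)
next
  case (Suc n)
  then show ?case by (simp add: transform_conv_D conv_power_prob_algebra)
qed

section \<open>Differentiability of the transform under a first moment\<close>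

text \<open>\<open>exp\<close> has a derivative of modulus at most 1 on the closed left half-plane,
  which is convex.\<close>

lemma norm_exp_diff_le:
  fixes z w :: complex
  assumes "Re z \<le> 0" "Re w \<le> 0"
  shows "norm (exp z - exp w) \<le> norm (z - w)"
proof -
  have "norm (exp z - exp w) \<le> 1 * norm (z - w)"
    by (rule field_differentiable_bound[of "{z. Re z \<le> 0}" exp exp])
      (use assms in \<open>auto simp: convex_halfspace_Re_le intro!: DERIV_exp[THEN has_field_derivative_at_within]\<close>)
  then show ?thesis by simp
qed

lemma norm_pairing_le: "norm (pairing u \<xi>) \<le> 2 * norm u * norm \<xi>"
proof -
  have "norm (pairing u \<xi>) \<le> norm (fst u) * \<bar>fst \<xi>\<bar> + norm (snd u) * \<bar>snd \<xi>\<bar>"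
    unfolding pairing_def by (rule order_trans[OF norm_triangle_ineq]) (simp add: norm_mult)
  also have "\<dots> \<le> norm u * norm \<xi> + norm u * norm \<xi>"
    using norm_fst_le[of "fst u" "snd u"] norm_snd_le[of "snd u" "fst u"]
      norm_fst_le[of "fst \<xi>" "snd \<xi>"] norm_snd_le[of "snd \<xi>" "fst \<xi>"]
    by (intro add_mono mult_mono) auto
  finally show ?thesis by (simp add: mult_ac)
qed

lemma norm_exp_pairing_diff_le:
  assumes "u \<in> U" "v \<in> U" "\<xi> \<in> D"
  shows "norm (exp (pairing u \<xi>) - exp (pairing v \<xi>)) \<le> 2 * norm (u - v) * norm \<xi>"
  using norm_exp_diff_le[OF Re_pairing_nonpos[OF assms(1,3)] Re_pairing_nonpos[OF assms(2,3)]]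
    norm_pairing_le[of "u - v" \<xi>]
  unfolding pairing_diff_left by linarith

lemma norm_transform_diff_le:
  assumes \<mu>: "\<mu> \<in> space (prob_algebra MD)" and int: "integrable \<mu> norm" and u: "u \<in> U" "v \<in> U"
  shows "norm (transform \<mu> u - transform \<mu> v) \<le> 2 * norm (u - v) * (LINT \<xi>|\<mu>. norm \<xi>)"
proof -
  have "norm (transform \<mu> u - transform \<mu> v) = norm (CLINT \<xi>|\<mu>. exp (pairing u \<xi>) - exp (pairing v \<xi>))"
    unfolding transform_def using integrable_exp_pairing[OF \<mu>] u by simp
  also have "\<dots> \<le> (LINT \<xi>|\<mu>. norm (exp (pairing u \<xi>) - exp (pairing v \<xi>)))"
    by (rule integral_norm_bound)
  also have "\<dots> \<le> (LINT \<xi>|\<mu>. 2 * norm (u - v) * norm \<xi>)"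
    using norm_exp_pairing_diff_le[OF u] prob_algebra_MDD(3)[OF \<mu>] integrable_exp_pairing[OF \<mu>] u
    by (intro integral_mono integrable_mult_right[OF int] integrable_norm Bochner_Integration.integrable_diff) auto
  finally show ?thesis by simp
qed

lemma continuous_on_integral_exp_pairing:
  fixes g :: "real \<times> real \<Rightarrow> complex"
  assumes \<mu>: "\<mu> \<in> space (prob_algebra MD)" and g: "integrable \<mu> g"
  shows "continuous_on U (\<lambda>u. CLINT \<xi>|\<mu>. g \<xi> * exp (pairing u \<xi>))"
  unfolding continuous_on_sequentially
proof (intro allI impI ballI, elim conjE)
  fix X u assume u: "u \<in> U" and X: "\<forall>n. X n \<in> U" "X \<longlonglongrightarrow> u"
  note bm = borel_measurable_prob_MD[OF \<mu>]
  have [measurable]: "(\<lambda>\<xi>. exp (pairing u \<xi>)) \<in> borel_measurable \<mu>" for u by (rule bm) simp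
  have [measurable]: "g \<in> borel_measurable \<mu>" using g by auto
  have "(\<lambda>n. CLINT \<xi>|\<mu>. g \<xi> * exp (pairing (X n) \<xi>)) \<longlonglongrightarrow> (CLINT \<xi>|\<mu>. g \<xi> * exp (pairing u \<xi>))"
  proof (rule integral_dominated_convergence[where w = "\<lambda>\<xi>. norm (g \<xi>)"])
    show "AE \<xi> in \<mu>. (\<lambda>n. g \<xi> * exp (pairing (X n) \<xi>)) \<longlonglongrightarrow> g \<xi> * exp (pairing u \<xi>)"
      unfolding pairing_def using X by (intro AE_I2 tendsto_intros) auto
    show "AE \<xi> in \<mu>. norm (g \<xi> * exp (pairing (X n) \<xi>)) \<le> norm (g \<xi>)" for n
      unfolding norm_mult using X norm_exp_pairing_le prob_algebra_MDD(3)[OF \<mu>]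
      by (intro AE_I2 mult_right_le_one_le) auto
  qed (use g in auto)
  then show "((\<lambda>u. CLINT \<xi>|\<mu>. g \<xi> * exp (pairing u \<xi>)) \<circ> X) \<longlonglongrightarrow> (CLINT \<xi>|\<mu>. g \<xi> * exp (pairing u \<xi>))"
    by (simp add: o_def)
qed

lemma continuous_on_transform:
  assumes \<mu>: "\<mu> \<in> space (prob_algebra MD)"
  shows "continuous_on U (transform \<mu>)"
  using continuous_on_integral_exp_pairing[OF \<mu> integrable_bounded_MD[OF \<mu>, of "\<lambda>_. 1" 1]]
  by (simp add: transform_def[abs_def])

text \<open>The derivative at \<open>u\<close> in direction \<open>w\<close>, taken under the
  integral. At \<open>u = 0\<close> it collects the first moments.\<close>

definition transform_deriv :: "(real \<times> real) measure \<Rightarrow> complex \<times> complex \<Rightarrow> complex \<times> complex \<Rightarrow> complex" where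
  "transform_deriv \<mu> u w = (CLINT \<xi>|\<mu>. pairing w \<xi> * exp (pairing u \<xi>))"

context
  fixes \<mu> assumes \<mu>: "\<mu> \<in> space (prob_algebra MD)" and int: "integrable \<mu> norm"
begin

lemma integrable_fst_snd: "integrable \<mu> fst" "integrable \<mu> snd"
proof -
  note bm = borel_measurable_prob_MD[OF \<mu>]
  have "\<bar>fst \<xi>\<bar> \<le> norm \<xi>" "\<bar>snd \<xi>\<bar> \<le> norm \<xi>" for \<xi> :: "real \<times> real"
    using norm_fst_le[of "fst \<xi>" "snd \<xi>"] norm_snd_le[of "snd \<xi>" "fst \<xi>"] by simp_all
  then show "integrable \<mu> fst" "integrable \<mu> snd"
    by (auto intro!: Bochner_Integration.integrable_bound[OF int] bm AE_I2)
qed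

lemma integrable_pairing: "complex_integrable \<mu> (pairing w)"
  unfolding pairing_def[abs_def] using integrable_fst_snd
  by (intro Bochner_Integration.integrable_add integrable_mult_right integrable_of_real) auto

lemma integrable_pairing_exp: "u \<in> U \<Longrightarrow> complex_integrable \<mu> (\<lambda>\<xi>. pairing w \<xi> * exp (pairing u \<xi>))"
proof -
  assume u: "u \<in> U"
  note bm = borel_measurable_prob_MD[OF \<mu>]
  show ?thesis
    by (rule Bochner_Integration.integrable_bound[OF integrable_pairing[of w]])
     (use norm_exp_pairing_le[OF u] prob_algebra_MDD(3)[OF \<mu>] in
      \<open>auto intro!: bm AE_I2 mult_right_le_one_le simp: norm_mult\<close>)
qed

lemma continuous_on_transform_deriv: "continuous_on U (\<lambda>u. transform_deriv \<mu> u w)"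
  unfolding transform_deriv_def
  by (rule continuous_on_integral_exp_pairing[OF \<mu> integrable_pairing])

lemma transform_deriv_expand:
  assumes u: "u \<in> U"
  shows "transform_deriv \<mu> u w = fst w * transform_deriv \<mu> u (1, 0) + snd w * transform_deriv \<mu> u (0, 1)"
proof -
  have "transform_deriv \<mu> u w = (CLINT \<xi>|\<mu>. fst w * (pairing (1, 0) \<xi> * exp (pairing u \<xi>))
      + snd w * (pairing (0, 1) \<xi> * exp (pairing u \<xi>)))"
    unfolding transform_deriv_def
    by (intro Bochner_Integration.integral_cong refl) (simp add: pairing_def algebra_simps)
  also have "\<dots> = fst w * transform_deriv \<mu> u (1, 0) + snd w * transform_deriv \<mu> u (0, 1)"
    unfolding transform_deriv_def using integrable_pairing_exp[OF u] by simp
  finally show ?thesis .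
qed

lemma transform_deriv_0: "transform_deriv \<mu> 0 w = fst w * (LINT \<xi>|\<mu>. fst \<xi>) + snd w * (LINT \<xi>|\<mu>. snd \<xi>)"
proof -
  have "transform_deriv \<mu> 0 (1, 0) = (LINT \<xi>|\<mu>. fst \<xi>)" "transform_deriv \<mu> 0 (0, 1) = (LINT \<xi>|\<mu>. snd \<xi>)"
    by (simp_all add: transform_deriv_def pairing_def)
  then show ?thesis by (subst transform_deriv_expand) simp_all
qed

text \<open>Dominated convergence for the relative error \<open>e\<close>: after division by the
  increment of \<open>u\<close>, the increment of \<open>exp\<close> and the linear term are at most
  \<open>2 * norm \<xi>\<close> each. The bounds hold for arguments in \<open>U\<close>, hence the
  derivative is relative to \<open>U\<close> and exists at boundary points too.\<close>

lemma transform_has_derivative: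
  assumes u: "u \<in> U"
  shows "(transform \<mu> has_derivative transform_deriv \<mu> u) (at u within U)"
  unfolding has_derivative_within tendsto_at_iff_sequentially
proof (intro conjI allI impI)
  show "bounded_linear (transform_deriv \<mu> u)"
  proof -
    have "bounded_linear (\<lambda>w. fst w * transform_deriv \<mu> u (1, 0) + snd w * transform_deriv \<mu> u (0, 1))"
      by (intro bounded_linear_add bounded_linear_compose[OF bounded_linear_mult_left] bounded_linear_fst bounded_linear_snd)
    moreover have "transform_deriv \<mu> u = (\<lambda>w. fst w * transform_deriv \<mu> u (1, 0) + snd w * transform_deriv \<mu> u (0, 1))"
      by (rule ext) (rule transform_deriv_expand[OF u])
    ultimately show ?thesis by metis
  qed
  fix X assume X: "\<forall>n. X n \<in> U - {u}" "X \<longlonglongrightarrow> u"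
  note bm = borel_measurable_prob_MD[OF \<mu>]
  define e where "e v \<xi> = (1 / norm (v - u)) *\<^sub>R (exp (pairing v \<xi>) - (exp (pairing u \<xi>) + pairing (v - u) \<xi> * exp (pairing u \<xi>)))" for v \<xi>
  have e_int: "(1 / norm (v - u)) *\<^sub>R (transform \<mu> v - (transform \<mu> u + transform_deriv \<mu> u (v - u))) = (CLINT \<xi>|\<mu>. e v \<xi>)"
    if "v \<in> U" for v
    unfolding e_def transform_def transform_deriv_def
    using integrable_exp_pairing[OF \<mu> that] integrable_exp_pairing[OF \<mu> u] integrable_pairing_exp[OF u]
    by simp
  have "(\<lambda>n. CLINT \<xi>|\<mu>. e (X n) \<xi>) \<longlonglongrightarrow> (CLINT \<xi>|\<mu>. 0)"
  proof (rule integral_dominated_convergence[where w = "\<lambda>\<xi>. 4 * norm \<xi>"])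
    show "AE \<xi> in \<mu>. (\<lambda>n. e (X n) \<xi>) \<longlonglongrightarrow> 0"
    proof (intro AE_I2)
      fix \<xi>
      have "((\<lambda>v. exp (pairing v \<xi>)) has_derivative (\<lambda>w. pairing w \<xi> * exp (pairing u \<xi>))) (at u within U)"
      proof -
        have "((\<lambda>v. pairing v \<xi>) has_derivative (\<lambda>w. pairing w \<xi>)) (at u within U)"
          unfolding pairing_def by (auto intro!: derivative_eq_intros)
        from has_derivative_compose[OF this DERIV_exp[unfolded has_field_derivative_def]]
        show ?thesis by (simp add: mult.commute)
      qed
      then have "((\<lambda>v. e v \<xi>) \<longlongrightarrow> 0) (at u within U)"
        unfolding has_derivative_within e_def by simp
      then show "(\<lambda>n. e (X n) \<xi>) \<longlonglongrightarrow> 0"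
        using X unfolding tendsto_at_iff_sequentially o_def by blast
    qed
    show "AE \<xi> in \<mu>. norm (e (X n) \<xi>) \<le> 4 * norm \<xi>" for n
    proof (intro AE_I2)
      fix \<xi> assume "\<xi> \<in> space \<mu>"
      then have \<xi>: "\<xi> \<in> D" using prob_algebra_MDD(3)[OF \<mu>] by simp
      have Xn: "X n \<in> U" "X n \<noteq> u" using X by auto
      have "norm (exp (pairing (X n) \<xi>) - (exp (pairing u \<xi>) + pairing (X n - u) \<xi> * exp (pairing u \<xi>)))
        \<le> norm (exp (pairing (X n) \<xi>) - exp (pairing u \<xi>)) + norm (pairing (X n - u) \<xi> * exp (pairing u \<xi>))"
        unfolding diff_diff_eq[symmetric] by (rule norm_triangle_ineq4)
      also have "\<dots> \<le> 2 * norm (X n - u) * norm \<xi> + 2 * norm (X n - u) * norm \<xi> * 1"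
        unfolding norm_mult
        by (intro add_mono mult_mono norm_exp_pairing_diff_le norm_pairing_le norm_exp_pairing_le Xn u \<xi>) auto
      also have "\<dots> = norm (X n - u) * (4 * norm \<xi>)" by simp
      finally show "norm (e (X n) \<xi>) \<le> 4 * norm \<xi>"
        using Xn by (simp add: e_def divide_le_eq mult_ac)
    qed
  qed (use int in \<open>auto intro!: bm simp: e_def\<close>)
  then show "((\<lambda>v. (1 / norm (v - u)) *\<^sub>R (transform \<mu> v - (transform \<mu> u + transform_deriv \<mu> u (v - u)))) \<circ> X) \<longlonglongrightarrow> 0"
    using e_int X by (simp add: o_def)
qed

end

section \<open>Measurable solutions of functional equations\<close>

text \<open>\<open>s = 1\<close> shows that the real part is 0; a nonzero imaginary part could be
  scaled to plus or minus \<open>pi\<close>, where the cosine is -1.\<close>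

lemma exp_multiples_eq_1:
  fixes z :: complex
  assumes "\<And>s::real. (0::real) \<le> s \<Longrightarrow> exp (complex_of_real s * z) = 1"
  shows "z = 0"
proof -
  have "exp z = 1" using assms[OF zero_le_one] by simp
  then have "norm (exp z) = 1" by (metis norm_one)
  then have Re: "Re z = 0" by simp
  have "Im z = 0"
  proof (rule ccontr)
    assume Im: "Im z \<noteq> 0"
    define s where "s = pi / \<bar>Im z\<bar>"
    have "exp (s * z) = 1" by (rule assms) (simp add: s_def)
    then have "cos (s * Im z) = 1" using Re by (simp add: complex_eq_iff Re_exp)
    moreover have "s * Im z = pi \<or> s * Im z = - pi" using Im by (auto simp: s_def abs_if)
    ultimately show False by auto
  qed
  with Re show ?thesis by (simp add: complex_eq_iff)
qed

text \<open>Far enough along the sequence the argument lies in the strip where \<open>Ln\<close>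
  inverts \<open>exp\<close>.\<close>

lemma exp_fractions_eq_1:
  fixes z :: complex
  assumes "\<And>n::nat. exp (z / of_nat (Suc n)) = 1"
  shows "z = 0"
proof -
  obtain n :: nat where n: "norm z < real n" using reals_Archimedean2 by blast
  have "norm (z / of_nat (Suc n)) < 1" using n by (simp add: norm_divide divide_less_eq del: of_nat_Suc)
  then have "\<bar>Im (z / of_nat (Suc n))\<bar> < pi"
    using abs_Im_le_cmod[of "z / of_nat (Suc n)"] pi_gt3 by linarith
  then have "Ln (exp (z / of_nat (Suc n))) = z / of_nat (Suc n)" by (intro Ln_exp; linarith)
  then show ?thesis using assms[of n] by (simp del: of_nat_Suc)
qed

text \<open>The difference of \<open>a\<close> and \<open>b\<close>, up to a constant, takes values
  in the multiples of \<open>2 * pi * \<i>\<close>, which are more than 1 apart; so it is constant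
  on a connected set.\<close>

lemma continuous_logs_eq:
  fixes a b :: "'a :: topological_space \<Rightarrow> complex"
  assumes S: "connected S" and a: "continuous_on S a" and b: "continuous_on S b"
    and exp_eq: "\<And>x. x \<in> S \<Longrightarrow> exp (a x) = exp (b x)" and x0: "x0 \<in> S" "a x0 = b x0" and x: "x \<in> S"
  shows "a x = b x"
proof -
  have "(\<lambda>x. a x - b x) constant_on S"
  proof (rule continuous_discrete_range_constant[OF S])
    show "continuous_on S (\<lambda>x. a x - b x)" using a b by (intro continuous_intros)
    show "\<exists>e>0. \<forall>y. y \<in> S \<and> a y - b y \<noteq> a x - b x \<longrightarrow> e \<le> norm ((a y - b y) - (a x - b x))"
      if x: "x \<in> S" for x
    proof (intro exI[of _ 1] conjI allI impI)
      fix y assume y: "y \<in> S \<and> a y - b y \<noteq> a x - b x"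
      define z where "z = (a y - b y) - (a x - b x)"
      have e: "exp z = 1" using exp_eq[of x] exp_eq[of y] x y by (simp add: z_def exp_diff)
      show "1 \<le> norm ((a y - b y) - (a x - b x))"
      proof (rule ccontr)
        assume "\<not> ?thesis"
        then have "\<bar>Im z\<bar> < pi" using abs_Im_le_cmod[of z] pi_gt3 by (simp add: z_def)
        then have "Ln (exp z) = z" by (intro Ln_exp) auto
        then show False using e y by (simp add: z_def)
      qed
    qed simp
  qed
  then obtain k where "\<And>x. x \<in> S \<Longrightarrow> a x - b x = k" by (auto simp: constant_on_def)
  from this[OF x] this[OF x0(1)] x0(2) show ?thesis by simp
qed

text \<open>The integral over \<open>[0, 1]\<close> of the bounded measurable character \<open>exp (\<i> * f t / n)\<close> is nonzero for
  large \<open>n\<close>, which makes the character differentiable; additivity removes the ambiguity of its logarithm.\<close>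

lemma measurable_additive_linear:
  fixes f :: "real \<Rightarrow> real"
  assumes meas [measurable]: "(\<lambda>t. f (max 0 t)) \<in> borel_measurable borel"
    and add: "\<And>s t. 0 \<le> s \<Longrightarrow> 0 \<le> t \<Longrightarrow> f (s + t) = f s + f t"
  shows "\<exists>a. \<forall>t\<ge>0. f t = a * t"
proof -
  define G where "G n t = iexp (f (max 0 t) / real (Suc n))" for n t
  have G_meas [measurable]: "G n \<in> borel_measurable borel" for n unfolding G_def by measurable
  have G_norm: "norm (G n t) = 1" for n t by (simp add: G_def)
  have G_mult: "G n (s + t) = G n s * G n t" if "0 \<le> s" "0 \<le> t" for n s t
    using that by (simp add: G_def add exp_add add_divide_distrib distrib_left)
  have "(\<lambda>n. CLBINT t:{0..1}. G n t) \<longlonglongrightarrow> (CLBINT t:{0..1::real}. 1)"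
    unfolding set_lebesgue_integral_def
  proof (rule integral_dominated_convergence[where w = "indicator {0..1}"])
    show "AE t in lborel. (\<lambda>n. indicator {0..1} t *\<^sub>R G n t) \<longlonglongrightarrow> indicator {0..1} t *\<^sub>R 1"
    proof (intro AE_I2 tendsto_intros)
      fix t
      have "(\<lambda>n. f (max 0 t) / real (Suc n)) \<longlonglongrightarrow> 0"
        using LIMSEQ_Suc[OF lim_const_over_n[of "f (max 0 t)"]] by simp
      then have "(\<lambda>n. iexp (f (max 0 t) / real (Suc n))) \<longlonglongrightarrow> iexp 0" by (intro tendsto_intros)
      then show "(\<lambda>n. G n t) \<longlonglongrightarrow> 1" by (simp add: G_def)
    qed
    show "AE t in lborel. norm (indicator {0..1} t *\<^sub>R G n t) \<le> indicator {0..1} t" for n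
      by (auto simp: G_norm split: split_indicator)
  qed (auto simp: emeasure_lborel_Icc_eq)
  moreover have "(CLBINT t:{0..1::real}. 1) \<noteq> 0" by (simp add: set_lebesgue_integral_def)
  ultimately have "\<forall>\<^sub>F n in sequentially. (CLBINT t:{0..1}. G n t) \<noteq> 0"
    by (rule tendsto_imp_eventually_ne)
  then obtain n where I: "(CLBINT t:{0..1}. G n t) \<noteq> 0" by (auto simp: eventually_sequentially)
  define I where "I = (CLBINT t:{0..1}. G n t)"
  have G_int: "set_integrable lborel {a..b} (G n)" for a b
    unfolding set_integrable_def
    by (rule integrableI_bounded_set_indicator[where B = 1]) (auto simp: G_norm emeasure_lborel_Icc_eq)
  have G_hk: "G n integrable_on {a..b}" for a b
    using set_borel_integral_eq_integral(1)[OF G_int] by blast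
  define H where "H t = integral {0..t} (G n)" for t
  \<comment> \<open>Multiplicativity turns the factor \<open>I\<close> into a moving integral of
    \<open>G n\<close>, a difference of values of \<open>H\<close>; being nonzero, \<open>I\<close>
    can be divided out.\<close>
  have shift: "G n t * I = H (t + 1) - H t" if t: "0 \<le> t" for t
  proof -
    have "G n t * I = (CLBINT s:{0..1}. G n (t + s))"
      unfolding I_def set_lebesgue_integral_def using t
      by (subst integral_mult_right_zero[symmetric])
        (intro Bochner_Integration.integral_cong, auto simp: G_mult split: split_indicator)
    also have "\<dots> = (CLBINT s:{t..t+1}. G n s)"
      unfolding set_lebesgue_integral_def
      by (subst lborel_integral_real_affine[of 1 _ t])
        (auto intro!: Bochner_Integration.integral_cong split: split_indicator)
    also have "\<dots> = integral {t..t+1} (G n)"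
      by (rule set_borel_integral_eq_integral(2)[OF G_int])
    also have "\<dots> = H (t + 1) - H t"
      unfolding H_def using Henstock_Kurzweil_Integration.integral_combine[OF _ _ G_hk, of 0 t "t + 1"] t
      by (simp add: eq_diff_eq add.commute)
    finally show ?thesis .
  qed
  have H_cont: "continuous_on {0..b} H" for b
    unfolding H_def by (rule indefinite_integral_continuous_1[OF G_hk])
  have I0: "I \<noteq> 0" using I by (simp add: I_def)
  have G_cont: "continuous_on {0..b} (G n)" for b
  proof -
    have "continuous_on {0..b} (\<lambda>t. (H (t + 1) - H t) / I)"
      by (intro continuous_intros H_cont continuous_on_compose2[OF H_cont[of "b + 1"], where f = "\<lambda>t. t + 1"]) (use I0 in auto)
    then show ?thesis
      by (rule continuous_on_eq) (use shift I0 in \<open>simp add: field_simps\<close>)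
  qed
  have H_deriv: "(H has_vector_derivative G n t) (at t within {0..b})" if "t \<in> {0..b}" for t b
    unfolding H_def by (rule integral_has_vector_derivative[OF G_cont that])
  \<comment> \<open>Differentiating \<open>G n t = (H (t + 1) - H t) / I\<close> gives
    \<open>(G n (t + 1) - G n t) / I\<close>, and multiplicativity factors this constant
    out.\<close>
  define k where "k = (G n 1 - 1) / I"
  have G_deriv: "(G n has_vector_derivative k * G n t) (at t within {0..b})" if t: "t \<in> {0..b}" for t b
  proof -
    have 1: "(H has_vector_derivative G n (t + 1)) (at (t + 1) within (\<lambda>t. t + 1) ` {0..b})"
      by (rule has_vector_derivative_within_subset[OF H_deriv[of "t + 1" "b + 1"]]) (use t in auto)
    have "((\<lambda>t. t + 1) has_vector_derivative 1) (at t within {0..b})"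
      by (auto intro!: derivative_eq_intros)
    from vector_diff_chain_within[OF this 1]
    have "((\<lambda>t. H (t + 1)) has_vector_derivative G n (t + 1)) (at t within {0..b})" by (simp add: o_def)
    then have "((\<lambda>t. (H (t + 1) - H t) / I) has_vector_derivative (G n (t + 1) - G n t) / I) (at t within {0..b})"
      by (intro has_vector_derivative_divide has_vector_derivative_diff H_deriv t)
    moreover have "(G n (t + 1) - G n t) / I = k * G n t"
      using t by (simp add: k_def G_mult algebra_simps diff_divide_distrib)
    ultimately show ?thesis
      using t by (auto intro: has_vector_derivative_transform[rotated 2] simp: shift[symmetric] I0)
  qed
  have G_exp: "G n t = exp (k * t)" if t: "0 \<le> t" for t
  proof -
    obtain c where c: "\<And>s. s \<in> {0..t} \<Longrightarrow> exp (- k * s) * G n s = c"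
    proof (rule has_vector_derivative_zero_constant)
      fix s assume s: "s \<in> {0..t}"
      have "((\<lambda>s. exp (- k * of_real s)) has_vector_derivative - k * exp (- k * s)) (at s within {0..t})"
        by (rule has_vector_derivative_real_field[of "\<lambda>z. exp (- k * z)", THEN has_vector_derivative_at_within])
           (auto intro!: derivative_eq_intros)
      from has_vector_derivative_mult[OF this G_deriv[OF s]]
      show "((\<lambda>s. exp (- k * s) * G n s) has_vector_derivative 0) (at s within {0..t})" by simp
    qed auto
    have "f 0 = 0" using add[of 0 0] by simp
    then have "c = 1" using c[of 0] t by (simp add: G_def)
    then show ?thesis using c[of t] t by (simp add: exp_minus field_simps)
  qed
  have "\<i> * (f t / Suc n) = k * t" if t: "0 \<le> t" for t
  proof -
    have "\<i> * (f t / Suc n) - k * t = 0"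
    proof (rule exp_fractions_eq_1)
      fix m :: nat
      define s where "s = t / real (Suc m)"
      have s: "0 \<le> s" using t by (simp add: s_def)
      have "f (real j * s) = real j * f s" for j
        by (induction j) (use s add[of 0 0] in \<open>auto simp: add distrib_right\<close>)
      from this[of "Suc m"] have ft: "f t = real (Suc m) * f s" by (simp add: s_def del: of_nat_Suc)
      have "t = real (Suc m) * s" by (simp add: s_def del: of_nat_Suc)
      then have "(\<i> * (f t / Suc n) - k * t) / of_nat (Suc m) = \<i> * (f s / Suc n) - k * s"
        using ft by (simp add: field_simps del: of_nat_Suc)
      moreover have "exp (\<i> * (f s / Suc n)) = exp (k * s)" using G_exp[OF s] s by (simp add: G_def)
      ultimately show "exp ((\<i> * (f t / Suc n) - k * t) / of_nat (Suc m)) = 1"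
        by (simp only: exp_diff) simp
    qed
    then show ?thesis by simp
  qed
  then have eq: "\<i> * (f t / Suc n) = k * t" if "0 \<le> t" for t using that by blast
  have "f t = (Im k * Suc n) * t" if "0 \<le> t" for t
  proof -
    have "Im (\<i> * complex_of_real (f t / Suc n)) = Im (k * complex_of_real t)" using eq[OF that] by (simp only:)
    then show ?thesis by (simp add: field_simps del: of_nat_Suc)
  qed
  then show ?thesis by blast
qed

lemma measurable_multiplicative_exp:
  fixes p :: "real \<Rightarrow> real"
  assumes [measurable]: "(\<lambda>t. p (max 0 t)) \<in> borel_measurable borel"
    and mult: "\<And>s t. 0 \<le> s \<Longrightarrow> 0 \<le> t \<Longrightarrow> p (s + t) = p s * p t" and pos: "\<And>t. 0 \<le> t \<Longrightarrow> 0 < p t"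
  shows "\<exists>a. \<forall>t\<ge>0. p t = exp (a * t)"
proof -
  have "\<exists>a. \<forall>t\<ge>0. ln (p t) = a * t"
    by (rule measurable_additive_linear) (use mult pos in \<open>auto simp: ln_mult_pos\<close>)
  then show ?thesis using pos by (metis exp_ln)
qed

text \<open>The integral of \<open>exp (k * s)\<close> over \<open>s\<close> from 0 to
  \<open>t\<close>.\<close>

definition exp_integral :: "real \<Rightarrow> real \<Rightarrow> real" where
  "exp_integral k t = (if k = 0 then t else (exp (k * t) - 1) / k)"

text \<open>For \<open>k = 0\<close> the equation is additivity. Otherwise the two ways of computing
  \<open>g (1 + t)\<close> determine \<open>g t\<close> from \<open>g 1\<close>.\<close>

lemma measurable_exp_cocycle:
  fixes g :: "real \<Rightarrow> real"
  assumes meas: "(\<lambda>t. g (max 0 t)) \<in> borel_measurable borel"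
    and cocycle: "\<And>s t. 0 \<le> s \<Longrightarrow> 0 \<le> t \<Longrightarrow> g (s + t) = exp (k * s) * g t + g s"
  shows "\<exists>C. \<forall>t\<ge>0. g t = C * exp_integral k t"
proof (cases "k = 0")
  case True
  then show ?thesis using measurable_additive_linear[OF meas] cocycle by (auto simp: exp_integral_def)
next
  case False
  have "g t = g 1 * k / (exp k - 1) * exp_integral k t" if "0 \<le> t" for t
  proof -
    have "exp (k * 1) * g t + g 1 = exp (k * t) * g 1 + g t"
      using cocycle[of 1 t] cocycle[of t 1] that by (simp add: add.commute)
    then have "g t * (exp k - 1) = g 1 * (exp (k * t) - 1)" by (simp add: algebra_simps)
    then have "g t = g 1 * (exp (k * t) - 1) / (exp k - 1)" using False by (simp add: eq_divide_eq)
    then show ?thesis using False by (simp add: exp_integral_def)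
  qed
  then show ?thesis by blast
qed

section \<open>Continuous differentiability and absolute continuity\<close>

text \<open>Two-sided derivatives on the whole line: functions given for nonnegative times are
  compared with such an extension, which avoids one-sided derivatives at 0.\<close>

definition C1 :: "(real \<Rightarrow> real) \<Rightarrow> bool" where
  "C1 f \<longleftrightarrow> (\<exists>f'. continuous_on UNIV f' \<and> (\<forall>t. (f has_real_derivative f' t) (at t)))"

lemma C1_const: "C1 (\<lambda>_. k)"
  unfolding C1_def by (intro exI[of _ "\<lambda>_. 0"]) auto

lemma C1_ident: "C1 (\<lambda>t. t)"
  unfolding C1_def by (intro exI[of _ "\<lambda>_. 1"]) auto

lemma C1_exp: "C1 (\<lambda>t. exp (k * t))"
  unfolding C1_def
  by (intro exI[of _ "\<lambda>t. k * exp (k * t)"]) (auto intro!: derivative_eq_intros continuous_intros)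

lemma C1_continuous: "C1 f \<Longrightarrow> continuous_on UNIV f"
  unfolding C1_def by (metis DERIV_isCont continuous_at_imp_continuous_on)

lemma C1_add: "C1 f \<Longrightarrow> C1 g \<Longrightarrow> C1 (\<lambda>t. f t + g t)"
  unfolding C1_def by (blast intro: DERIV_add continuous_on_add)

lemma C1_mult:
  assumes "C1 f" "C1 g" shows "C1 (\<lambda>t. f t * g t)"
proof -
  obtain f' g' where "continuous_on UNIV f'" "\<forall>t. (f has_real_derivative f' t) (at t)"
    "continuous_on UNIV g'" "\<forall>t. (g has_real_derivative g' t) (at t)"
    using assms by (auto simp: C1_def)
  moreover have "continuous_on UNIV f" "continuous_on UNIV g" using assms C1_continuous by auto
  ultimately show ?thesis
    unfolding C1_def
    by (intro exI[of _ "\<lambda>t. f' t * g t + g' t * f t"] conjI allI DERIV_mult continuous_intros) auto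
qed

lemmas C1_intros = C1_const C1_ident C1_exp C1_add C1_mult

lemma C1_exp_integral: "C1 (exp_integral k)"
proof (cases "k = 0")
  case True
  then show ?thesis using C1_ident by (simp add: exp_integral_def[abs_def])
next
  case False
  have "C1 (\<lambda>t. exp (k * t) * (1 / k) + - (1 / k))" by (intro C1_intros)
  then show ?thesis using False by (simp add: exp_integral_def[abs_def] diff_divide_distrib)
qed

text \<open>A continuous derivative is bounded on a bounded interval, so \<open>h\<close> is
  Lipschitz there.\<close>

lemma C1_imp_absolutely_continuous:
  assumes H: "C1 H" and h: "\<And>t. 0 \<le> t \<Longrightarrow> h t = H t"
  shows "absolutely_continuous_on_nonneg h"
  unfolding absolutely_continuous_on_nonneg_def absolutely_continuous_on_interval_def
proof (intro allI impI, elim conjE)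
  fix a b \<epsilon> :: real assume ab: "0 \<le> a" "a \<le> b" and \<epsilon>: "0 < \<epsilon>"
  obtain H' where H': "continuous_on UNIV H'" "\<And>t. (H has_real_derivative H' t) (at t)"
    using H by (auto simp: C1_def)
  have "bounded (H' ` {a..b})"
    by (intro compact_imp_bounded compact_continuous_image continuous_on_subset[OF H'(1)]) auto
  then obtain L where L: "0 < L" "\<And>t. t \<in> {a..b} \<Longrightarrow> norm (H' t) \<le> L" by (auto simp: bounded_pos)
  have lip: "\<bar>h s - h r\<bar> \<le> L * (s - r)" if "a \<le> r" "r \<le> s" "s \<le> b" for r s
  proof -
    have "norm (H s - H r) \<le> L * norm (s - r)"
      by (rule field_differentiable_bound[of "{a..b}" H H'])
        (use that L H' in \<open>auto intro: has_field_derivative_at_within\<close>)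
    then show ?thesis using h that ab by simp
  qed
  show "\<exists>\<delta>>0. \<forall>(n::nat) l r. (\<forall>i<n. a \<le> l i \<and> l i \<le> r i \<and> r i \<le> b) \<and>
      disjoint_family_on (\<lambda>i. {l i<..<r i}) {..<n} \<and> (\<Sum>i<n. r i - l i) < \<delta> \<longrightarrow>
      (\<Sum>i<n. \<bar>h (r i) - h (l i)\<bar>) < \<epsilon>"
  proof (intro exI[of _ "\<epsilon> / L"] conjI allI impI, use \<epsilon> L in simp, elim conjE)
    fix n :: nat and l r :: "nat \<Rightarrow> real"
    assume lr: "\<forall>i<n. a \<le> l i \<and> l i \<le> r i \<and> r i \<le> b" and small: "(\<Sum>i<n. r i - l i) < \<epsilon> / L"
    have "(\<Sum>i<n. \<bar>h (r i) - h (l i)\<bar>) \<le> (\<Sum>i<n. L * (r i - l i))"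
      using lr by (intro sum_mono lip) auto
    also have "\<dots> = L * (\<Sum>i<n. r i - l i)" by (simp add: sum_distrib_left)
    also have "\<dots> < \<epsilon>" using small L by (simp add: field_simps)
    finally show "(\<Sum>i<n. \<bar>h (r i) - h (l i)\<bar>) < \<epsilon>" .
  qed
qed

section \<open>Rigidity of exponentials and consequences of weak continuity\<close>

text \<open>The equality case of the triangle inequality: rotated by the conjugate of its mean,
  \<open>f\<close> has real part at most 1 with mean 1, hence equal to 1 almost everywhere, and
  modulus at most 1 leaves no imaginary part.\<close>

lemma (in prob_space) AE_eq_expectation_if_norm_1:
  fixes f :: "'a \<Rightarrow> complex"
  assumes int: "complex_integrable M f" and le: "\<And>x. x \<in> space M \<Longrightarrow> norm (f x) \<le> 1"
    and norm_1: "norm (expectation f) = 1"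
  shows "AE x in M. f x = expectation f"
proof -
  define c where "c = expectation f"
  have c: "norm c = 1" using norm_1 by (simp add: c_def)
  have int2: "complex_integrable M (\<lambda>x. cnj c * f x)" using int by simp
  have re_le: "Re (cnj c * f x) \<le> 1" if "x \<in> space M" for x
    using complex_Re_le_cmod[of "cnj c * f x"] le[OF that] c by (simp add: norm_mult del: complex_cnj_mult)
  have "expectation (\<lambda>x. cnj c * f x) = 1"
    using c complex_norm_square[of c] by (simp add: c_def[symmetric] mult.commute)
  then have "expectation (\<lambda>x. 1 - Re (cnj c * f x)) = 0"
    using integral_Re[OF int2]
    by (subst Bochner_Integration.integral_diff[OF _ integrable_Re[OF int2]])
      (simp_all add: prob_space del: complex_cnj_mult times_complex.sel)
  moreover have "integrable M (\<lambda>x. 1 - Re (cnj c * f x))"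
    by (intro Bochner_Integration.integrable_diff integrable_Re[OF int2]) simp
  ultimately have "AE x in M. 1 - Re (cnj c * f x) = 0"
    using re_le by (subst (asm) integral_nonneg_eq_0_iff_AE) (auto intro!: AE_I2)
  then show ?thesis
  proof (rule AE_mp, intro AE_I2 impI)
    fix x assume x: "x \<in> space M" and "1 - Re (cnj c * f x) = 0"
    then have re: "Re (cnj c * f x) = 1" by simp
    have "norm (cnj c * f x) \<le> 1" using le[OF x] c by (simp add: norm_mult)
    then have "(Re (cnj c * f x))\<^sup>2 + (Im (cnj c * f x))\<^sup>2 \<le> 1"
      by (simp only: cmod_power2[symmetric] power_le_one norm_ge_zero)
    with re have "cnj c * f x = 1" by (simp add: complex_eq_iff)
    then have "c * (cnj c * f x) = c" by simp
    moreover have "c * cnj c = 1" using c complex_norm_square[of c] by simp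
    ultimately show "f x = expectation f" by (simp add: c_def[symmetric] mult.assoc[symmetric])
  qed
qed

text \<open>At a single \<open>x\<close> the exponents agree only modulo
  \<open>2 * pi * \<i>\<close>; scaling \<open>x\<close> along the half-axes of \<open>D\<close>
  removes the ambiguity.\<close>

lemma pairing_inj:
  assumes "\<And>x. x \<in> D \<Longrightarrow> exp (pairing a x) = exp (pairing b x)"
  shows "a = b"
proof (rule prod_eqI)
  have "fst a - fst b = 0"
  proof (rule exp_multiples_eq_1)
    fix s :: real assume "0 \<le> s"
    then have "(s, 0) \<in> D" by (simp add: D_def)
    from assms[OF this] show "exp (complex_of_real s * (fst a - fst b)) = 1"
      by (simp add: pairing_def right_diff_distrib exp_diff mult.commute)
  qed
  then show "fst a = fst b" by simp
  have "snd a - snd b = 0"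
  proof (rule exp_multiples_eq_1)
    fix s :: real assume "0 \<le> s"
    have "(0, s) \<in> D" by (simp add: D_def)
    from assms[OF this] show "exp (complex_of_real s * (snd a - snd b)) = 1"
      by (simp add: pairing_def right_diff_distrib exp_diff mult.commute)
  qed
  then show "snd a = snd b" by simp
qed

lemma (in prob_space) AE_obtain:
  assumes "AE x in M. P x" obtains x where "P x"
proof -
  have "\<exists>x. P x"
  proof (rule ccontr)
    assume "\<nexists>x. P x"
    with assms have "AE x in M. False" by simp
    then show False by simp
  qed
  then show ?thesis using that by blast
qed

lemma convex_U: "convex U"
  unfolding U_def
  by (intro convex_Times convex_halfspace_Re_le) (auto simp: convex_def)

lemma connected_U: "connected U"
  using convex_U by (rule convex_connected)

lemma scale_mem_U: "u \<in> U \<Longrightarrow> 0 \<le> s \<Longrightarrow> (complex_of_real s * fst u, complex_of_real s * snd u) \<in> U"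
  by (auto simp: U_def mult_nonneg_nonpos)

lemma transform_return: "x \<in> D \<Longrightarrow> transform (return MD x) u = exp (pairing u x)"
  by (simp add: transform_def integral_return)

lemma weakly_continuous_complex:
  fixes f :: "real \<times> real \<Rightarrow> complex"
  assumes wc: "weakly_continuous \<mu>" and \<mu>: "\<And>t. 0 \<le> t \<Longrightarrow> \<mu> t \<in> space (prob_algebra MD)"
    and f: "continuous_on D f" "\<And>\<xi>. \<xi> \<in> D \<Longrightarrow> norm (f \<xi>) \<le> B"
  shows "continuous_on {0..} (\<lambda>t. CLINT \<xi>|\<mu> t. f \<xi>)"
proof -
  have [measurable]: "f \<in> borel_measurable MD" using f by (intro borel_measurable_continuous_on_restrict)
  have int: "complex_integrable (\<mu> t) f" if "0 \<le> t" for t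
    by (rule integrable_bounded_MD[OF \<mu>[OF that]]) (use f in auto)
  have bRe: "\<bar>Re (f x)\<bar> \<le> B" and bIm: "\<bar>Im (f x)\<bar> \<le> B" if "x \<in> D" for x
    using f(2)[OF that] abs_Re_le_cmod[of "f x"] abs_Im_le_cmod[of "f x"] by linarith+
  have "continuous_on {0..} (\<lambda>t. LINT \<xi>|\<mu> t. Re (f \<xi>))" "continuous_on {0..} (\<lambda>t. LINT \<xi>|\<mu> t. Im (f \<xi>))"
    using f bRe bIm
    by (auto intro!: wc[unfolded weakly_continuous_def, rule_format] continuous_intros boundedI[where B = B])
  then have "continuous_on {0..} (\<lambda>t. Complex (LINT \<xi>|\<mu> t. Re (f \<xi>)) (LINT \<xi>|\<mu> t. Im (f \<xi>)))"
    by (simp add: complex_eq continuous_intros)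
  then show ?thesis
    by (rule continuous_on_eq) (use int in \<open>auto simp: complex_eq_iff\<close>)
qed

lemma weakly_continuous_transform:
  assumes wc: "weakly_continuous \<mu>" and \<mu>: "\<And>t. 0 \<le> t \<Longrightarrow> \<mu> t \<in> space (prob_algebra MD)" and u: "u \<in> U"
  shows "continuous_on {0..} (\<lambda>t. transform (\<mu> t) u)"
  unfolding transform_def
  by (rule weakly_continuous_complex[OF wc \<mu>, where B = 1])
    (use norm_exp_pairing_le[OF u] in \<open>auto simp: pairing_def intro!: continuous_intros\<close>)

text \<open>Weak continuity does not reach an unbounded \<open>f\<close>: the truncations have
  continuous integrals, and their pointwise limit is merely seen to be measurable. This is why the
  functional equations are solved among measurable functions. \<open>max 0\<close> extends the time
  axis to all reals.\<close>

lemma weakly_continuous_integral_measurable: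
  fixes f :: "real \<times> real \<Rightarrow> real"
  assumes wc: "weakly_continuous \<mu>" and \<mu>: "\<And>t. 0 \<le> t \<Longrightarrow> \<mu> t \<in> space (prob_algebra MD)"
    and f: "continuous_on D f" and int: "\<And>t. 0 \<le> t \<Longrightarrow> integrable (\<mu> t) f"
  shows "(\<lambda>t. LINT \<xi>|\<mu> (max 0 t). f \<xi>) \<in> borel_measurable borel"
proof (rule borel_measurable_LIMSEQ_real)
  define g where "g n \<xi> = max (- real n) (min (real n) (f \<xi>))" for n \<xi>
  have g_cont: "continuous_on D (g n)" for n unfolding g_def by (intro continuous_intros f)
  have [measurable]: "g n \<in> borel_measurable MD" for n using g_cont by (rule borel_measurable_continuous_on_restrict)
  show "(\<lambda>n. LINT \<xi>|\<mu> (max 0 t). g n \<xi>) \<longlonglongrightarrow> (LINT \<xi>|\<mu> (max 0 t). f \<xi>)" for t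
  proof (rule integral_dominated_convergence[where w = "\<lambda>\<xi>. \<bar>f \<xi>\<bar>"])
    note \<mu>t = \<mu>[of "max 0 t", simplified]
    show "g n \<in> borel_measurable (\<mu> (max 0 t))" for n
      using measurable_cong_sets[OF prob_algebra_MDD(2)[OF \<mu>t] refl, of borel] \<open>g n \<in> borel_measurable MD\<close> by blast
    show "AE \<xi> in \<mu> (max 0 t). (\<lambda>n. g n \<xi>) \<longlonglongrightarrow> f \<xi>"
    proof (intro AE_I2 tendsto_eventually)
      fix \<xi>
      obtain n0 :: nat where n0: "\<bar>f \<xi>\<bar> < real n0" using reals_Archimedean2 by blast
      show "\<forall>\<^sub>F n in sequentially. g n \<xi> = f \<xi>"
        by (rule eventually_sequentiallyI[of n0]) (use n0 in \<open>auto simp: g_def\<close>)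
    qed
    show "AE \<xi> in \<mu> (max 0 t). norm (g n \<xi>) \<le> \<bar>f \<xi>\<bar>" for n
      by (rule AE_I2) (auto simp: g_def)
  qed (use int[of "max 0 t"] in auto)
  show "(\<lambda>t. LINT \<xi>|\<mu> (max 0 t). g n \<xi>) \<in> borel_measurable borel" for n
  proof (intro borel_measurable_continuous_onI)
    have "bounded (g n ` D)" unfolding bounded_iff by (intro exI[of _ "real n"]) (auto simp: g_def)
    then have "continuous_on {0..} (\<lambda>t. LINT \<xi>|\<mu> t. g n \<xi>)"
      using wc g_cont by (auto simp: weakly_continuous_def)
    then show "continuous_on UNIV (\<lambda>t. LINT \<xi>|\<mu> (max 0 t). g n \<xi>)"
      by (rule continuous_on_compose2) (auto intro!: continuous_intros)
  qed
qed

lemma integrable_norm_MD: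
  assumes "\<mu> \<in> space (prob_algebra MD)" "(\<integral>\<^sup>+\<xi>. ennreal (norm \<xi>) \<partial>\<mu>) < \<infinity>"
  shows "integrable \<mu> norm"
  by (rule integrableI_bounded) (use assms borel_measurable_prob_MD[of \<mu> norm] in auto)

text \<open>The chain rule along a curve that stays in \<open>U\<close>, where the transform is
  differentiable. It serves the imaginary axes and their images under
  \<open>\<psi> t\<close>.\<close>

lemma transform_curve_deriv:
  fixes v :: "real \<Rightarrow> complex \<times> complex" and v' :: "complex \<times> complex"
  assumes \<mu>: "\<mu> \<in> space (prob_algebra MD)" and int: "integrable \<mu> norm"
    and v: "\<And>\<theta>. v \<theta> \<in> U" "v 0 = 0" "(v has_vector_derivative v') (at 0)"
  shows "((\<lambda>\<theta>. transform \<mu> (v \<theta>)) has_vector_derivative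
    (fst v' * (LINT \<xi>|\<mu>. fst \<xi>) + snd v' * (LINT \<xi>|\<mu>. snd \<xi>))) (at 0)"
proof -
  have "(transform \<mu> has_derivative transform_deriv \<mu> 0) (at (v 0) within range v)"
    using transform_has_derivative[OF \<mu> int zero_mem_U] v by (auto intro: has_derivative_subset)
  from has_derivative_in_compose[OF v(3)[unfolded has_vector_derivative_def] this]
  have "((\<lambda>\<theta>. transform \<mu> (v \<theta>)) has_derivative (\<lambda>s. transform_deriv \<mu> 0 (s *\<^sub>R v'))) (at 0)" .
  moreover have "transform_deriv \<mu> 0 (s *\<^sub>R v') = s *\<^sub>R (fst v' * (LINT \<xi>|\<mu>. fst \<xi>) + snd v' * (LINT \<xi>|\<mu>. snd \<xi>))" for s
    by (simp add: transform_deriv_0[OF \<mu> int] scaleR_conv_of_real algebra_simps)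
  ultimately show ?thesis by (simp add: has_vector_derivative_def)
qed

section \<open>Structure of the semigroup and its first moments\<close>

locale affine_immigration =
  fixes Q :: "real \<Rightarrow> real \<times> real \<Rightarrow> (real \<times> real) measure"
    and \<psi> :: "real \<Rightarrow> complex \<times> complex \<Rightarrow> complex \<times> complex"
    and \<gamma> :: "real \<Rightarrow> (real \<times> real) measure"
  assumes HA: "HA_semigroup Q \<psi>"
    and Q_weakly_continuous: "x \<in> D \<Longrightarrow> weakly_continuous (\<lambda>t. Q t x)"
    and SC: "SC_semigroup Q \<gamma>"
    and \<gamma>_weakly_continuous: "weakly_continuous \<gamma>"
    and Q_moment: "0 \<le> t \<Longrightarrow> x \<in> D \<Longrightarrow> (\<integral>\<^sup>+\<xi>. ennreal (norm \<xi>) \<partial>Q t x) < \<infinity>"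
    and \<gamma>_moment: "0 \<le> t \<Longrightarrow> (\<integral>\<^sup>+\<xi>. ennreal (norm \<xi>) \<partial>\<gamma> t) < \<infinity>"
begin

lemma Q_measurable: "0 \<le> t \<Longrightarrow> Q t \<in> MD \<rightarrow>\<^sub>M prob_algebra MD"
  using HA by (simp add: HA_semigroup_def transition_semigroup_def)

lemma Q_0: "x \<in> D \<Longrightarrow> Q 0 x = return MD x"
  using HA by (simp add: HA_semigroup_def transition_semigroup_def)

lemma Q_add: "0 \<le> r \<Longrightarrow> 0 \<le> t \<Longrightarrow> x \<in> D \<Longrightarrow> Q (r + t) x = Q r x \<bind> Q t"
  using HA by (simp add: HA_semigroup_def transition_semigroup_def)

lemma Q_prob: "0 \<le> t \<Longrightarrow> x \<in> D \<Longrightarrow> Q t x \<in> space (prob_algebra MD)"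
  using measurable_space[OF Q_measurable] by simp

lemma \<gamma>_prob: "0 \<le> t \<Longrightarrow> \<gamma> t \<in> space (prob_algebra MD)"
  using SC by (simp add: SC_semigroup_def)

lemma \<gamma>_add: "0 \<le> r \<Longrightarrow> 0 \<le> t \<Longrightarrow> \<gamma> (r + t) = conv_D (\<gamma> r \<bind> Q t) (\<gamma> t)"
  using SC by (simp add: SC_semigroup_def)

lemma Q_integrable: "0 \<le> t \<Longrightarrow> x \<in> D \<Longrightarrow> integrable (Q t x) norm"
  using integrable_norm_MD Q_prob Q_moment by blast

lemma \<gamma>_integrable: "0 \<le> t \<Longrightarrow> integrable (\<gamma> t) norm"
  using integrable_norm_MD \<gamma>_prob \<gamma>_moment by blast

lemma \<psi>_continuous: "0 \<le> t \<Longrightarrow> continuous_on U (\<psi> t)"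
  using HA by (simp add: HA_semigroup_def)

lemma transform_Q: "0 \<le> t \<Longrightarrow> x \<in> D \<Longrightarrow> u \<in> U \<Longrightarrow> transform (Q t x) u = exp (pairing (\<psi> t u) x)"
  using HA by (simp add: HA_semigroup_def)

lemma Q_bind_prob: "M \<in> space (prob_algebra MD) \<Longrightarrow> 0 \<le> t \<Longrightarrow> M \<bind> Q t \<in> space (prob_algebra MD)"
  using bind_prob_algebra Q_measurable by blast

lemma Q_measurable_prob: "M \<in> space (prob_algebra MD) \<Longrightarrow> 0 \<le> t \<Longrightarrow> Q t \<in> M \<rightarrow>\<^sub>M prob_algebra MD"
  using Q_measurable measurable_cong_sets[OF prob_algebra_MDD(2) refl] by blast

lemma transform_bind_Q:
  assumes M: "M \<in> space (prob_algebra MD)" and t: "0 \<le> t" and u: "u \<in> U"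
  shows "transform (M \<bind> Q t) u = transform M (\<psi> t u)"
proof -
  have "transform (M \<bind> Q t) u = (CLINT x|M. transform (Q t x) u)"
    by (rule transform_bind[OF prob_algebra_MDD(1)[OF M] Q_measurable_prob[OF M t] u])
  also have "\<dots> = transform M (\<psi> t u)"
    unfolding transform_def[of M] using transform_Q[OF t _ u] prob_algebra_MDD(3)[OF M]
    by (intro Bochner_Integration.integral_cong) auto
  finally show ?thesis .
qed

lemma transform_\<gamma>_add:
  "0 \<le> r \<Longrightarrow> 0 \<le> t \<Longrightarrow> u \<in> U \<Longrightarrow> transform (\<gamma> (r + t)) u = transform (\<gamma> r) (\<psi> t u) * transform (\<gamma> t) u"
  by (simp add: \<gamma>_add transform_conv_D Q_bind_prob \<gamma>_prob transform_bind_Q)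

text \<open>Transforms have modulus at most 1, so \<open>pairing (\<psi> t u) x\<close> has
  nonpositive real part for all \<open>x\<close> in \<open>D\<close>; the points
  \<open>(0, 1)\<close> and \<open>(0, -1)\<close> together make the second coordinate
  imaginary.\<close>

lemma \<psi>_mem_U:
  assumes t: "0 \<le> t" and u: "u \<in> U"
  shows "\<psi> t u \<in> U"
proof -
  have "Re (pairing (\<psi> t u) x) \<le> 0" if "x \<in> D" for x
    using norm_transform_le[OF Q_prob[OF t that] u] by (simp add: transform_Q[OF t that u])
  from this[of "(1, 0)"] this[of "(0, 1)"] this[of "(0, -1)"]
  show ?thesis by (cases "\<psi> t u") (auto simp: U_def D_def pairing_def)
qed

lemma \<psi>_flow:
  assumes r: "0 \<le> r" and t: "0 \<le> t" and u: "u \<in> U"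
  shows "\<psi> (r + t) u = \<psi> r (\<psi> t u)"
proof (rule pairing_inj)
  fix x assume x: "x \<in> D"
  have "exp (pairing (\<psi> (r + t) u) x) = transform (Q r x \<bind> Q t) u"
    using r t x u by (simp add: transform_Q Q_add[symmetric])
  then show "exp (pairing (\<psi> (r + t) u) x) = exp (pairing (\<psi> r (\<psi> t u)) x)"
    using r t x u by (simp add: transform_bind_Q Q_prob transform_Q \<psi>_mem_U)
qed

lemma \<psi>_time_0: "u \<in> U \<Longrightarrow> \<psi> 0 u = u"
  by (rule pairing_inj) (metis Q_0 transform_Q transform_return order_refl)

lemma \<psi>_0: "0 \<le> t \<Longrightarrow> \<psi> t 0 = 0"
  by (rule pairing_inj) (simp add: transform_Q[symmetric] transform_0 Q_prob)

section \<open>The second coordinate of the flow\<close>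

text \<open>The real factor by which \<open>\<psi> t\<close> multiplies the second coordinate, read
  off at \<open>(0, \<i>)\<close>.\<close>

definition drift :: "real \<Rightarrow> real" where
  "drift t = Im (snd (\<psi> t (0, \<i>)))"

text \<open>From \<open>(0, 1)\<close> and \<open>(0, -1)\<close> the transforms of \<open>Q t\<close> are reciprocal, hence of modulus one, so the
  process started at \<open>(0, 1)\<close> is deterministic.\<close>

lemma snd_\<psi>:
  assumes t: "0 \<le> t" and u: "u \<in> U"
  shows "snd (\<psi> t u) = complex_of_real (drift t) * snd u"
proof -
  have e: "(0, 1) \<in> D" by (simp add: D_def)
  define M where "M = Q t (0, 1)"
  have M: "M \<in> space (prob_algebra MD)" using Q_prob[OF t e] by (simp add: M_def)
  interpret prob_space M using M by (rule prob_algebra_MDD)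
  have sp: "space M = D" using M by (rule prob_algebra_MDD)
  have tr: "transform M u = exp (snd (\<psi> t u))" if "u \<in> U" for u
    using transform_Q[OF t e that] by (simp add: M_def pairing_def)
  have norm_tr: "norm (transform M u) = 1" if "u \<in> U" for u
    using tr[OF that] \<psi>_mem_U[OF t that] by (auto simp: U_def)
  have AE1: "AE \<xi> in M. exp (pairing u \<xi>) = transform M u" if u: "u \<in> U" for u
    unfolding transform_def
    by (rule AE_eq_expectation_if_norm_1)
      (use norm_tr[OF u] norm_exp_pairing_le[OF u] integrable_exp_pairing[OF M u] sp in \<open>auto simp: transform_def\<close>)
  \<comment> \<open>One value of \<open>exp (pairing u \<xi>)\<close> fixes the pairing only modulo
    \<open>2 * pi * \<i>\<close>. Countably many fractions of \<open>u\<close> share a null set and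
    fix it completely.\<close>
  define scaled where "scaled u n = (complex_of_real (1 / real (Suc n)) * fst u, complex_of_real (1 / real (Suc n)) * snd u)" for u n
  have "AE \<xi> in M. \<forall>n. exp (pairing (scaled u n) \<xi>) = transform M (scaled u n)" if u: "u \<in> U" for u
    unfolding AE_all_countable scaled_def by (intro allI AE1 scale_mem_U u) simp
  moreover have "(-1, 0) \<in> U" "(0, \<i>) \<in> U" by (auto simp: U_def)
  ultimately have "AE \<xi> in M. (\<forall>n. exp (pairing (scaled (-1, 0) n) \<xi>) = transform M (scaled (-1, 0) n))
    \<and> (\<forall>n. exp (pairing (scaled (0, \<i>) n) \<xi>) = transform M (scaled (0, \<i>) n))" (is "AE \<xi> in M. ?P \<xi>")
    by (intro AE_conjI) blast+
  then obtain \<xi>0 where P0: "?P \<xi>0" by (rule AE_obtain)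
  have uniq: "\<xi> = \<xi>0" if P: "?P \<xi>" for \<xi>
  proof -
    have "pairing u \<xi> - pairing u \<xi>0 = 0" if "u = (-1, 0) \<or> u = (0, \<i>)" for u
    proof (rule exp_fractions_eq_1)
      fix n
      have *: "pairing (scaled u n) \<xi> = pairing u \<xi> / of_nat (Suc n)" for \<xi>
        by (simp add: scaled_def pairing_def add_divide_distrib)
      have "exp (pairing (scaled u n) \<xi>) = exp (pairing (scaled u n) \<xi>0)" using P P0 that by auto
      then show "exp ((pairing u \<xi> - pairing u \<xi>0) / of_nat (Suc n)) = 1"
        unfolding diff_divide_distrib exp_diff * by simp
    qed
    from this[of "(-1, 0)"] this[of "(0, \<i>)"] show ?thesis
      by (auto simp: pairing_def prod_eq_iff complex_eq_iff)
  qed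
  have "AE \<xi> in M. \<xi> = \<xi>0" using \<open>AE \<xi> in M. ?P \<xi>\<close> by (rule AE_mp) (use uniq in \<open>auto intro!: AE_I2\<close>)
  then have trM: "transform M u = exp (pairing u \<xi>0)" if "u \<in> U" for u
  proof -
    have "(CLINT \<xi>|M. exp (pairing u \<xi>)) = (CLINT \<xi>|M. exp (pairing u \<xi>0))"
      using \<open>AE \<xi> in M. \<xi> = \<xi>0\<close> borel_measurable_prob_MD[OF M, of "\<lambda>\<xi>. exp (pairing u \<xi>)"]
      by (intro integral_cong_AE) auto
    then show ?thesis by (simp add: transform_def prob_space)
  qed
  \<comment> \<open>At \<open>(-1, 0)\<close> the transform is \<open>exp (- fst \<xi>0)\<close>,
    and it has modulus one.\<close>
  have "fst \<xi>0 = 0"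
    using norm_tr[OF \<open>(-1, 0) \<in> U\<close>] trM[OF \<open>(-1, 0) \<in> U\<close>] by (simp add: pairing_def)
  have *: "snd (\<psi> t u) = snd u * of_real (snd \<xi>0)" if "u \<in> U" for u
  proof (rule continuous_logs_eq[OF connected_U _ _ _ zero_mem_U _ that])
    show "continuous_on U (\<lambda>u. snd (\<psi> t u))" by (intro continuous_intros \<psi>_continuous[OF t])
    show "continuous_on U (\<lambda>u. snd u * complex_of_real (snd \<xi>0))" by (intro continuous_intros)
    show "snd (\<psi> t 0) = snd 0 * complex_of_real (snd \<xi>0)" by (simp add: \<psi>_0[OF t])
    fix u assume u: "u \<in> U"
    show "exp (snd (\<psi> t u)) = exp (snd u * complex_of_real (snd \<xi>0))"
      using tr[OF u] trM[OF u] \<open>fst \<xi>0 = 0\<close> by (simp add: pairing_def)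
  qed
  have "drift t = snd \<xi>0" using *[OF \<open>(0, \<i>) \<in> U\<close>] by (simp add: drift_def)
  then show ?thesis using *[OF u] by (simp add: mult.commute)
qed

section \<open>First moments as derivatives at 0\<close>

text \<open>Started at \<open>(1, 0)\<close>, the process has the transform
  \<open>exp (fst (\<psi> t u))\<close>, so this law carries the first coordinate of the
  flow.\<close>

abbreviation branch :: "real \<Rightarrow> (real \<times> real) measure" where
  "branch t \<equiv> Q t (1, 0)"

lemma e1_mem_D [simp]: "(1, 0) \<in> D" by (simp add: D_def)

lemmas branch_prob = Q_prob[OF _ e1_mem_D]
lemmas branch_integrable = Q_integrable[OF _ e1_mem_D]
lemmas branch_weakly_continuous = Q_weakly_continuous[OF e1_mem_D]

lemma exp_fst_\<psi>: "0 \<le> t \<Longrightarrow> u \<in> U \<Longrightarrow> exp (fst (\<psi> t u)) = transform (branch t) u"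
  by (simp add: transform_Q pairing_def)

definition q1 :: "real \<Rightarrow> real" where "q1 t = (LINT \<xi>|branch t. fst \<xi>)"
definition q2 :: "real \<Rightarrow> real" where "q2 t = (LINT \<xi>|branch t. snd \<xi>)"
definition h1 :: "real \<Rightarrow> real" where "h1 t = (LINT \<xi>|\<gamma> t. fst \<xi>)"
definition h2 :: "real \<Rightarrow> real" where "h2 t = (LINT \<xi>|\<gamma> t. snd \<xi>)"

text \<open>Near \<theta> = 0 the principal logarithm of the transform of \<open>branch t\<close> is
  \<open>fst (\<psi> t (v \<theta>))\<close>, since the latter is continuous and vanishes at 0. Its
  derivative thus comes from that of \<open>Ln\<close> at 1; the second coordinate is
  linear.\<close>

lemma \<psi>_curve_deriv:
  fixes v :: "real \<Rightarrow> complex \<times> complex" and v' :: "complex \<times> complex"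
  assumes t: "0 \<le> t" and v: "\<And>\<theta>. v \<theta> \<in> U" "v 0 = 0" "(v has_vector_derivative v') (at 0)"
  shows "((\<lambda>\<theta>. \<psi> t (v \<theta>)) has_vector_derivative (fst v' * q1 t + snd v' * q2 t, drift t * snd v')) (at 0)"
proof -
  have tr: "((\<lambda>\<theta>. transform (branch t) (v \<theta>)) has_vector_derivative (fst v' * q1 t + snd v' * q2 t)) (at 0)"
    unfolding q1_def q2_def by (rule transform_curve_deriv[OF branch_prob[OF t] branch_integrable[OF t] v])
  have v_cont: "(v \<longlongrightarrow> 0) (at 0)"
    using has_vector_derivative_continuous[OF v(3)] v(2) by (simp add: isCont_def)
  have "((\<lambda>\<theta>. \<psi> t (v \<theta>)) \<longlongrightarrow> \<psi> t 0) (at 0)"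
    by (rule continuous_on_tendsto_compose[OF \<psi>_continuous[OF t] v_cont]) (use v in auto)
  then have "((\<lambda>\<theta>. fst (\<psi> t (v \<theta>))) \<longlongrightarrow> 0) (at 0)"
    using tendsto_fst[of "\<lambda>\<theta>. \<psi> t (v \<theta>)" "\<psi> t 0"] \<psi>_0[OF t] by simp
  then have "\<forall>\<^sub>F \<theta> in at 0. norm (fst (\<psi> t (v \<theta>))) < pi"
    using tendsto_iff[of "\<lambda>\<theta>. fst (\<psi> t (v \<theta>))" 0 "at 0"] pi_gt_zero by (simp add: dist_norm)
  then have ev: "\<forall>\<^sub>F \<theta> in at 0. Ln (transform (branch t) (v \<theta>)) = fst (\<psi> t (v \<theta>))"
  proof (rule eventually_mono)
    fix \<theta> assume "norm (fst (\<psi> t (v \<theta>))) < pi"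
    then have "\<bar>Im (fst (\<psi> t (v \<theta>)))\<bar> < pi" using abs_Im_le_cmod order_le_less_trans by blast
    then have "Ln (exp (fst (\<psi> t (v \<theta>)))) = fst (\<psi> t (v \<theta>))" by (intro Ln_exp; linarith)
    then show "Ln (transform (branch t) (v \<theta>)) = fst (\<psi> t (v \<theta>))" using exp_fst_\<psi>[OF t v(1)] by simp
  qed
  have "(Ln has_field_derivative inverse 1) (at (transform (branch t) (v 0)))"
    using has_field_derivative_Ln[of 1] by (simp add: v(2) transform_0[OF branch_prob[OF t]])
  from field_vector_diff_chain_at[OF tr this]
  have "((\<lambda>\<theta>. Ln (transform (branch t) (v \<theta>))) has_vector_derivative (fst v' * q1 t + snd v' * q2 t)) (at 0)"
    by (simp add: o_def)
  then have 1: "((\<lambda>\<theta>. fst (\<psi> t (v \<theta>))) has_vector_derivative (fst v' * q1 t + snd v' * q2 t)) (at 0)"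
    unfolding has_vector_derivative_def
    by (rule has_derivative_transform_eventually[OF _ ev]) (simp_all add: v(2) \<psi>_0[OF t] transform_0[OF branch_prob[OF t]])
  have "((\<lambda>\<theta>. snd (v \<theta>)) has_vector_derivative snd v') (at 0)"
    using v(3) unfolding has_vector_derivative_def by (auto dest: has_derivative_snd)
  then have "((\<lambda>\<theta>. drift t * snd (v \<theta>)) has_vector_derivative drift t * snd v') (at 0)"
    by (intro has_vector_derivative_mult_right)
  then have 2: "((\<lambda>\<theta>. snd (\<psi> t (v \<theta>))) has_vector_derivative drift t * snd v') (at 0)"
    using snd_\<psi>[OF t v(1)] by simp
  from has_vector_derivative_Pair[OF 1 2] show ?thesis by simp
qed

end

text \<open>A zero propagates to times tending to 0, where stochastic continuity will exclude
  it.\<close>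

lemma multiplicative_zero_halves:
  fixes p :: "real \<Rightarrow> real"
  assumes mult: "\<And>s t. 0 \<le> s \<Longrightarrow> 0 \<le> t \<Longrightarrow> p (s + t) = p s * p t" and t: "0 \<le> t" "p t = 0"
  shows "p (t / 2 ^ n) = 0"
proof (induction n)
  case (Suc n)
  have "p (t / 2 ^ Suc n + t / 2 ^ Suc n) = p (t / 2 ^ Suc n) * p (t / 2 ^ Suc n)"
    using t by (intro mult) auto
  moreover have "t / 2 ^ Suc n + t / 2 ^ Suc n = t / 2 ^ n" by simp
  ultimately show ?case using Suc by simp
qed (use t in simp)

lemma halves_tendsto_0: "(\<lambda>n. t / 2 ^ n :: real) \<longlonglongrightarrow> 0"
proof -
  have "(\<lambda>n. t * (1 / 2) ^ n) \<longlonglongrightarrow> t * 0" by (intro tendsto_mult tendsto_const LIMSEQ_power_zero) simp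
  then show ?thesis by (simp add: power_one_over)
qed

text \<open>In the imaginary directions \<open>U\<close> is left on neither side of 0, so two-sided
  derivatives are available; the factor \<open>\<i>\<close> cancels in the moment
  identities.\<close>

lemma imaginary_axis_curves:
  "(\<i> * complex_of_real \<theta>, 0) \<in> U" "(0, \<i> * complex_of_real \<theta>) \<in> U"
  "((\<lambda>\<theta>. (\<i> * complex_of_real \<theta>, 0::complex)) has_vector_derivative (\<i>, 0)) (at 0)"
  "((\<lambda>\<theta>. (0::complex, \<i> * complex_of_real \<theta>)) has_vector_derivative (0, \<i>)) (at 0)"
proof -
  have "((\<lambda>\<theta>. \<i> * complex_of_real \<theta>) has_vector_derivative \<i>) (at 0)"
    by (auto intro!: derivative_eq_intros has_vector_derivative_real_field)
  then show "((\<lambda>\<theta>. (\<i> * complex_of_real \<theta>, 0::complex)) has_vector_derivative (\<i>, 0)) (at 0)"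
     "((\<lambda>\<theta>. (0::complex, \<i> * complex_of_real \<theta>)) has_vector_derivative (0, \<i>)) (at 0)"
    by (auto intro!: has_vector_derivative_Pair has_vector_derivative_const)
qed (auto simp: U_def)

lemma C1_imp_continuous_on_nonneg:
  assumes "C1 f" "\<And>t. 0 \<le> t \<Longrightarrow> g t = f t"
  shows "continuous_on {0..} g"
  by (rule continuous_on_eq[OF continuous_on_subset[OF C1_continuous[OF assms(1)]]]) (use assms(2) in auto)

text \<open>On \<open>D\<close> the first coordinate is its own modulus, so its mean controls it;
  the modulus of the second is recovered from the linear form by the triangle inequality and
  division by \<open>d\<close>.\<close>

lemma mean_norm_le:
  assumes \<mu>: "\<mu> \<in> space (prob_algebra MD)" and int: "integrable \<mu> norm"
    and le: "(\<integral>\<^sup>+x. ennreal \<bar>fst x * q + snd x * d + a\<bar> \<partial>\<mu>) \<le> ennreal K" and K: "0 \<le> K" and d: "0 < d"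
  shows "(LINT x|\<mu>. norm x) \<le> (LINT x|\<mu>. fst x) + (K + \<bar>q\<bar> * (LINT x|\<mu>. fst x) + \<bar>a\<bar>) / d"
proof -
  interpret prob_space \<mu> using \<mu> by (rule prob_algebra_MDD)
  have sp: "space \<mu> = D" using \<mu> by (rule prob_algebra_MDD)
  note i = integrable_fst_snd[OF \<mu> int]
  have [simp]: "integrable \<mu> fst" "integrable \<mu> snd" by fact+
  have int_lin: "integrable \<mu> (\<lambda>x. fst x * q + snd x * d + a)"
    by (intro Bochner_Integration.integrable_add integrable_mult_left i) simp
  have "ennreal (LINT x|\<mu>. \<bar>fst x * q + snd x * d + a\<bar>) = (\<integral>\<^sup>+x. ennreal \<bar>fst x * q + snd x * d + a\<bar> \<partial>\<mu>)"
    using int_lin by (intro nn_integral_eq_integral[symmetric]) auto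
  with le have "ennreal (LINT x|\<mu>. \<bar>fst x * q + snd x * d + a\<bar>) \<le> ennreal K" by (simp only:)
  then have K': "(LINT x|\<mu>. \<bar>fst x * q + snd x * d + a\<bar>) \<le> K"
    using K by (simp only: ennreal_le_iff)
  have "d * (LINT x|\<mu>. \<bar>snd x\<bar>) = (LINT x|\<mu>. d * \<bar>snd x\<bar>)" by simp
  also have "\<dots> \<le> (LINT x|\<mu>. \<bar>fst x * q + snd x * d + a\<bar> + \<bar>q\<bar> * fst x + \<bar>a\<bar>)"
  proof (rule integral_mono)
    fix x assume "x \<in> space \<mu>"
    then have "0 \<le> fst x" by (auto simp: sp D_def)
    moreover have "\<bar>snd x * d\<bar> \<le> \<bar>fst x * q + snd x * d + a\<bar> + \<bar>fst x * q\<bar> + \<bar>a\<bar>" by linarith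
    ultimately show "d * \<bar>snd x\<bar> \<le> \<bar>fst x * q + snd x * d + a\<bar> + \<bar>q\<bar> * fst x + \<bar>a\<bar>"
      using d by (simp add: abs_mult mult.commute)
  qed (use int_lin in auto)
  also have "\<dots> = (LINT x|\<mu>. \<bar>fst x * q + snd x * d + a\<bar>) + \<bar>q\<bar> * (LINT x|\<mu>. fst x) + \<bar>a\<bar>"
    using int_lin by (simp add: prob_space)
  finally have "d * (LINT x|\<mu>. \<bar>snd x\<bar>) \<le> K + \<bar>q\<bar> * (LINT x|\<mu>. fst x) + \<bar>a\<bar>" using K' by simp
  then have "(LINT x|\<mu>. \<bar>snd x\<bar>) \<le> (K + \<bar>q\<bar> * (LINT x|\<mu>. fst x) + \<bar>a\<bar>) / d"
    using d by (simp add: field_simps)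
  moreover have "(LINT x|\<mu>. norm x) \<le> (LINT x|\<mu>. fst x + \<bar>snd x\<bar>)"
  proof (rule integral_mono)
    fix x assume "x \<in> space \<mu>"
    then have "0 \<le> fst x" by (auto simp: sp D_def)
    then show "norm x \<le> fst x + \<bar>snd x\<bar>" using norm_Pair_le[of "fst x" "snd x"] by simp
  qed (use int in auto)
  moreover have "(LINT x|\<mu>. fst x + \<bar>snd x\<bar>) = (LINT x|\<mu>. fst x) + (LINT x|\<mu>. \<bar>snd x\<bar>)" by simp
  ultimately show ?thesis by linarith
qed

section \<open>Functional equations and explicit first moments\<close>

context affine_immigration
begin

text \<open>Both sides of \<open>transform (Q t x) u = exp (pairing (\<psi> t u) x)\<close> are
  differentiated at \<open>u = 0\<close> along the two imaginary axes.\<close>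

lemma Q_first_moments:
  assumes t: "0 \<le> t" and x: "x \<in> D"
  shows "(LINT \<xi>|Q t x. fst \<xi>) = fst x * q1 t" "(LINT \<xi>|Q t x. snd \<xi>) = fst x * q2 t + snd x * drift t"
proof -
  have eq: "fst v' * (LINT \<xi>|Q t x. fst \<xi>) + snd v' * (LINT \<xi>|Q t x. snd \<xi>)
      = (fst v' * q1 t + snd v' * q2 t) * fst x + (drift t * snd v') * snd x"
    if v: "\<And>\<theta>. v \<theta> \<in> U" "v 0 = 0" "(v has_vector_derivative v') (at 0)"
    for v :: "real \<Rightarrow> complex \<times> complex" and v' :: "complex \<times> complex"
  proof (rule vector_derivative_unique_at)
    show "((\<lambda>\<theta>. transform (Q t x) (v \<theta>)) has_vector_derivative
        fst v' * (LINT \<xi>|Q t x. fst \<xi>) + snd v' * (LINT \<xi>|Q t x. snd \<xi>)) (at 0)"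
      by (rule transform_curve_deriv[OF Q_prob[OF t x] Q_integrable[OF t x] v])
    have "((\<lambda>\<theta>. pairing (\<psi> t (v \<theta>)) x) has_vector_derivative
        (fst v' * q1 t + snd v' * q2 t) * fst x + (drift t * snd v') * snd x) (at 0)"
    proof -
      have "bounded_linear (\<lambda>w. pairing w x)"
        unfolding pairing_def
        by (intro bounded_linear_add bounded_linear_compose[OF bounded_linear_mult_left] bounded_linear_fst bounded_linear_snd)
      from bounded_linear.has_vector_derivative[OF this \<psi>_curve_deriv[OF t v]]
      show ?thesis by (simp add: pairing_def)
    qed
    then have "((\<lambda>\<theta>. exp (pairing (\<psi> t (v \<theta>)) x)) has_vector_derivative
        ((fst v' * q1 t + snd v' * q2 t) * fst x + (drift t * snd v') * snd x) * exp (pairing (\<psi> t (v 0)) x)) (at 0)"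
      using field_vector_diff_chain_at[OF _ DERIV_exp] by (fastforce simp: o_def)
    then show "((\<lambda>\<theta>. transform (Q t x) (v \<theta>)) has_vector_derivative
        (fst v' * q1 t + snd v' * q2 t) * fst x + (drift t * snd v') * snd x) (at 0)"
      using transform_Q[OF t x v(1)] by (simp add: v(2) \<psi>_0[OF t])
  qed
  show "(LINT \<xi>|Q t x. fst \<xi>) = fst x * q1 t"
    using eq[OF imaginary_axis_curves(1) _ imaginary_axis_curves(3)] by (simp add: zero_prod_def complex_eq_iff mult.commute)
  show "(LINT \<xi>|Q t x. snd \<xi>) = fst x * q2 t + snd x * drift t"
    using eq[OF imaginary_axis_curves(2) _ imaginary_axis_curves(4)] by (simp add: zero_prod_def complex_eq_iff mult.commute)
qed

text \<open>The same differentiation, applied to the flow identity \<open>transform (branch (r + t))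
  u = transform (branch r) (\<psi> t u)\<close>.\<close>

lemma q_add:
  assumes r: "0 \<le> r" and t: "0 \<le> t"
  shows "q1 (r + t) = q1 r * q1 t" "q2 (r + t) = q1 r * q2 t + q2 r * drift t"
proof -
  have rt: "0 \<le> r + t" using r t by simp
  have eq: "fst v' * q1 (r + t) + snd v' * q2 (r + t)
      = (fst v' * q1 t + snd v' * q2 t) * q1 r + (drift t * snd v') * q2 r"
    if v: "\<And>\<theta>. v \<theta> \<in> U" "v 0 = 0" "(v has_vector_derivative v') (at 0)"
    for v :: "real \<Rightarrow> complex \<times> complex" and v' :: "complex \<times> complex"
  proof (rule vector_derivative_unique_at)
    show "((\<lambda>\<theta>. transform (branch (r + t)) (v \<theta>)) has_vector_derivative fst v' * q1 (r + t) + snd v' * q2 (r + t)) (at 0)"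
      unfolding q1_def q2_def by (rule transform_curve_deriv[OF branch_prob[OF rt] branch_integrable[OF rt] v])
    have "transform (branch (r + t)) (v \<theta>) = transform (branch r) (\<psi> t (v \<theta>))" for \<theta>
      using r t v(1) by (simp add: exp_fst_\<psi>[symmetric] \<psi>_flow \<psi>_mem_U)
    moreover have "((\<lambda>\<theta>. transform (branch r) (\<psi> t (v \<theta>))) has_vector_derivative
        (fst v' * q1 t + snd v' * q2 t) * q1 r + (drift t * snd v') * q2 r) (at 0)"
      using transform_curve_deriv[OF branch_prob[OF r] branch_integrable[OF r] \<psi>_mem_U[OF t v(1)] _ \<psi>_curve_deriv[OF t v]]
      by (simp add: q1_def q2_def v(2) \<psi>_0[OF t])
    ultimately show "((\<lambda>\<theta>. transform (branch (r + t)) (v \<theta>)) has_vector_derivative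
        (fst v' * q1 t + snd v' * q2 t) * q1 r + (drift t * snd v') * q2 r) (at 0)" by simp
  qed
  show "q1 (r + t) = q1 r * q1 t"
    using eq[OF imaginary_axis_curves(1) _ imaginary_axis_curves(3)] by (simp add: zero_prod_def complex_eq_iff mult.commute)
  show "q2 (r + t) = q1 r * q2 t + q2 r * drift t"
    using eq[OF imaginary_axis_curves(2) _ imaginary_axis_curves(4)] by (simp add: zero_prod_def complex_eq_iff mult.commute)
qed

text \<open>The derivative at 0 of the skew convolution equation; both factors are 1 there, so the
  product rule adds the two contributions.\<close>

lemma h_add:
  assumes r: "0 \<le> r" and t: "0 \<le> t"
  shows "h1 (r + t) = h1 r * q1 t + h1 t" "h2 (r + t) = h1 r * q2 t + h2 r * drift t + h2 t"
proof -
  have rt: "0 \<le> r + t" using r t by simp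
  have eq: "fst v' * h1 (r + t) + snd v' * h2 (r + t)
      = ((fst v' * q1 t + snd v' * q2 t) * h1 r + (drift t * snd v') * h2 r) + (fst v' * h1 t + snd v' * h2 t)"
    if v: "\<And>\<theta>. v \<theta> \<in> U" "v 0 = 0" "(v has_vector_derivative v') (at 0)"
    for v :: "real \<Rightarrow> complex \<times> complex" and v' :: "complex \<times> complex"
  proof (rule vector_derivative_unique_at)
    show "((\<lambda>\<theta>. transform (\<gamma> (r + t)) (v \<theta>)) has_vector_derivative fst v' * h1 (r + t) + snd v' * h2 (r + t)) (at 0)"
      unfolding h1_def h2_def by (rule transform_curve_deriv[OF \<gamma>_prob[OF rt] \<gamma>_integrable[OF rt] v])
    have 1: "((\<lambda>\<theta>. transform (\<gamma> r) (\<psi> t (v \<theta>))) has_vector_derivative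
        (fst v' * q1 t + snd v' * q2 t) * h1 r + (drift t * snd v') * h2 r) (at 0)"
      using transform_curve_deriv[OF \<gamma>_prob[OF r] \<gamma>_integrable[OF r] \<psi>_mem_U[OF t v(1)] _ \<psi>_curve_deriv[OF t v]]
      by (simp add: h1_def h2_def v(2) \<psi>_0[OF t])
    have 2: "((\<lambda>\<theta>. transform (\<gamma> t) (v \<theta>)) has_vector_derivative fst v' * h1 t + snd v' * h2 t) (at 0)"
      unfolding h1_def h2_def by (rule transform_curve_deriv[OF \<gamma>_prob[OF t] \<gamma>_integrable[OF t] v])
    show "((\<lambda>\<theta>. transform (\<gamma> (r + t)) (v \<theta>)) has_vector_derivative
        ((fst v' * q1 t + snd v' * q2 t) * h1 r + (drift t * snd v') * h2 r) + (fst v' * h1 t + snd v' * h2 t)) (at 0)"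
      using has_vector_derivative_mult[OF 1 2] transform_\<gamma>_add[OF r t v(1)]
      by (simp add: v(2) \<psi>_0[OF t] transform_0[OF \<gamma>_prob[OF t]] transform_0[OF \<gamma>_prob[OF r]] add.commute)
  qed
  show "h1 (r + t) = h1 r * q1 t + h1 t"
    using eq[OF imaginary_axis_curves(1) _ imaginary_axis_curves(3)] by (simp add: zero_prod_def complex_eq_iff mult.commute)
  show "h2 (r + t) = h1 r * q2 t + h2 r * drift t + h2 t"
    using eq[OF imaginary_axis_curves(2) _ imaginary_axis_curves(4)] by (simp add: zero_prod_def complex_eq_iff mult.commute)
qed

lemma drift_add:
  assumes "0 \<le> r" "0 \<le> t"
  shows "drift (r + t) = drift r * drift t"
proof -
  have "snd (\<psi> (r + t) (0, \<i>)) = of_real (drift r) * (of_real (drift t) * \<i>)"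
    using assms imaginary_axis_curves(2)[of 1] by (simp add: \<psi>_flow snd_\<psi> \<psi>_mem_U)
  then show ?thesis by (simp add: drift_def[of "r + t"])
qed

lemma moments_measurable:
  "(\<lambda>t. drift (max 0 t)) \<in> borel_measurable borel"
  "(\<lambda>t. q1 (max 0 t)) \<in> borel_measurable borel" "(\<lambda>t. q2 (max 0 t)) \<in> borel_measurable borel"
  "(\<lambda>t. h1 (max 0 t)) \<in> borel_measurable borel" "(\<lambda>t. h2 (max 0 t)) \<in> borel_measurable borel"
proof -
  have e2: "(0, 1) \<in> D" by (simp add: D_def)
  \<comment> \<open>Started at \<open>(0, 1)\<close>, the second coordinate has mean
    \<open>drift\<close>, which is thereby an integral to which measurability in time
    applies.\<close>
  have "drift (max 0 t) = (LINT \<xi>|Q (max 0 t) (0, 1). snd \<xi>)" for t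
    by (subst Q_first_moments(2)) (simp_all add: e2)
  then show "(\<lambda>t. drift (max 0 t)) \<in> borel_measurable borel"
    using weakly_continuous_integral_measurable[OF Q_weakly_continuous[OF e2] Q_prob[OF _ e2], of snd]
      integrable_fst_snd[OF Q_prob[OF _ e2] Q_integrable[OF _ e2]]
    by (simp add: continuous_intros)
  show "(\<lambda>t. q1 (max 0 t)) \<in> borel_measurable borel" "(\<lambda>t. q2 (max 0 t)) \<in> borel_measurable borel"
    unfolding q1_def q2_def
    by (intro weakly_continuous_integral_measurable[OF branch_weakly_continuous branch_prob]
      integrable_fst_snd[OF branch_prob branch_integrable] continuous_intros; assumption)+
  show "(\<lambda>t. h1 (max 0 t)) \<in> borel_measurable borel" "(\<lambda>t. h2 (max 0 t)) \<in> borel_measurable borel"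
    unfolding h1_def h2_def
    by (intro weakly_continuous_integral_measurable[OF \<gamma>_weakly_continuous \<gamma>_prob]
      integrable_fst_snd[OF \<gamma>_prob \<gamma>_integrable] continuous_intros; assumption)+
qed

text \<open>\<open>drift t\<close> is a square, and a zero would recur at the times
  \<open>t / 2 ^ n\<close>. There the transform of \<open>Q\<close> started at
  \<open>(0, 1)\<close>, taken at \<open>(0, \<i>)\<close>, equals 1, whereas it tends to
  \<open>exp \<i>\<close> by stochastic continuity.\<close>

lemma drift_pos:
  assumes t: "0 \<le> t" shows "0 < drift t"
proof -
  have e2: "(0, 1) \<in> D" "(0, \<i>) \<in> U" by (simp_all add: D_def U_def)
  have tr: "transform (Q t (0, 1)) (0, \<i>) = exp (\<i> * drift t)" if "0 \<le> t" for t
    using transform_Q[OF that e2] snd_\<psi>[OF that e2(2)] by (simp add: pairing_def mult.commute)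
  have "0 \<le> drift t" using drift_add[of "t / 2" "t / 2"] t by simp
  moreover have "drift t \<noteq> 0"
  proof
    assume "drift t = 0"
    then have zero: "drift (t / 2 ^ n) = 0" for n
      using multiplicative_zero_halves[of drift t n, OF drift_add] t by simp
    have "(\<lambda>n. transform (Q (t / 2 ^ n) (0, 1)) (0, \<i>)) \<longlonglongrightarrow> transform (Q 0 (0, 1)) (0, \<i>)"
      by (rule continuous_on_tendsto_compose[OF weakly_continuous_transform[OF Q_weakly_continuous[OF e2(1)] Q_prob[OF _ e2(1)] e2(2)]
          halves_tendsto_0]) (use t in auto)
    moreover have "transform (Q (t / 2 ^ n) (0, 1)) (0, \<i>) = 1" for n
      using t by (subst tr) (simp_all add: zero)
    moreover have "transform (Q 0 (0, 1)) (0, \<i>) = exp \<i>"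
      by (simp add: Q_0 e2 transform_return pairing_def)
    ultimately have "exp \<i> = 1" by (simp add: LIMSEQ_const_iff)
    then have "sin (1::real) = 0" by (simp add: complex_eq_iff Im_exp)
    then show False using sin_gt_zero[of 1] pi_gt3 by simp
  qed
  ultimately show ?thesis by simp
qed

text \<open>As for \<open>drift\<close>, a zero recurs at times tending to 0. A vanishing mean of
  the nonnegative first coordinate makes it 0 almost surely, so the transform at
  \<open>(-1, 0)\<close> is 1, against the limit \<open>exp (-1)\<close>.\<close>

lemma q1_pos:
  assumes t: "0 \<le> t" shows "0 < q1 t"
proof -
  have e2: "(-1, 0) \<in> U" by (simp add: U_def)
  have nonneg: "AE \<xi> in branch t. 0 \<le> fst \<xi>" if "0 \<le> t" for t
    using prob_algebra_MDD(3)[OF branch_prob[OF that]] by (intro AE_I2) (auto simp: D_def)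
  have "0 \<le> q1 t" unfolding q1_def by (rule integral_nonneg_AE[OF nonneg[OF t]])
  moreover have "q1 t \<noteq> 0"
  proof
    assume "q1 t = 0"
    then have zero: "q1 (t / 2 ^ n) = 0" for n
      using multiplicative_zero_halves[of q1 t n, OF q_add(1)] t by simp
    have "(\<lambda>n. transform (branch (t / 2 ^ n)) (-1, 0)) \<longlonglongrightarrow> transform (branch 0) (-1, 0)"
      by (rule continuous_on_tendsto_compose[OF weakly_continuous_transform[OF branch_weakly_continuous branch_prob e2]
          halves_tendsto_0]) (use t in auto)
    moreover have "transform (branch (t / 2 ^ n)) (-1, 0) = 1" for n
    proof -
      have tn: "0 \<le> t / 2 ^ n" using t by simp
      interpret prob_space "branch (t / 2 ^ n)" by (rule prob_algebra_MDD[OF branch_prob[OF tn]])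
      have "AE \<xi> in branch (t / 2 ^ n). fst \<xi> = 0"
        using zero[of n] integrable_fst_snd(1)[OF branch_prob[OF tn] branch_integrable[OF tn]] nonneg[OF tn]
        by (simp add: q1_def integral_nonneg_eq_0_iff_AE)
      then have "(CLINT \<xi>|branch (t / 2 ^ n). exp (pairing (-1, 0) \<xi>)) = (CLINT \<xi>|branch (t / 2 ^ n). 1)"
        using borel_measurable_prob_MD[OF branch_prob[OF tn], of "\<lambda>\<xi>. exp (pairing (-1, 0) \<xi>)"]
        by (intro integral_cong_AE) (auto simp: pairing_def)
      then show ?thesis by (simp add: transform_def prob_space)
    qed
    moreover have "transform (branch 0) (-1, 0) = exp (-1)"
      by (simp add: Q_0 transform_return pairing_def)
    ultimately have "exp (-1 :: complex) = 1" by (simp add: LIMSEQ_const_iff)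
    then have "norm (exp (-1 :: complex)) = 1" by (metis norm_one)
    then show False by simp
  qed
  ultimately show ?thesis by simp
qed

definition \<alpha> :: real where "\<alpha> = ln (q1 1)"
definition \<beta> :: real where "\<beta> = ln (drift 1)"

lemma q1_eq: "0 \<le> t \<Longrightarrow> q1 t = exp (\<alpha> * t)"
proof -
  obtain a where a: "\<And>t. 0 \<le> t \<Longrightarrow> q1 t = exp (a * t)"
    using measurable_multiplicative_exp[OF moments_measurable(2) q_add(1) q1_pos] by blast
  then have "a = \<alpha>" using a[of 1] by (simp add: \<alpha>_def)
  then show "0 \<le> t \<Longrightarrow> q1 t = exp (\<alpha> * t)" using a by simp
qed

lemma drift_eq: "0 \<le> t \<Longrightarrow> drift t = exp (\<beta> * t)"
proof -
  obtain a where a: "\<And>t. 0 \<le> t \<Longrightarrow> drift t = exp (a * t)"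
    using measurable_multiplicative_exp[OF moments_measurable(1) drift_add drift_pos] by blast
  then have "a = \<beta>" using a[of 1] by (simp add: \<beta>_def)
  then show "0 \<le> t \<Longrightarrow> drift t = exp (\<beta> * t)" using a by simp
qed

lemma h1_eq: "\<exists>C. \<forall>t\<ge>0. h1 t = C * exp_integral \<alpha> t"
proof (rule measurable_exp_cocycle[OF moments_measurable(4)])
  fix s t :: real assume "0 \<le> s" "0 \<le> t"
  then show "h1 (s + t) = exp (\<alpha> * s) * h1 t + h1 s"
    using h_add(1)[of t s] by (simp add: q1_eq add.commute mult.commute)
qed

text \<open>Dividing by \<open>drift\<close> turns the mixed equation for \<open>q2\<close> into a
  cocycle equation with exponent \<open>\<alpha> - \<beta>\<close>.\<close>

lemma q2_eq: "\<exists>C. \<forall>t\<ge>0. q2 t = C * (exp (\<beta> * t) * exp_integral (\<alpha> - \<beta>) t)"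
proof -
  have "\<exists>C. \<forall>t\<ge>0. q2 t / drift t = C * exp_integral (\<alpha> - \<beta>) t"
  proof (rule measurable_exp_cocycle)
    show "(\<lambda>t. q2 (max 0 t) / drift (max 0 t)) \<in> borel_measurable borel"
      by (intro borel_measurable_divide moments_measurable)
    fix s t :: real assume "0 \<le> s" "0 \<le> t"
    then show "q2 (s + t) / drift (s + t) = exp ((\<alpha> - \<beta>) * s) * (q2 t / drift t) + q2 s / drift s"
      using drift_pos[of s] drift_pos[of t]
      by (simp add: q_add q1_eq drift_eq add_divide_distrib left_diff_distrib distrib_left exp_diff exp_add)
  qed
  then obtain C where C: "\<And>t. 0 \<le> t \<Longrightarrow> q2 t / drift t = C * exp_integral (\<alpha> - \<beta>) t" by blast
  have "q2 t = C * (exp (\<beta> * t) * exp_integral (\<alpha> - \<beta>) t)" if "0 \<le> t" for t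
    using C[OF that] drift_pos[OF that] by (simp add: drift_eq[OF that] field_simps)
  then show ?thesis by blast
qed

lemma q2_C1: "\<exists>f. C1 f \<and> (\<forall>t\<ge>0. q2 t = f t)"
proof -
  obtain C where "\<forall>t\<ge>0. q2 t = C * (exp (\<beta> * t) * exp_integral (\<alpha> - \<beta>) t)" using q2_eq by blast
  moreover have "C1 (\<lambda>t. C * (exp (\<beta> * t) * exp_integral (\<alpha> - \<beta>) t))" by (intro C1_intros C1_exp_integral)
  ultimately show ?thesis by blast
qed

lemma h1_C1: "\<exists>f. C1 f \<and> (\<forall>t\<ge>0. h1 t = f t)"
proof -
  obtain C where "\<forall>t\<ge>0. h1 t = C * exp_integral \<alpha> t" using h1_eq by blast
  moreover have "C1 (\<lambda>t. C * exp_integral \<alpha> t)" by (intro C1_intros C1_exp_integral)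
  ultimately show ?thesis by blast
qed

text \<open>Evaluating \<open>h2 (1 + t)\<close> in both orders yields
  \<open>h2 t * (exp \<beta> - 1)\<close> explicitly, which settles
  \<open>\<beta> \<noteq> 0\<close>. For \<open>\<beta> = 0\<close> the equation is additive up to a
  symmetric product, and subtracting a particular solution leaves a measurable additive
  function.\<close>

lemma h2_C1: "\<exists>f. C1 f \<and> (\<forall>t\<ge>0. h2 t = f t)"
proof -
  obtain f1 where f1: "C1 f1" "\<And>t. 0 \<le> t \<Longrightarrow> h1 t = f1 t" using h1_C1 by blast
  obtain f2 where f2: "C1 f2" "\<And>t. 0 \<le> t \<Longrightarrow> q2 t = f2 t" using q2_C1 by blast
  show ?thesis
  proof (cases "\<beta> = 0")
    case False
    define f where "f t = 1 / (exp \<beta> - 1) * (h1 1 * f2 t + (- q2 1) * f1 t + h2 1 * (exp (\<beta> * t) + (-1)))" for t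
    have "h2 t = f t" if "0 \<le> t" for t
    proof -
      have "h1 1 * q2 t + h2 1 * drift t + h2 t = h1 t * q2 1 + h2 t * drift 1 + h2 1"
        using h_add(2)[of 1 t] h_add(2)[of t 1] that by (simp add: add.commute)
      then have "h2 t * (exp \<beta> - 1) = h1 1 * q2 t + (- q2 1) * h1 t + h2 1 * (exp (\<beta> * t) + (-1))"
        using that by (simp add: drift_eq algebra_simps)
      then show ?thesis using False that by (simp add: f_def f1 f2 eq_divide_eq)
    qed
    moreover have "C1 f" unfolding f_def by (intro C1_intros f1 f2)
    ultimately show ?thesis by blast
  next
    case True
    obtain A where A: "\<And>t. 0 \<le> t \<Longrightarrow> h1 t = A * exp_integral \<alpha> t" using h1_eq by blast
    obtain B where B: "\<And>t. 0 \<le> t \<Longrightarrow> q2 t = B * exp_integral \<alpha> t" using q2_eq True by auto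
    have h2_add: "h2 (r + t) = A * B * (exp_integral \<alpha> r * exp_integral \<alpha> t) + h2 r + h2 t"
      if "0 \<le> r" "0 \<le> t" for r t
      using h_add(2)[OF that] that True by (simp add: A B drift_eq)
    \<comment> \<open>A particular solution, from \<open>exp_integral \<alpha> (r + t) -
      exp_integral \<alpha> r - exp_integral \<alpha> t = \<alpha> * exp_integral \<alpha> r *
      exp_integral \<alpha> t\<close>; for \<open>\<alpha> = 0\<close> half the square of
      \<open>t\<close> takes its place.\<close>
    define p where "p t = A * B * (if \<alpha> = 0 then 1 / 2 * (t * t) else 1 / \<alpha> * exp_integral \<alpha> t)" for t
    have p_C1: "C1 p"
    proof (cases "\<alpha> = 0")
      case True
      have "C1 (\<lambda>t. A * B * (1 / 2 * (t * t)))" by (intro C1_intros)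
      with True show ?thesis by (simp add: p_def[abs_def])
    next
      case False
      have "C1 (\<lambda>t. A * B * (1 / \<alpha> * exp_integral \<alpha> t))" by (intro C1_intros C1_exp_integral)
      with False show ?thesis by (simp add: p_def[abs_def])
    qed
    have p_add: "p (r + t) = A * B * (exp_integral \<alpha> r * exp_integral \<alpha> t) + p r + p t" for r t
      by (cases "\<alpha> = 0") (simp_all add: p_def exp_integral_def field_simps exp_add)
    have "\<exists>a. \<forall>t\<ge>0. h2 t - p t = a * t"
    proof (rule measurable_additive_linear)
      have "p \<in> borel_measurable borel"
        by (rule borel_measurable_continuous_onI[OF C1_continuous[OF p_C1]])
      then have "(\<lambda>t. p (max 0 t)) \<in> borel_measurable borel" by measurable
      then show "(\<lambda>t. h2 (max 0 t) - p (max 0 t)) \<in> borel_measurable borel"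
        by (intro borel_measurable_diff moments_measurable)
    qed (simp add: h2_add p_add)
    then obtain a where "\<And>t. 0 \<le> t \<Longrightarrow> h2 t = p t + a * t" by (auto simp: algebra_simps)
    moreover have "C1 (\<lambda>t. p t + a * t)" by (intro C1_intros p_C1)
    ultimately show ?thesis by blast
  qed
qed

lemma moments_continuous:
  "continuous_on {0..} q1" "continuous_on {0..} q2" "continuous_on {0..} drift"
  "continuous_on {0..} h1" "continuous_on {0..} h2"
  using C1_imp_continuous_on_nonneg[OF C1_exp q1_eq] C1_imp_continuous_on_nonneg[OF C1_exp drift_eq] C1_imp_continuous_on_nonneg q2_C1 h1_C1 h2_C1 by blast+

section \<open>Bounds for absolute moments near time 0\<close>

text \<open>Given the state \<open>x\<close> at the earlier time, the second coordinate has
  conditional mean \<open>fst x * q2 t + snd x * drift t\<close>, and Jensen's inequality is applied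
  for each \<open>x\<close>.\<close>

lemma jensen_bind_Q:
  assumes \<mu>: "\<mu> \<in> space (prob_algebra MD)" and t: "0 \<le> t"
  shows "(\<integral>\<^sup>+x. ennreal \<bar>fst x * q2 t + snd x * drift t + a\<bar> \<partial>\<mu>) \<le> (\<integral>\<^sup>+\<xi>. ennreal \<bar>snd \<xi> + a\<bar> \<partial>(\<mu> \<bind> Q t))"
proof -
  have "(\<integral>\<^sup>+\<xi>. ennreal \<bar>snd \<xi> + a\<bar> \<partial>(\<mu> \<bind> Q t)) = (\<integral>\<^sup>+x. \<integral>\<^sup>+\<xi>. ennreal \<bar>snd \<xi> + a\<bar> \<partial>Q t x \<partial>\<mu>)"
    by (rule nn_integral_bind[where B = MD])
      (auto intro!: measurable_prob_algebraD[OF Q_measurable_prob[OF \<mu> t]])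
  also have "\<dots> \<ge> (\<integral>\<^sup>+x. ennreal \<bar>fst x * q2 t + snd x * drift t + a\<bar> \<partial>\<mu>)"
  proof (rule nn_integral_mono)
    fix x assume "x \<in> space \<mu>"
    then have x: "x \<in> D" using prob_algebra_MDD(3)[OF \<mu>] by simp
    interpret prob_space "Q t x" using Q_prob[OF t x] by (rule prob_algebra_MDD)
    have i: "integrable (Q t x) snd" by (rule integrable_fst_snd[OF Q_prob[OF t x] Q_integrable[OF t x]])
    then have int: "integrable (Q t x) (\<lambda>\<xi>. snd \<xi> + a)" by simp
    from integral_norm_bound_ennreal[OF int] i
    show "ennreal \<bar>fst x * q2 t + snd x * drift t + a\<bar> \<le> (\<integral>\<^sup>+\<xi>. ennreal \<bar>snd \<xi> + a\<bar> \<partial>Q t x)"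
      by (simp add: Q_first_moments[OF t x] prob_space)
  qed
  finally show ?thesis .
qed

text \<open>Subadditivity of the absolute moments would not exclude a blow-up as \<open>s\<close> tends to \<open>0\<close>. Jensen's
  inequality, applied to the conditional mean at time \<open>T\<close> given the state at time \<open>s\<close>, bounds them by the
  absolute moment at the fixed time \<open>T\<close>.\<close>

lemma local_moment_bound:
  "\<exists>L. \<forall>s\<in>{0..T}. (LINT \<xi>|branch s. norm \<xi>) \<le> L \<and> (LINT \<xi>|\<gamma> s. norm \<xi>) \<le> L"
proof (cases "0 \<le> T")
  case T: True
  define K1 where "K1 = (LINT \<xi>|branch T. \<bar>snd \<xi>\<bar>)"
  define K2 where "K2 = (LINT \<xi>|\<gamma> T. \<bar>snd \<xi>\<bar>)"
  \<comment> \<open>\<open>g1\<close> and \<open>g2\<close> are the right sides of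
    \<open>mean_norm_le\<close>, with \<open>a = 0\<close> for \<open>branch\<close>. They are
    continuous in \<open>s\<close> because the signed moments are and \<open>drift\<close> has no
    zero.\<close>
  define g1 where "g1 s = q1 s + (K1 + \<bar>q2 (T - s)\<bar> * q1 s + \<bar>0\<bar>) / drift (T - s)" for s
  define g2 where "g2 s = h1 s + (K2 + \<bar>q2 (T - s)\<bar> * h1 s + \<bar>h2 (T - s)\<bar>) / drift (T - s)" for s
  have K: "0 \<le> K1" "0 \<le> K2" by (simp_all add: K1_def K2_def)
  have b1: "(LINT \<xi>|branch s. norm \<xi>) \<le> g1 s" if "s \<in> {0..T}" for s
  proof -
    have s: "0 \<le> s" "0 \<le> T - s" using that by auto
    have "(\<integral>\<^sup>+x. ennreal \<bar>fst x * q2 (T - s) + snd x * drift (T - s) + 0\<bar> \<partial>branch s)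
        \<le> (\<integral>\<^sup>+\<xi>. ennreal \<bar>snd \<xi> + 0\<bar> \<partial>(branch s \<bind> Q (T - s)))"
      by (rule jensen_bind_Q[OF branch_prob[OF s(1)] s(2)])
    also have "branch s \<bind> Q (T - s) = branch T" using Q_add[OF s e1_mem_D] by simp
    also have "(\<integral>\<^sup>+\<xi>. ennreal \<bar>snd \<xi> + 0\<bar> \<partial>branch T) = ennreal K1"
      unfolding K1_def using integrable_fst_snd(2)[OF branch_prob[OF T] branch_integrable[OF T]]
      by (subst nn_integral_eq_integral[symmetric]) auto
    finally show ?thesis
      unfolding g1_def q1_def
      by (rule mean_norm_le[OF branch_prob[OF s(1)] branch_integrable[OF s(1)] _ K(1) drift_pos[OF s(2)]])
  qed
  have b2: "(LINT \<xi>|\<gamma> s. norm \<xi>) \<le> g2 s" if "s \<in> {0..T}" for s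
  proof -
    have s: "0 \<le> s" "0 \<le> T - s" using that by auto
    note M = Q_bind_prob[OF \<gamma>_prob[OF s(1)] s(2)]
    interpret prob_space "\<gamma> (T - s)" using \<gamma>_prob[OF s(2)] by (rule prob_algebra_MDD)
    have "(\<integral>\<^sup>+x. ennreal \<bar>fst x * q2 (T - s) + snd x * drift (T - s) + h2 (T - s)\<bar> \<partial>\<gamma> s)
        \<le> (\<integral>\<^sup>+\<xi>. ennreal \<bar>snd \<xi> + h2 (T - s)\<bar> \<partial>(\<gamma> s \<bind> Q (T - s)))"
      by (rule jensen_bind_Q[OF \<gamma>_prob[OF s(1)] s(2)])
    \<comment> \<open>A second use of Jensen's inequality: the constant \<open>h2 (T - s)\<close> is
      the mean of the independent summand with law \<open>\<gamma> (T - s)\<close>.\<close>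
    also have "\<dots> \<le> (\<integral>\<^sup>+x. \<integral>\<^sup>+y. ennreal \<bar>snd (x + y)\<bar> \<partial>\<gamma> (T - s) \<partial>(\<gamma> s \<bind> Q (T - s)))"
    proof (rule nn_integral_mono)
      fix x :: "real \<times> real"
      have i: "integrable (\<gamma> (T - s)) snd" by (rule integrable_fst_snd[OF \<gamma>_prob[OF s(2)] \<gamma>_integrable[OF s(2)]])
      then have int: "integrable (\<gamma> (T - s)) (\<lambda>y. snd x + snd y)" by simp
      from integral_norm_bound_ennreal[OF int] i
      show "ennreal \<bar>snd x + h2 (T - s)\<bar> \<le> (\<integral>\<^sup>+y. ennreal \<bar>snd (x + y)\<bar> \<partial>\<gamma> (T - s))"
        by (simp add: prob_space h2_def)
    qed
    also have "\<dots> = (\<integral>\<^sup>+\<xi>. ennreal \<bar>snd \<xi>\<bar> \<partial>conv_D (\<gamma> s \<bind> Q (T - s)) (\<gamma> (T - s)))"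
      by (subst nn_integral_conv_D[OF M \<gamma>_prob[OF s(2)]]) auto
    also have "conv_D (\<gamma> s \<bind> Q (T - s)) (\<gamma> (T - s)) = \<gamma> T" using \<gamma>_add[OF s] by simp
    also have "(\<integral>\<^sup>+\<xi>. ennreal \<bar>snd \<xi>\<bar> \<partial>\<gamma> T) = ennreal K2"
      unfolding K2_def using integrable_fst_snd(2)[OF \<gamma>_prob[OF T] \<gamma>_integrable[OF T]]
      by (subst nn_integral_eq_integral[symmetric]) auto
    finally show ?thesis
      unfolding g2_def h1_def
      by (rule mean_norm_le[OF \<gamma>_prob[OF s(1)] \<gamma>_integrable[OF s(1)] _ K(2) drift_pos[OF s(2)]])
  qed
  have c: "continuous_on {0..T} (\<lambda>s. f (T - s))" "continuous_on {0..T} f"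
    if "continuous_on {0..} f" for f :: "real \<Rightarrow> real"
    using that by (auto intro: continuous_on_subset intro!: continuous_on_compose2[OF that] continuous_intros)
  note c = c[OF moments_continuous(1)] c[OF moments_continuous(2)] c[OF moments_continuous(3)]
    c[OF moments_continuous(4)] c[OF moments_continuous(5)]
  have "\<forall>s\<in>{0..T}. drift (T - s) \<noteq> 0"
    by (metis atLeastAtMost_iff diff_ge_0_iff_ge drift_pos less_irrefl)
  then have "continuous_on {0..T} g1" "continuous_on {0..T} g2"
    unfolding g1_def g2_def by (intro continuous_intros c; assumption)+
  then have "bounded (g1 ` {0..T})" "bounded (g2 ` {0..T})"
    by (auto intro!: compact_imp_bounded compact_continuous_image)
  then obtain B1 B2 where "\<And>s. s \<in> {0..T} \<Longrightarrow> norm (g1 s) \<le> B1" "\<And>s. s \<in> {0..T} \<Longrightarrow> norm (g2 s) \<le> B2"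
    unfolding bounded_iff by (metis imageI)
  then have "\<forall>s\<in>{0..T}. (LINT \<xi>|branch s. norm \<xi>) \<le> max B1 B2 \<and> (LINT \<xi>|\<gamma> s. norm \<xi>) \<le> max B1 B2"
    using b1 b2 by (force simp: abs_le_iff)
  then show ?thesis by blast
qed auto

lemma h2_absolutely_continuous:
  assumes "\<And>t. 0 \<le> t \<Longrightarrow> h t = h2 t"
  shows "absolutely_continuous_on_nonneg h"
proof -
  obtain f where "C1 f" "\<And>t. 0 \<le> t \<Longrightarrow> h2 t = f t" using h2_C1 by blast
  then show ?thesis using assms by (intro C1_imp_absolutely_continuous[of f]) auto
qed

end

section \<open>Averages over a time interval\<close>

text \<open>Closed sets generate the Borel sets and are stable under intersections. The indicator of
  a closed set is the limit of the continuous functions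
  \<open>max 0 (1 - real n * infdist \<xi> C)\<close>, so its integral is measurable in
  time.\<close>

lemma weakly_continuous_kernel:
  assumes wc: "weakly_continuous \<mu>" and \<mu>: "\<And>t. 0 \<le> t \<Longrightarrow> \<mu> t \<in> space (prob_algebra MD)"
  shows "(\<lambda>t. \<mu> (max 0 t)) \<in> borel \<rightarrow>\<^sub>M prob_algebra MD"
proof (rule measurable_prob_algebra_generated[where \<Omega> = D and G = "(\<inter>) D ` Collect closed"])
  have "D \<in> sigma_sets UNIV (Collect closed)"
    using D_sets sets_measure_of[of "Collect closed" UNIV] by (simp add: borel_eq_closed)
  from sigma_sets_Int[OF this] show "sets MD = sigma_sets D ((\<inter>) D ` Collect closed)"
    by (simp add: sets_restrict_space borel_eq_closed)
  show "Int_stable ((\<inter>) D ` Collect closed)"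
    unfolding Int_stable_def
  proof (intro ballI)
    fix A B assume "A \<in> (\<inter>) D ` Collect closed" "B \<in> (\<inter>) D ` Collect closed"
    then obtain a b where "closed a" "A = D \<inter> a" "closed b" "B = D \<inter> b" by blast
    then have "A \<inter> B = D \<inter> (a \<inter> b)" "closed (a \<inter> b)" by auto
    then show "A \<inter> B \<in> (\<inter>) D ` Collect closed" by blast
  qed
  show "prob_space (\<mu> (max 0 a))" "sets (\<mu> (max 0 a)) = sets MD" for a
    using prob_algebra_MDD[OF \<mu>[of "max 0 a"]] by auto
  fix A assume "A \<in> (\<inter>) D ` Collect closed"
  then obtain C where C: "closed C" "A = D \<inter> C" by auto
  have "(\<lambda>t. measure (\<mu> (max 0 t)) A) \<in> borel_measurable borel"
  \<comment> \<open>\<open>infdist\<close> to the empty set is 0, so the approximation is right for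
    nonempty \<open>C\<close> only.\<close>
  proof (cases "C = {}")
    case False
    define f where "f n \<xi> = max 0 (1 - real n * infdist \<xi> C)" for n and \<xi> :: "real \<times> real"
    have f_cont: "continuous_on S (f n)" for n S unfolding f_def by (intro continuous_intros)
    have f_norm: "norm (f n \<xi>) \<le> 1" for n \<xi> using infdist_nonneg[of \<xi> C] by (simp add: f_def)
    have f_bm: "f n \<in> borel_measurable borel" for n by (intro borel_measurable_continuous_onI f_cont)
    show ?thesis
    proof (rule borel_measurable_LIMSEQ_real)
      show "(\<lambda>t. LINT \<xi>|\<mu> (max 0 t). f n \<xi>) \<in> borel_measurable borel" for n
        by (rule weakly_continuous_integral_measurable[OF wc \<mu> f_cont])
          (auto intro!: integrable_bounded_MD[OF \<mu>, where B = 1] measurable_MD_borel f_bm simp: f_norm simp del: real_norm_def)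
      fix t :: real
      note \<mu>t = \<mu>[of "max 0 t", simplified]
      interpret prob_space "\<mu> (max 0 t)" using \<mu>t by (rule prob_algebra_MDD)
      have "(\<lambda>n. LINT \<xi>|\<mu> (max 0 t). f n \<xi>) \<longlonglongrightarrow> (LINT \<xi>|\<mu> (max 0 t). indicator C \<xi>)"
      proof (rule integral_dominated_convergence[where w = "\<lambda>_. 1"])
        show "AE \<xi> in \<mu> (max 0 t). (\<lambda>n. f n \<xi>) \<longlonglongrightarrow> indicator C \<xi>"
        proof (intro AE_I2 tendsto_eventually)
          fix \<xi>
          show "\<forall>\<^sub>F n in sequentially. f n \<xi> = indicator C \<xi>"
          proof (cases "\<xi> \<in> C")
            case True
            then show ?thesis by (simp add: f_def)
          next
            case False
            then have d: "0 < infdist \<xi> C"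
              using infdist_pos_not_in_closed[OF C(1) \<open>C \<noteq> {}\<close>] by simp
            obtain n0 :: nat where n0: "1 / infdist \<xi> C < real n0" using reals_Archimedean2 by blast
            show ?thesis
            proof (rule eventually_sequentiallyI[of n0])
              fix n assume "n0 \<le> n"
              then have "1 / infdist \<xi> C < real n" using n0 by simp
              then show "f n \<xi> = indicator C \<xi>" using False d by (simp add: f_def field_simps)
            qed
          qed
        qed
        show "f n \<in> borel_measurable (\<mu> (max 0 t))" for n by (rule borel_measurable_prob_MD[OF \<mu>t f_bm])
        show "(indicator C :: _ \<Rightarrow> real) \<in> borel_measurable (\<mu> (max 0 t))"
          using C by (intro borel_measurable_prob_MD[OF \<mu>t]) (simp add: borel_closed)
      qed (use f_norm in auto)
      then show "(\<lambda>n. LINT \<xi>|\<mu> (max 0 t). f n \<xi>) \<longlonglongrightarrow> measure (\<mu> (max 0 t)) A"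
        by (simp add: C prob_algebra_MDD(3)[OF \<mu>t] Int_commute)
    qed
  qed (simp add: C)
  moreover have "emeasure (\<mu> (max 0 t)) A = ennreal (measure (\<mu> (max 0 t)) A)" for t
    using prob_algebra_MDD(1)[OF \<mu>[of "max 0 t"]]
    by (simp add: finite_measure.emeasure_eq_measure prob_space_def)
  ultimately show "(\<lambda>t. emeasure (\<mu> (max 0 t)) A) \<in> borel_measurable borel" by simp
qed auto

text \<open>A mixture over a random time; along the flow its transform becomes a moving average in
  time. \<open>max 0\<close> makes the kernel total.\<close>

definition time_average :: "real \<Rightarrow> (real \<Rightarrow> (real \<times> real) measure) \<Rightarrow> (real \<times> real) measure" where
  "time_average \<epsilon> \<mu> = uniform_measure lborel {0..\<epsilon>} \<bind> (\<lambda>s. \<mu> (max 0 s))"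

lemma integral_uniform_interval:
  fixes f :: "real \<Rightarrow> complex"
  assumes \<epsilon>: "0 < \<epsilon>" and f: "continuous_on {0..\<epsilon>} f" and [measurable]: "f \<in> borel_measurable borel"
  shows "(CLINT s|uniform_measure lborel {0..\<epsilon>}. f s) = integral {0..\<epsilon>} f / \<epsilon>"
proof -
  have "uniform_measure lborel {0..\<epsilon>} = density lborel (\<lambda>s. ennreal (indicator {0..\<epsilon>} s / \<epsilon>))"
    unfolding uniform_measure_def using \<epsilon>
    by (intro density_cong AE_I2) (auto simp: divide_ennreal simp flip: ennreal_1 split: split_indicator)
  then have "(CLINT s|uniform_measure lborel {0..\<epsilon>}. f s) = (CLINT s|lborel. (indicator {0..\<epsilon>} s / \<epsilon>) *\<^sub>R f s)"
    using \<epsilon> by (simp add: integral_density)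
  also have "\<dots> = (CLBINT s:{0..\<epsilon>}. f s) / \<epsilon>"
    unfolding set_lebesgue_integral_def
    by (subst integral_divide_zero[symmetric]) (simp add: scaleR_conv_of_real)
  also have "(CLBINT s:{0..\<epsilon>}. f s) = integral {0..\<epsilon>} f"
    by (rule set_borel_integral_eq_integral(2)) (rule borel_integrable_atLeastAtMost'[OF f])
  finally show ?thesis .
qed

context
  fixes \<mu> :: "real \<Rightarrow> (real \<times> real) measure" and \<epsilon> :: real
  assumes wc: "weakly_continuous \<mu>" and \<mu>: "\<And>t. 0 \<le> t \<Longrightarrow> \<mu> t \<in> space (prob_algebra MD)" and \<epsilon>: "0 < \<epsilon>"
begin

lemma uniform_prob: "prob_space (uniform_measure lborel {0..\<epsilon>})"
  by (rule prob_space_uniform_measure) (use \<epsilon> in auto)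

lemma uniform_kernel: "(\<lambda>s. \<mu> (max 0 s)) \<in> uniform_measure lborel {0..\<epsilon>} \<rightarrow>\<^sub>M prob_algebra MD"
  using weakly_continuous_kernel[OF wc \<mu>] by simp

lemma uniform_AE: "AE s in uniform_measure lborel {0..\<epsilon>}. s \<in> {0..\<epsilon>}"
  by (rule AE_uniform_measureI) auto

lemma time_average_prob: "time_average \<epsilon> \<mu> \<in> space (prob_algebra MD)"
  unfolding time_average_def
  by (rule bind_prob_algebra[OF _ uniform_kernel]) (use uniform_prob in \<open>simp add: space_prob_algebra\<close>)

lemma time_average_nn_integral_le:
  assumes f: "f \<in> borel_measurable MD" and le: "\<And>s. s \<in> {0..\<epsilon>} \<Longrightarrow> (\<integral>\<^sup>+\<xi>. f \<xi> \<partial>\<mu> s) \<le> c"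
  shows "(\<integral>\<^sup>+\<xi>. f \<xi> \<partial>time_average \<epsilon> \<mu>) \<le> c"
proof -
  interpret prob_space "uniform_measure lborel {0..\<epsilon>}" by (rule uniform_prob)
  have "(\<integral>\<^sup>+\<xi>. f \<xi> \<partial>time_average \<epsilon> \<mu>) = (\<integral>\<^sup>+s. \<integral>\<^sup>+\<xi>. f \<xi> \<partial>\<mu> (max 0 s) \<partial>uniform_measure lborel {0..\<epsilon>})"
    unfolding time_average_def by (rule nn_integral_bind[OF f measurable_prob_algebraD[OF uniform_kernel]])
  also have "\<dots> \<le> (\<integral>\<^sup>+s. c \<partial>uniform_measure lborel {0..\<epsilon>})"
    by (rule nn_integral_mono_AE, rule AE_mp[OF uniform_AE]) (use le in \<open>auto intro!: AE_I2\<close>)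
  also have "\<dots> = c" using emeasure_space_1 by simp
  finally show ?thesis .
qed

lemma time_average_integral:
  fixes f :: "real \<times> real \<Rightarrow> complex"
  assumes f: "continuous_on D f" "\<And>\<xi>. \<xi> \<in> D \<Longrightarrow> norm (f \<xi>) \<le> B"
  shows "(CLINT \<xi>|time_average \<epsilon> \<mu>. f \<xi>) = integral {0..\<epsilon>} (\<lambda>s. CLINT \<xi>|\<mu> s. f \<xi>) / \<epsilon>"
proof -
  note c = weakly_continuous_complex[OF wc \<mu> f]
  have "(CLINT \<xi>|time_average \<epsilon> \<mu>. f \<xi>) = (CLINT s|uniform_measure lborel {0..\<epsilon>}. CLINT \<xi>|\<mu> (max 0 s). f \<xi>)"
    unfolding time_average_def
    by (rule integral_bind_complex[OF uniform_prob uniform_kernel])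
      (use f in \<open>auto intro!: borel_measurable_continuous_on_restrict\<close>)
  also have "\<dots> = integral {0..\<epsilon>} (\<lambda>s. CLINT \<xi>|\<mu> (max 0 s). f \<xi>) / \<epsilon>"
    by (rule integral_uniform_interval[OF \<epsilon>])
     (auto intro!: borel_measurable_continuous_onI continuous_on_compose2[OF c] continuous_intros)
  also have "integral {0..\<epsilon>} (\<lambda>s. CLINT \<xi>|\<mu> (max 0 s). f \<xi>) = integral {0..\<epsilon>} (\<lambda>s. CLINT \<xi>|\<mu> s. f \<xi>)"
    by (rule integral_cong) simp
  finally show ?thesis .
qed

lemma transform_time_average:
  assumes u: "u \<in> U"
  shows "transform (time_average \<epsilon> \<mu>) u = integral {0..\<epsilon>} (\<lambda>s. transform (\<mu> s) u) / \<epsilon>"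
  unfolding transform_def
  by (rule time_average_integral[where B = 1])
    (use norm_exp_pairing_le[OF u] in \<open>auto simp: pairing_def intro!: continuous_intros\<close>)

lemma time_average_integral_near:
  fixes f :: "real \<times> real \<Rightarrow> complex"
  assumes f: "continuous_on D f" "\<And>\<xi>. \<xi> \<in> D \<Longrightarrow> norm (f \<xi>) \<le> B"
    and near: "\<And>s. s \<in> {0..\<epsilon>} \<Longrightarrow> norm ((CLINT \<xi>|\<mu> s. f \<xi>) - a) \<le> \<eta>"
  shows "norm ((CLINT \<xi>|time_average \<epsilon> \<mu>. f \<xi>) - a) \<le> \<eta>"
proof -
  note c = continuous_on_subset[OF weakly_continuous_complex[OF wc \<mu> f], of "{0..\<epsilon>}"]
  have "integral {0..\<epsilon>} (\<lambda>s. (CLINT \<xi>|\<mu> s. f \<xi>) - a) = integral {0..\<epsilon>} (\<lambda>s. CLINT \<xi>|\<mu> s. f \<xi>) - \<epsilon> * a"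
    using \<epsilon> c by (subst integral_diff) (auto intro!: integrable_continuous_interval simp: scaleR_conv_of_real)
  then have "(CLINT \<xi>|time_average \<epsilon> \<mu>. f \<xi>) - a = integral {0..\<epsilon>} (\<lambda>s. (CLINT \<xi>|\<mu> s. f \<xi>) - a) / \<epsilon>"
    using \<epsilon> by (simp add: time_average_integral[OF f] diff_divide_distrib)
  moreover have "norm (integral {0..\<epsilon>} (\<lambda>s. (CLINT \<xi>|\<mu> s. f \<xi>) - a)) \<le> \<eta> * (\<epsilon> - 0)"
    using \<epsilon> by (intro integral_bound continuous_intros c near) auto
  ultimately show ?thesis using \<epsilon> by (simp add: norm_divide divide_le_eq)
qed

lemma time_average_integrable:
  assumes int: "\<And>s. 0 \<le> s \<Longrightarrow> integrable (\<mu> s) norm" and L: "\<And>s. s \<in> {0..\<epsilon>} \<Longrightarrow> (LINT \<xi>|\<mu> s. norm \<xi>) \<le> L"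
  shows "integrable (time_average \<epsilon> \<mu>) norm"
proof (rule integrable_norm_MD[OF time_average_prob])
  have "(\<integral>\<^sup>+\<xi>. ennreal (norm \<xi>) \<partial>\<mu> s) \<le> ennreal L" if "s \<in> {0..\<epsilon>}" for s
    using int[of s] L[OF that] that by (subst nn_integral_eq_integral) (auto intro: ennreal_leI)
  then have "(\<integral>\<^sup>+\<xi>. ennreal (norm \<xi>) \<partial>time_average \<epsilon> \<mu>) \<le> ennreal L"
    by (intro time_average_nn_integral_le measurable_MD_borel) auto
  also have "\<dots> < \<infinity>" by simp
  finally show "(\<integral>\<^sup>+\<xi>. ennreal (norm \<xi>) \<partial>time_average \<epsilon> \<mu>) < \<infinity>" .
qed

end

lemma continuous_on_nonneg_at_0:
  fixes g :: "real \<Rightarrow> 'a :: real_normed_vector"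
  assumes "continuous_on {0..} g" "0 < \<eta>"
  obtains d where "0 < d" "\<And>s. 0 \<le> s \<Longrightarrow> s < d \<Longrightarrow> norm (g s - g 0) < \<eta>"
proof -
  have "(0::real) \<in> {0..}" by simp
  then obtain d where "0 < d" "\<forall>s\<in>{0..}. dist s 0 < d \<longrightarrow> dist (g s) (g 0) < \<eta>"
    using assms unfolding continuous_on_iff by blast
  then show ?thesis using that[of d] by (simp add: dist_norm)
qed

section \<open>Joint continuity of the flow and transforms of time averages\<close>

context affine_immigration
begin

text \<open>The moment bound on a compact time interval makes the transforms Lipschitz in
  \<open>u\<close> uniformly in time; continuity in time at fixed \<open>u\<close> does the
  rest.\<close>

lemma branch_transform_continuous: "continuous_on ({0..} \<times> U) (\<lambda>(t, u). transform (branch t) u)"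
  unfolding continuous_on_sequentially
proof (intro allI impI ballI, elim conjE)
  fix X and x :: "real \<times> complex \<times> complex"
  assume x: "x \<in> {0..} \<times> U" and X: "\<forall>n. X n \<in> {0..} \<times> U" "X \<longlonglongrightarrow> x"
  obtain t u where tu: "x = (t, u)" by (cases x)
  have t: "0 \<le> t" and u: "u \<in> U" using x tu by auto
  define s where "s n = fst (X n)" for n
  define v where "v n = snd (X n)" for n
  have s: "0 \<le> s n" and v: "v n \<in> U" for n using X by (auto simp: s_def v_def mem_Times_iff)
  have s_lim: "s \<longlonglongrightarrow> t" and v_lim: "v \<longlonglongrightarrow> u"
    using tendsto_fst[OF X(2)] tendsto_snd[OF X(2)] by (simp_all add: s_def[abs_def] v_def[abs_def] tu)
  have "Bseq s" using s_lim convergent_imp_Bseq[of s] unfolding convergent_def by blast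
  then obtain T where "\<And>n. \<bar>s n\<bar> \<le> T" by (auto simp: Bseq_def)
  then have T: "\<And>n. s n \<le> T" by (simp add: abs_le_iff)
  obtain L where L: "\<And>s. s \<in> {0..T} \<Longrightarrow> (LINT \<xi>|branch s. norm \<xi>) \<le> L" using local_moment_bound[of T] by blast
  have "(\<lambda>n. transform (branch (s n)) (v n) - transform (branch (s n)) u) \<longlonglongrightarrow> 0"
  proof (rule Lim_null_comparison)
    show "\<forall>\<^sub>F n in sequentially. norm (transform (branch (s n)) (v n) - transform (branch (s n)) u) \<le> 2 * norm (v n - u) * L"
    proof (intro always_eventually allI)
      fix n
      have "norm (transform (branch (s n)) (v n) - transform (branch (s n)) u) \<le> 2 * norm (v n - u) * (LINT \<xi>|branch (s n). norm \<xi>)"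
        by (rule norm_transform_diff_le[OF branch_prob[OF s] branch_integrable[OF s] v u])
      also have "\<dots> \<le> 2 * norm (v n - u) * L"
        using L[of "s n"] s T by (intro mult_left_mono) auto
      finally show "norm (transform (branch (s n)) (v n) - transform (branch (s n)) u) \<le> 2 * norm (v n - u) * L" .
    qed
    have "(\<lambda>n. 2 * norm (v n - u) * L) \<longlonglongrightarrow> 2 * norm (u - u) * L" by (intro tendsto_intros v_lim)
    then show "(\<lambda>n. 2 * norm (v n - u) * L) \<longlonglongrightarrow> 0" by simp
  qed
  moreover have "(\<lambda>n. transform (branch (s n)) u) \<longlonglongrightarrow> transform (branch t) u"
    by (rule continuous_on_tendsto_compose[OF weakly_continuous_transform[OF branch_weakly_continuous branch_prob u] s_lim])
      (use t s in auto)
  ultimately have "(\<lambda>n. (transform (branch (s n)) (v n) - transform (branch (s n)) u) + transform (branch (s n)) u)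
      \<longlonglongrightarrow> 0 + transform (branch t) u" by (rule tendsto_add)
  then show "((\<lambda>(t, u). transform (branch t) u) \<circ> X) \<longlonglongrightarrow> (\<lambda>(t, u). transform (branch t) u) x"
    by (simp add: o_def tu s_def v_def split_beta')
qed

text \<open>The domain is convex, hence contractible, so the nonvanishing transform of
  \<open>branch\<close> has a jointly continuous logarithm \<open>g\<close>. Subtracting
  \<open>g (t, 0)\<close> makes it vanish at \<open>u = 0\<close>, and by uniqueness of logarithms
  it is then \<open>fst (\<psi> t u)\<close>.\<close>

lemma \<psi>_jointly_continuous: "continuous_on ({0..} \<times> U) (\<lambda>(t, u). \<psi> t u)"
proof -
  have ne: "(\<lambda>(t, u). transform (branch t) u) z \<noteq> 0" if "z \<in> {0..} \<times> U" for z
    using that by (auto simp: exp_fst_\<psi>[symmetric])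
  have "convex ({0::real..} \<times> U)" by (intro convex_Times convex_U) simp
  then obtain g where g: "continuous_on ({0..} \<times> U) g"
    "\<And>z. z \<in> {0..} \<times> U \<Longrightarrow> (\<lambda>(t, u). transform (branch t) u) z = exp (g z)"
    using continuous_logarithm_on_contractible[OF branch_transform_continuous convex_imp_contractible ne] by blast
  have eq: "fst (\<psi> t u) = g (t, u) - g (t, 0)" if t: "0 \<le> t" and u: "u \<in> U" for t u
  proof (rule continuous_logs_eq[OF connected_U _ _ _ zero_mem_U _ u])
    show "continuous_on U (\<lambda>u. fst (\<psi> t u))" by (intro continuous_intros \<psi>_continuous[OF t])
    show "continuous_on U (\<lambda>u. g (t, u) - g (t, 0))"
      by (intro continuous_intros continuous_on_compose2[OF g(1)]) (use t in auto)
    show "fst (\<psi> t 0) = g (t, 0) - g (t, 0)" by (simp add: \<psi>_0[OF t])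
    fix v assume v: "v \<in> U"
    show "exp (fst (\<psi> t v)) = exp (g (t, v) - g (t, 0))"
      using g(2)[of "(t, v)"] g(2)[of "(t, 0)"] t v
      by (simp add: exp_diff exp_fst_\<psi> transform_0[OF branch_prob])
  qed
  have "continuous_on ({0..} \<times> U) (\<lambda>z. (g z - g (fst z, 0), complex_of_real (drift (fst z)) * snd (snd z)))"
    by (intro continuous_intros continuous_on_compose2[OF g(1)] continuous_on_compose2[OF moments_continuous(3)] g(1)) auto
  then show ?thesis
    by (rule continuous_on_eq) (auto simp: eq snd_\<psi> prod_eq_iff)
qed

lemma \<psi>_time_continuous: "u \<in> U \<Longrightarrow> continuous_on {0..} (\<lambda>t. \<psi> t u)"
  using continuous_on_compose2[OF \<psi>_jointly_continuous, of "{0..}" "\<lambda>t. (t, u)"]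
  by (simp add: continuous_intros image_subset_iff)

lemma time_average_branch:
  assumes \<epsilon>: "0 < \<epsilon>"
  shows "time_average \<epsilon> branch \<in> space (prob_algebra MD)" "integrable (time_average \<epsilon> branch) norm"
    "\<And>u. u \<in> U \<Longrightarrow> transform (time_average \<epsilon> branch) u = integral {0..\<epsilon>} (\<lambda>s. transform (branch s) u) / \<epsilon>"
proof -
  obtain L where L: "\<And>s. s \<in> {0..\<epsilon>} \<Longrightarrow> (LINT \<xi>|branch s. norm \<xi>) \<le> L" using local_moment_bound[of \<epsilon>] by blast
  show "time_average \<epsilon> branch \<in> space (prob_algebra MD)"
    by (rule time_average_prob[OF branch_weakly_continuous branch_prob \<epsilon>])
  show "integrable (time_average \<epsilon> branch) norm"
    by (rule time_average_integrable[OF branch_weakly_continuous branch_prob \<epsilon> branch_integrable L])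
  show "\<And>u. u \<in> U \<Longrightarrow> transform (time_average \<epsilon> branch) u = integral {0..\<epsilon>} (\<lambda>s. transform (branch s) u) / \<epsilon>"
    by (rule transform_time_average[OF branch_weakly_continuous branch_prob \<epsilon>])
qed

lemma time_average_\<gamma>:
  assumes \<epsilon>: "0 < \<epsilon>"
  shows "time_average \<epsilon> \<gamma> \<in> space (prob_algebra MD)" "integrable (time_average \<epsilon> \<gamma>) norm"
    "\<And>u. u \<in> U \<Longrightarrow> transform (time_average \<epsilon> \<gamma>) u = integral {0..\<epsilon>} (\<lambda>s. transform (\<gamma> s) u) / \<epsilon>"
proof -
  obtain L where L: "\<And>s. s \<in> {0..\<epsilon>} \<Longrightarrow> (LINT \<xi>|\<gamma> s. norm \<xi>) \<le> L" using local_moment_bound[of \<epsilon>] by blast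
  show "time_average \<epsilon> \<gamma> \<in> space (prob_algebra MD)"
    by (rule time_average_prob[OF \<gamma>_weakly_continuous \<gamma>_prob \<epsilon>])
  show "integrable (time_average \<epsilon> \<gamma>) norm"
    by (rule time_average_integrable[OF \<gamma>_weakly_continuous \<gamma>_prob \<epsilon> \<gamma>_integrable L])
  show "\<And>u. u \<in> U \<Longrightarrow> transform (time_average \<epsilon> \<gamma>) u = integral {0..\<epsilon>} (\<lambda>s. transform (\<gamma> s) u) / \<epsilon>"
    by (rule transform_time_average[OF \<gamma>_weakly_continuous \<gamma>_prob \<epsilon>])
qed

text \<open>The equation at time 0 makes the transform idempotent; its values 0 and 1 cannot both
  occur on the connected set \<open>U\<close>, and the value at \<open>u = 0\<close> is 1.\<close>

lemma transform_\<gamma>_0: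
  assumes u: "u \<in> U" shows "transform (\<gamma> 0) u = 1"
proof -
  have idem: "transform (\<gamma> 0) v * transform (\<gamma> 0) v = transform (\<gamma> 0) v" if "v \<in> U" for v
    using transform_\<gamma>_add[of 0 0 v] that by (simp add: \<psi>_time_0)
  have "transform (\<gamma> 0) constant_on U"
  proof (rule continuous_discrete_range_constant[OF connected_U])
    show "continuous_on U (transform (\<gamma> 0))" by (rule continuous_on_transform[OF \<gamma>_prob]) simp
    have 01: "transform (\<gamma> 0) v = 0 \<or> transform (\<gamma> 0) v = 1" if "v \<in> U" for v using idem[OF that] by auto
    show "\<exists>e>0. \<forall>y. y \<in> U \<and> transform (\<gamma> 0) y \<noteq> transform (\<gamma> 0) x \<longrightarrow> e \<le> norm (transform (\<gamma> 0) y - transform (\<gamma> 0) x)"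
      if "x \<in> U" for x
    proof (intro exI[of _ 1] conjI allI impI, simp)
      fix y assume "y \<in> U \<and> transform (\<gamma> 0) y \<noteq> transform (\<gamma> 0) x"
      then show "1 \<le> norm (transform (\<gamma> 0) y - transform (\<gamma> 0) x)"
        using 01[OF that] 01[of y] by auto
    qed
  qed
  then show ?thesis using transform_0[OF \<gamma>_prob[of 0]] u zero_mem_U by (auto simp: constant_on_def)
qed

text \<open>The integrand \<open>fst \<xi> * exp \<langle>u, \<xi>\<rangle>\<close> is unbounded; the convergence of the means \<open>q1\<close> supplies
  uniform integrability near time \<open>0\<close>.\<close>

lemma time_average_branch_deriv_nonzero:
  assumes u: "u \<in> U"
  obtains \<epsilon> where "0 < \<epsilon>" "transform_deriv (time_average \<epsilon> branch) u (1, 0) \<noteq> 0"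
proof -
  \<comment> \<open>At time 0 the law is concentrated at \<open>(1, 0)\<close> and the derivative is
    \<open>exp (fst u)\<close>. Truncating and averaging cost \<eta> each, together two thirds of
    its modulus.\<close>
  define \<eta> where "\<eta> = norm (exp (fst u)) / 3"
  have \<eta>: "0 < \<eta>" by (simp add: \<eta>_def)
  define f where "f \<xi> = complex_of_real (min (fst \<xi>) 1) * exp (pairing u \<xi>)" for \<xi>
  have f_cont: "continuous_on D f" unfolding f_def pairing_def by (intro continuous_intros)
  have f_norm: "norm (f \<xi>) \<le> 1" if "\<xi> \<in> D" for \<xi>
  proof -
    have "\<bar>min (fst \<xi>) 1\<bar> \<le> 1" using that by (auto simp: D_def)
    then have "\<bar>min (fst \<xi>) 1\<bar> * norm (exp (pairing u \<xi>)) \<le> 1 * 1"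
      using norm_exp_pairing_le[OF u that] by (intro mult_mono) auto
    then show ?thesis by (simp add: f_def norm_mult del: norm_exp_eq_Re)
  qed
  have min_bm: "(\<lambda>\<xi>. complex_of_real (min (fst \<xi>) 1)) \<in> borel_measurable MD"
    by (rule measurable_MD_borel) measurable
  \<comment> \<open>The mean excess of the first coordinate over 1. It is continuous in time because
    \<open>q1\<close> is, and it vanishes at time 0.\<close>
  define g where "g s = q1 s - Re (CLINT \<xi>|branch s. complex_of_real (min (fst \<xi>) 1))" for s
  have m_cont: "continuous_on {0..} (\<lambda>s. CLINT \<xi>|branch s. complex_of_real (min (fst \<xi>) 1))"
    by (rule weakly_continuous_complex[OF branch_weakly_continuous branch_prob, where B = 1])
      (auto intro!: continuous_intros simp: D_def)
  have g_cont: "continuous_on {0..} g" unfolding g_def by (intro continuous_intros moments_continuous m_cont)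
  have f_int_cont: "continuous_on {0..} (\<lambda>s. CLINT \<xi>|branch s. f \<xi>)"
    by (rule weakly_continuous_complex[OF branch_weakly_continuous branch_prob f_cont f_norm])
  have branch_0: "branch 0 = return MD (1, 0)" by (simp add: Q_0)
  have f0: "(CLINT \<xi>|branch 0. f \<xi>) = exp (fst u)"
    unfolding branch_0 using f_cont
    by (subst integral_return) (auto intro!: borel_measurable_continuous_on_restrict simp: f_def pairing_def)
  have g0: "g 0 = 0"
    unfolding g_def branch_0 using q1_eq[of 0] by (subst integral_return) auto
  obtain d1 where d1: "0 < d1" "\<And>s. 0 \<le> s \<Longrightarrow> s < d1 \<Longrightarrow> \<bar>g s\<bar> < \<eta>"
    using continuous_on_nonneg_at_0[OF g_cont \<eta>] by (auto simp: g0)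
  obtain d2 where d2: "0 < d2" "\<And>s. 0 \<le> s \<Longrightarrow> s < d2 \<Longrightarrow> norm ((CLINT \<xi>|branch s. f \<xi>) - exp (fst u)) < \<eta>"
    using continuous_on_nonneg_at_0[OF f_int_cont \<eta>] unfolding f0 by blast
  define \<epsilon> where "\<epsilon> = min d1 d2 / 2"
  have \<epsilon>: "0 < \<epsilon>" "\<epsilon> < d1" "\<epsilon> < d2" using d1 d2 by (auto simp: \<epsilon>_def)
  define M where "M = time_average \<epsilon> branch"
  note M = time_average_branch[OF \<epsilon>(1), folded M_def]
  have spM: "space M = D" using M(1) by (rule prob_algebra_MDD)
  have near: "norm ((CLINT \<xi>|M. f \<xi>) - exp (fst u)) \<le> \<eta>"
    unfolding M_def
    by (rule time_average_integral_near[OF branch_weakly_continuous branch_prob \<epsilon>(1) f_cont f_norm])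
      (use d2(2) \<epsilon> in \<open>auto intro!: less_imp_le\<close>)
  have tail: "(\<integral>\<^sup>+\<xi>. ennreal (fst \<xi> - min (fst \<xi>) 1) \<partial>M) \<le> ennreal \<eta>"
    unfolding M_def
  proof (rule time_average_nn_integral_le[OF branch_weakly_continuous branch_prob \<epsilon>(1)])
    fix s assume s: "s \<in> {0..\<epsilon>}"
    then have s0: "0 \<le> s" by simp
    have i1: "integrable (branch s) fst" by (rule integrable_fst_snd[OF branch_prob[OF s0] branch_integrable[OF s0]])
    have i2: "complex_integrable (branch s) (\<lambda>\<xi>. complex_of_real (min (fst \<xi>) 1))"
      by (rule integrable_bounded_MD[OF branch_prob[OF s0] min_bm, where B = 1]) (auto simp: D_def)
    have i3: "integrable (branch s) (\<lambda>\<xi>. min (fst \<xi>) 1)"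
      using integrable_Re[OF i2] by simp
    have "(\<integral>\<^sup>+\<xi>. ennreal (fst \<xi> - min (fst \<xi>) 1) \<partial>branch s) = ennreal (LINT \<xi>|branch s. fst \<xi> - min (fst \<xi>) 1)"
      using i1 i3 by (intro nn_integral_eq_integral) auto
    also have "(LINT \<xi>|branch s. fst \<xi> - min (fst \<xi>) 1) = g s"
      using i1 i3 by (simp add: g_def q1_def)
    also have "ennreal (g s) \<le> ennreal \<eta>" using d1(2)[of s] s \<epsilon> by (intro ennreal_leI) auto
    finally show "(\<integral>\<^sup>+\<xi>. ennreal (fst \<xi> - min (fst \<xi>) 1) \<partial>branch s) \<le> ennreal \<eta>" .
  qed auto
  have iM: "integrable M fst" by (rule integrable_fst_snd[OF M(1,2)])
  have iM1: "complex_integrable M f"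
    by (rule integrable_bounded_MD[OF M(1), where B = 1])
      (use f_norm f_cont in \<open>auto intro!: borel_measurable_continuous_on_restrict\<close>)
  have iM2: "complex_integrable M (\<lambda>\<xi>. pairing (1, 0) \<xi> * exp (pairing u \<xi>))"
    by (rule integrable_pairing_exp[OF M(1,2) u])
  have iM3: "complex_integrable M (\<lambda>\<xi>. complex_of_real (min (fst \<xi>) 1))"
    by (rule integrable_bounded_MD[OF M(1) min_bm, where B = 1]) (auto simp: D_def)
  have iM4: "integrable M (\<lambda>\<xi>. fst \<xi> - min (fst \<xi>) 1)"
    using integrable_Re[OF iM3] iM by simp
  have "(LINT \<xi>|M. fst \<xi> - min (fst \<xi>) 1) \<le> \<eta>"
    using tail \<eta> iM4 by (subst (asm) nn_integral_eq_integral) (auto simp: ennreal_le_iff)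
  moreover have "norm (transform_deriv M u (1, 0) - (CLINT \<xi>|M. f \<xi>)) \<le> (LINT \<xi>|M. fst \<xi> - min (fst \<xi>) 1)"
  proof -
    have "transform_deriv M u (1, 0) - (CLINT \<xi>|M. f \<xi>) = (CLINT \<xi>|M. pairing (1, 0) \<xi> * exp (pairing u \<xi>) - f \<xi>)"
      unfolding transform_deriv_def using iM1 iM2 by simp
    also have "norm \<dots> \<le> (LINT \<xi>|M. norm (pairing (1, 0) \<xi> * exp (pairing u \<xi>) - f \<xi>))"
      by (rule integral_norm_bound)
    also have "\<dots> \<le> (LINT \<xi>|M. fst \<xi> - min (fst \<xi>) 1)"
    proof (rule integral_mono)
      fix \<xi> assume "\<xi> \<in> space M"
      then have \<xi>: "\<xi> \<in> D" using spM by simp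
      have "pairing (1, 0) \<xi> * exp (pairing u \<xi>) - f \<xi> = complex_of_real (fst \<xi> - min (fst \<xi>) 1) * exp (pairing u \<xi>)"
        by (simp add: pairing_def f_def algebra_simps)
      then have "norm (pairing (1, 0) \<xi> * exp (pairing u \<xi>) - f \<xi>) = (fst \<xi> - min (fst \<xi>) 1) * norm (exp (pairing u \<xi>))"
        by (simp only: norm_mult norm_of_real)
      also have "\<dots> \<le> (fst \<xi> - min (fst \<xi>) 1) * 1"
        using norm_exp_pairing_le[OF u \<xi>] by (intro mult_left_mono) auto
      finally show "norm (pairing (1, 0) \<xi> * exp (pairing u \<xi>) - f \<xi>) \<le> fst \<xi> - min (fst \<xi>) 1" by simp
    qed (use iM1 iM2 iM4 in \<open>auto intro!: integrable_norm Bochner_Integration.integrable_diff\<close>)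
    finally show ?thesis .
  qed
  ultimately have "norm (transform_deriv M u (1, 0) - exp (fst u)) \<le> \<eta> + \<eta>"
    using near norm_triangle_ineq[of "transform_deriv M u (1, 0) - (CLINT \<xi>|M. f \<xi>)" "(CLINT \<xi>|M. f \<xi>) - exp (fst u)"]
    by simp
  moreover have "\<eta> + \<eta> < norm (exp (fst u))" by (simp add: \<eta>_def)
  ultimately have "transform_deriv M u (1, 0) \<noteq> 0" by auto
  then show ?thesis using that[OF \<epsilon>(1)] by (simp add: M_def)
qed

lemma time_average_\<gamma>_nonzero:
  assumes u: "u \<in> U"
  obtains \<epsilon> where "0 < \<epsilon>" "transform (time_average \<epsilon> \<gamma>) u \<noteq> 0"
proof -
  have c: "continuous_on {0..} (\<lambda>s. transform (\<gamma> s) u)"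
    by (rule weakly_continuous_transform[OF \<gamma>_weakly_continuous \<gamma>_prob u])
  obtain d where d: "0 < d" "\<And>s. 0 \<le> s \<Longrightarrow> s < d \<Longrightarrow> norm (transform (\<gamma> s) u - 1) < 1 / 2"
    using continuous_on_nonneg_at_0[OF c, of "1 / 2"] unfolding transform_\<gamma>_0[OF u] by auto
  have "norm (transform (time_average (d / 2) \<gamma>) u - 1) \<le> 1 / 2"
    unfolding transform_def
    by (rule time_average_integral_near[OF \<gamma>_weakly_continuous \<gamma>_prob, where B = 1])
      (use d norm_exp_pairing_le[OF u] in \<open>auto simp: pairing_def transform_def intro!: continuous_intros less_imp_le\<close>)
  then have "transform (time_average (d / 2) \<gamma>) u \<noteq> 0" by auto
  then show ?thesis using that[of "d / 2"] d by auto
qed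

end

section \<open>Differentiability in time and regularity\<close>

lemma has_vector_derivative_iff_quotient:
  fixes f :: "real \<Rightarrow> 'a :: real_normed_vector"
  shows "(f has_vector_derivative d) (at x within S)
    \<longleftrightarrow> ((\<lambda>y. (f y - f x) /\<^sub>R (y - x)) \<longlongrightarrow> d) (at x within S)"
proof -
  have eq: "norm ((1 / norm (y - x)) *\<^sub>R (f y - (f x + (y - x) *\<^sub>R d))) = norm ((f y - f x) /\<^sub>R (y - x) - d)"
    if "y \<noteq> x" for y
  proof -
    have "(f y - f x) /\<^sub>R (y - x) - d = (1 / (y - x)) *\<^sub>R (f y - (f x + (y - x) *\<^sub>R d))"
      using that by (simp add: scaleR_diff_right scaleR_add_right inverse_eq_divide)
    then show ?thesis by simp
  qed
  have "(f has_vector_derivative d) (at x within S) \<longleftrightarrow>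
      ((\<lambda>y. norm ((1 / norm (y - x)) *\<^sub>R (f y - (f x + (y - x) *\<^sub>R d)))) \<longlongrightarrow> 0) (at x within S)"
    by (simp only: has_vector_derivative_def has_derivative_within bounded_linear_scaleR_left simp_thms tendsto_norm_zero_iff)
  also have "\<dots> \<longleftrightarrow> ((\<lambda>y. norm ((f y - f x) /\<^sub>R (y - x) - d)) \<longlongrightarrow> 0) (at x within S)"
    by (rule filterlim_cong) (use eq in \<open>auto simp: eventually_at_filter\<close>)
  finally show ?thesis by (simp add: tendsto_norm_zero_iff LIM_zero_iff)
qed

text \<open>The increment of \<open>H\<close> is factored exactly as \<open>A v * fst w + B v * snd w\<close> with \<open>w = v - p t\<close> and
  \<open>A\<close>, \<open>B\<close> continuous at \<open>p t\<close>; a remainder of order \<open>o(norm w)\<close> could not be absorbed, since the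
  increment of the first coordinate is the unknown.\<close>

lemma first_coordinate_deriv:
  fixes H :: "complex \<times> complex \<Rightarrow> complex" and p :: "real \<Rightarrow> complex \<times> complex"
  assumes H: "(H has_derivative (\<lambda>w. fst w * m1 + snd w * m2)) (at (p t) within V)" and m1: "m1 \<noteq> 0"
    and t: "t \<in> S" and p: "\<And>s. s \<in> S \<Longrightarrow> p s \<in> V" and p_cont: "continuous (at t within S) p"
    and snd_p: "((\<lambda>s. snd (p s)) has_vector_derivative q) (at t within S)"
    and Hp: "((\<lambda>s. H (p s)) has_vector_derivative k) (at t within S)"
  shows "((\<lambda>s. fst (p s)) has_vector_derivative (k - q * m2) / m1) (at t within S)"
proof -
  define e where "e v = H v - H (p t) - (fst (v - p t) * m1 + snd (v - p t) * m2)" for v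
  \<comment> \<open>The remainder \<open>e v\<close> is split in proportion to the conjugate
    coordinates of \<open>v - p t\<close>, whose products with the coordinates add up to the squared
    norm. At \<open>v = p t\<close> the fractions are 0, hence \<open>A (p t) = m1\<close> and
    \<open>B (p t) = m2\<close>.\<close>
  define A where "A v = m1 + e v * cnj (fst (v - p t)) / of_real ((norm (v - p t))\<^sup>2)" for v
  define B where "B v = m2 + e v * cnj (snd (v - p t)) / of_real ((norm (v - p t))\<^sup>2)" for v
  have factor: "H v - H (p t) = A v * fst (v - p t) + B v * snd (v - p t)" for v
  proof (cases "v = p t")
    case False
    define w where "w = v - p t"
    have w: "norm w \<noteq> 0" using False by (simp add: w_def)
    have "of_real ((norm w)\<^sup>2) = fst w * cnj (fst w) + snd w * cnj (snd w)"
      by (simp add: norm_prod_def complex_norm_square[symmetric])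
    from this[symmetric] have "e v * (fst w * cnj (fst w) + snd w * cnj (snd w)) / of_real ((norm w)\<^sup>2) = e v"
      using w by (simp only:) simp
    then have "e v * cnj (fst w) / of_real ((norm w)\<^sup>2) * fst w + e v * cnj (snd w) / of_real ((norm w)\<^sup>2) * snd w = e v"
      by (simp add: distrib_left add_divide_distrib mult_ac)
    then have "A v * fst w + B v * snd w = m1 * fst w + m2 * snd w + e v"
      unfolding A_def B_def w_def[symmetric] distrib_right by (simp add: add_ac)
    then show ?thesis
      by (simp add: w_def[symmetric] e_def mult.commute)
  qed simp
  have e_lim: "((\<lambda>v. norm (e v) / norm (v - p t)) \<longlongrightarrow> 0) (at (p t) within V)"
  proof -
    have "((\<lambda>v. norm ((1 / norm (v - p t)) *\<^sub>R (H v - (H (p t) + (fst (v - p t) * m1 + snd (v - p t) * m2))))) \<longlongrightarrow> 0) (at (p t) within V)"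
      using H unfolding has_derivative_within by (intro tendsto_norm_zero) auto
    then show ?thesis by (simp add: e_def diff_diff_eq)
  qed
  have bound: "norm (e v * cnj c / of_real ((norm (v - p t))\<^sup>2)) \<le> norm (e v) / norm (v - p t)"
    if "norm c \<le> norm (v - p t)" for c v
  proof (cases "v = p t")
    case False
    then have "norm (e v) * norm c / (norm (v - p t))\<^sup>2 \<le> norm (e v) * norm (v - p t) / (norm (v - p t))\<^sup>2"
      using that by (intro divide_right_mono mult_left_mono) auto
    then show ?thesis using False by (simp add: norm_mult norm_divide norm_power power2_eq_square)
  qed simp
  have "((\<lambda>v. e v * cnj (fst (v - p t)) / of_real ((norm (v - p t))\<^sup>2)) \<longlongrightarrow> 0) (at (p t) within V)"
    by (rule Lim_null_comparison[OF always_eventually e_lim]) (use bound norm_fst_le in \<open>metis prod.collapse\<close>)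
  then have A_lim: "(A \<longlongrightarrow> m1) (at (p t) within V)"
    unfolding A_def using tendsto_add[OF tendsto_const[of m1]] by fastforce
  have "((\<lambda>v. e v * cnj (snd (v - p t)) / of_real ((norm (v - p t))\<^sup>2)) \<longlongrightarrow> 0) (at (p t) within V)"
    by (rule Lim_null_comparison[OF always_eventually e_lim]) (use bound norm_snd_le in \<open>metis prod.collapse\<close>)
  then have B_lim: "(B \<longlongrightarrow> m2) (at (p t) within V)"
    unfolding B_def using tendsto_add[OF tendsto_const[of m2]] by fastforce
  have "A (p t) = m1" "B (p t) = m2" by (simp_all add: A_def B_def)
  with A_lim B_lim have "continuous (at (p t) within V) A" "continuous (at (p t) within V) B"
    by (simp_all add: continuous_within)
  moreover have "p ` S \<subseteq> V" using p by auto
  ultimately have "continuous (at (p t) within p ` S) A" "continuous (at (p t) within p ` S) B"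
    using continuous_within_subset by blast+
  then have "continuous (at t within S) (\<lambda>s. A (p s))" "continuous (at t within S) (\<lambda>s. B (p s))"
    using continuous_within_compose[OF p_cont] by (auto simp: o_def)
  then have A_p: "((\<lambda>s. A (p s)) \<longlongrightarrow> m1) (at t within S)" and B_p: "((\<lambda>s. B (p s)) \<longlongrightarrow> m2) (at t within S)"
    using \<open>A (p t) = m1\<close> \<open>B (p t) = m2\<close> by (simp_all add: continuous_within)
  have "((\<lambda>s. ((H (p s) - H (p t)) /\<^sub>R (s - t) - ((snd (p s) - snd (p t)) /\<^sub>R (s - t)) * B (p s)) / A (p s))
      \<longlongrightarrow> (k - q * m2) / m1) (at t within S)"
    using Hp snd_p m1 unfolding has_vector_derivative_iff_quotient
    by (intro tendsto_divide tendsto_diff tendsto_mult A_p B_p) auto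
  moreover have "\<forall>\<^sub>F s in at t within S. A (p s) \<noteq> 0"
    using tendsto_imp_eventually_ne[OF A_p m1] .
  then have "\<forall>\<^sub>F s in at t within S. ((H (p s) - H (p t)) /\<^sub>R (s - t) - ((snd (p s) - snd (p t)) /\<^sub>R (s - t)) * B (p s)) / A (p s)
      = (fst (p s) - fst (p t)) /\<^sub>R (s - t)"
  proof (rule eventually_mono)
    fix s assume "A (p s) \<noteq> 0"
    moreover have "(H (p s) - H (p t)) /\<^sub>R (s - t) - ((snd (p s) - snd (p t)) /\<^sub>R (s - t)) * B (p s)
        = A (p s) * ((fst (p s) - fst (p t)) /\<^sub>R (s - t))"
      unfolding factor by (simp add: scaleR_conv_of_real algebra_simps)
    ultimately show "((H (p s) - H (p t)) /\<^sub>R (s - t) - ((snd (p s) - snd (p t)) /\<^sub>R (s - t)) * B (p s)) / A (p s)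
      = (fst (p s) - fst (p t)) /\<^sub>R (s - t)"
      by (simp only: nonzero_mult_div_cancel_left not_False_eq_True)
  qed
  ultimately show ?thesis
    unfolding has_vector_derivative_iff_quotient by (rule Lim_transform_eventually)
qed

lemma eventually_mem_at_within: "\<forall>\<^sub>F s in at t within S. s \<in> S" for S
  by (simp add: eventually_at_filter)

text \<open>A quotient rule for a factor \<open>y\<close> not yet known to be continuous: the
  identity \<open>W s - W t - (B s - B t) * y t = B s * (y s - y t)\<close> is exact, and
  \<open>B s\<close> is nonzero near \<open>t\<close>.\<close>

lemma factor_deriv:
  fixes W B y :: "real \<Rightarrow> complex"
  assumes W: "\<And>s. s \<in> S \<Longrightarrow> W s = B s * y s" and t: "t \<in> S" and B0: "B t \<noteq> 0"
    and W': "(W has_vector_derivative w) (at t within S)" and B': "(B has_vector_derivative b) (at t within S)"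
  shows "(y has_vector_derivative (w - b * y t) / B t) (at t within S)"
proof -
  have B_cont: "(B \<longlongrightarrow> B t) (at t within S)"
    using has_vector_derivative_continuous[OF B'] by (simp add: continuous_within)
  have "((\<lambda>s. ((W s - W t) /\<^sub>R (s - t) - ((B s - B t) /\<^sub>R (s - t)) * y t) / B s) \<longlongrightarrow> (w - b * y t) / B t) (at t within S)"
    using W' B' B0 unfolding has_vector_derivative_iff_quotient
    by (intro tendsto_divide tendsto_diff tendsto_mult B_cont) auto
  moreover have "\<forall>\<^sub>F s in at t within S. ((W s - W t) /\<^sub>R (s - t) - ((B s - B t) /\<^sub>R (s - t)) * y t) / B s = (y s - y t) /\<^sub>R (s - t)"
    using tendsto_imp_eventually_ne[OF B_cont B0] eventually_mem_at_within[of S t]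
  proof eventually_elim
    case (elim s)
    have "(W s - W t) /\<^sub>R (s - t) - ((B s - B t) /\<^sub>R (s - t)) * y t = (W s - W t - (B s - B t) * y t) /\<^sub>R (s - t)"
      by (simp add: scaleR_conv_of_real algebra_simps)
    also have "W s - W t - (B s - B t) * y t = B s * (y s - y t)"
      using W[of s] W[OF t] elim by (simp add: algebra_simps)
    finally have "(W s - W t) /\<^sub>R (s - t) - ((B s - B t) /\<^sub>R (s - t)) * y t = B s * ((y s - y t) /\<^sub>R (s - t))"
      by (simp only: mult_scaleR_right)
    then show ?case using elim by (simp only: nonzero_mult_div_cancel_left not_False_eq_True)
  qed
  ultimately show ?thesis
    unfolding has_vector_derivative_iff_quotient by (rule Lim_transform_eventually)
qed

lemma at_within_nonneg: "0 \<le> (t::real) \<Longrightarrow> t < b \<Longrightarrow> at t within {0..b} = at t within {0..}"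
  by (rule at_within_nhd[of t "{..<b}"]) auto

text \<open>The integral is the increment of the primitive \<open>H\<close> over the window from
  \<open>t\<close> to \<open>t + \<epsilon>\<close>, so continuity of \<open>f\<close> makes it
  differentiable in \<open>t\<close>.\<close>

lemma window_deriv:
  fixes f :: "real \<Rightarrow> complex"
  assumes f: "continuous_on {0..} f" and \<epsilon>: "0 < \<epsilon>" and t: "0 \<le> t"
  shows "((\<lambda>t. integral {0..\<epsilon>} (\<lambda>r. f (r + t))) has_vector_derivative f (t + \<epsilon>) - f t) (at t within {0..})"
proof -
  define H where "H t = integral {0..t} f" for t
  have c: "continuous_on {0..b} f" for b using f by (rule continuous_on_subset) auto
  have H_deriv: "(H has_vector_derivative f s) (at s within {0..})" if s: "0 \<le> s" for s
    using integral_has_vector_derivative[OF c, of s "s + 1"] s at_within_nonneg[OF s, of "s + 1"]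
    by (simp add: H_def[abs_def])
  have shift: "integral {0..\<epsilon>} (\<lambda>r. f (r + s)) = H (s + \<epsilon>) - H s" if s: "s \<in> {0..}" for s
  proof -
    have "integral {0..\<epsilon>} (\<lambda>r. f (r + s)) = integral {s..s + \<epsilon>} f"
      using integral_shift_real_ivl[of s s "s + \<epsilon>" f] by simp
    moreover have "H s + integral {s..s + \<epsilon>} f = H (s + \<epsilon>)"
      unfolding H_def using s \<epsilon>
      by (intro Henstock_Kurzweil_Integration.integral_combine integrable_continuous_interval c) auto
    ultimately show ?thesis by (metis add_diff_cancel_left')
  qed
  have "(H has_vector_derivative f (t + \<epsilon>)) (at (t + \<epsilon>) within (\<lambda>s. s + \<epsilon>) ` {0..})"
    by (rule has_vector_derivative_within_subset[OF H_deriv]) (use t \<epsilon> in auto)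
  moreover have "((\<lambda>s. s + \<epsilon>) has_vector_derivative 1) (at t within {0..})"
    by (auto intro!: derivative_eq_intros)
  ultimately have "((\<lambda>s. H (s + \<epsilon>)) has_vector_derivative f (t + \<epsilon>)) (at t within {0..})"
    using vector_diff_chain_within[of "\<lambda>s. s + \<epsilon>" 1 t "{0..}" H "f (t + \<epsilon>)"] by (simp add: o_def)
  from has_vector_derivative_diff[OF this H_deriv[OF t]]
  show ?thesis
    by (rule has_vector_derivative_transform[rotated 2]) (use t shift in auto)
qed

section \<open>Generators of the flow and of the immigration\<close>

context affine_immigration
begin

abbreviation branch_deriv :: "real \<Rightarrow> complex \<times> complex \<Rightarrow> complex \<times> complex \<Rightarrow> complex" where
  "branch_deriv \<epsilon> \<equiv> transform_deriv (time_average \<epsilon> branch)"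

lemma snd_\<psi>_deriv:
  assumes t: "0 \<le> t" and u: "u \<in> U"
  shows "((\<lambda>s. snd (\<psi> s u)) has_vector_derivative of_real \<beta> * snd (\<psi> t u)) (at t within {0..})"
proof -
  have "((\<lambda>s. exp (of_real \<beta> * of_real s) * snd u) has_vector_derivative of_real \<beta> * (exp (of_real \<beta> * of_real t) * snd u)) (at t within {0..})"
    by (rule has_vector_derivative_real_field[of "\<lambda>z. exp (of_real \<beta> * z) * snd u", THEN has_vector_derivative_at_within])
      (auto intro!: derivative_eq_intros)
  moreover have eq: "snd (\<psi> s u) = exp (of_real \<beta> * of_real s) * snd u" if "s \<in> {0..}" for s
    using that u by (simp add: snd_\<psi> drift_eq exp_of_real[symmetric])
  ultimately show ?thesis
    using t by (simp add: eq) (rule has_vector_derivative_transform[rotated 2], auto simp: eq)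
qed

text \<open>The right side is kept explicit because continuity of the generator in \<open>u\<close>
  will be read off it.\<close>

lemma fst_\<psi>_deriv:
  assumes t: "0 \<le> t" and u: "u \<in> U" and \<epsilon>: "0 < \<epsilon>" and m1: "branch_deriv \<epsilon> (\<psi> t u) (1, 0) \<noteq> 0"
  shows "((\<lambda>s. fst (\<psi> s u)) has_vector_derivative
    ((transform (branch (t + \<epsilon>)) u - transform (branch t) u) / \<epsilon>
      - of_real \<beta> * snd (\<psi> t u) * branch_deriv \<epsilon> (\<psi> t u) (0, 1)) / branch_deriv \<epsilon> (\<psi> t u) (1, 0)) (at t within {0..})"
proof (rule first_coordinate_deriv[where V = U and H = "transform (time_average \<epsilon> branch)"])
  note av = time_average_branch[OF \<epsilon>]
  have v: "\<psi> t u \<in> U" using t u by (rule \<psi>_mem_U)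
  show "(transform (time_average \<epsilon> branch) has_derivative
      (\<lambda>w. fst w * branch_deriv \<epsilon> (\<psi> t u) (1, 0) + snd w * branch_deriv \<epsilon> (\<psi> t u) (0, 1))) (at (\<psi> t u) within U)"
  proof -
    have "branch_deriv \<epsilon> (\<psi> t u)
        = (\<lambda>w. fst w * branch_deriv \<epsilon> (\<psi> t u) (1, 0) + snd w * branch_deriv \<epsilon> (\<psi> t u) (0, 1))"
      by (rule ext) (rule transform_deriv_expand[OF av(1,2) v])
    then show ?thesis using transform_has_derivative[OF av(1,2) v] by (simp only:)
  qed
  show "\<psi> s u \<in> U" if "s \<in> {0..}" for s using that u by (simp add: \<psi>_mem_U)
  show "continuous (at t within {0..}) (\<lambda>s. \<psi> s u)"
    using \<psi>_time_continuous[OF u] t by (simp add: continuous_on_eq_continuous_within)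
  show "((\<lambda>s. snd (\<psi> s u)) has_vector_derivative of_real \<beta> * snd (\<psi> t u)) (at t within {0..})"
    by (rule snd_\<psi>_deriv[OF t u])
  have eq: "transform (time_average \<epsilon> branch) (\<psi> s u) = integral {0..\<epsilon>} (\<lambda>r. transform (branch (r + s)) u) / \<epsilon>"
    if "s \<in> {0..}" for s
  proof -
    have "integral {0..\<epsilon>} (\<lambda>r. transform (branch r) (\<psi> s u)) = integral {0..\<epsilon>} (\<lambda>r. transform (branch (r + s)) u)"
      using that u by (intro integral_cong) (simp add: exp_fst_\<psi>[symmetric] \<psi>_flow \<psi>_mem_U)
    then show ?thesis using that u by (simp add: av(3) \<psi>_mem_U)
  qed
  have "((\<lambda>s. integral {0..\<epsilon>} (\<lambda>r. transform (branch (r + s)) u) / \<epsilon>) has_vector_derivative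
      (transform (branch (t + \<epsilon>)) u - transform (branch t) u) / \<epsilon>) (at t within {0..})"
    by (intro has_vector_derivative_divide window_deriv[OF _ \<epsilon> t]
      weakly_continuous_transform[OF branch_weakly_continuous branch_prob u])
  then show "((\<lambda>s. transform (time_average \<epsilon> branch) (\<psi> s u)) has_vector_derivative
      (transform (branch (t + \<epsilon>)) u - transform (branch t) u) / \<epsilon>) (at t within {0..})"
    by (rule has_vector_derivative_transform[rotated 2]) (use t eq in auto)
qed (use t m1 in auto)

text \<open>The first component of the generator of the flow; by \<open>snd_\<psi>_deriv\<close> the
  second one is \<open>\<beta> * snd u\<close>.\<close>

definition R :: "complex \<times> complex \<Rightarrow> complex" where
  "R u = vector_derivative (\<lambda>t. fst (\<psi> t u)) (at 0 within {0..})"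

lemma at_0_nontrivial: "at 0 within {0::real..} \<noteq> bot"
  by (simp add: at_within_Ici_at_right)

lemma R_formula:
  assumes u: "u \<in> U" and \<epsilon>: "0 < \<epsilon>" and m1: "branch_deriv \<epsilon> u (1, 0) \<noteq> 0"
  shows "R u = ((transform (branch \<epsilon>) u - exp (fst u)) / \<epsilon>
      - of_real \<beta> * snd u * branch_deriv \<epsilon> u (0, 1)) / branch_deriv \<epsilon> u (1, 0)"
  using fst_\<psi>_deriv[OF order_refl u \<epsilon>] m1 u
  by (auto simp: R_def \<psi>_time_0 Q_0 transform_return pairing_def intro!: vector_derivative_within[OF at_0_nontrivial])

lemma \<psi>_deriv_exists:
  assumes t: "0 \<le> t" and u: "u \<in> U"
  obtains d where "((\<lambda>s. fst (\<psi> s u)) has_vector_derivative d) (at t within {0..})"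
  using time_average_branch_deriv_nonzero[OF \<psi>_mem_U[OF t u]] fst_\<psi>_deriv[OF t u] by metis

lemma \<psi>_deriv_0:
  assumes u: "u \<in> U"
  shows "((\<lambda>t. \<psi> t u) has_vector_derivative (R u, of_real \<beta> * snd u)) (at 0 within {0..})"
proof -
  obtain d where d: "((\<lambda>s. fst (\<psi> s u)) has_vector_derivative d) (at 0 within {0..})"
    using \<psi>_deriv_exists[OF order_refl u] .
  have "R u = d" unfolding R_def by (rule vector_derivative_within[OF at_0_nontrivial d])
  with has_vector_derivative_Pair[OF d snd_\<psi>_deriv[OF order_refl u]] u
  show ?thesis by (simp add: \<psi>_time_0)
qed

text \<open>The \<epsilon> that works at \<open>u0\<close> works at nearby points too, so one
  explicit formula covers a neighbourhood.\<close>

lemma continuous_on_R: "continuous_on U R"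
  unfolding continuous_on_def
proof
  fix u0 assume u0: "u0 \<in> U"
  obtain \<epsilon> where \<epsilon>: "0 < \<epsilon>" and m1: "branch_deriv \<epsilon> u0 (1, 0) \<noteq> 0"
    using time_average_branch_deriv_nonzero[OF u0] .
  note av = time_average_branch[OF \<epsilon>]
  note lim = continuous_on_transform_deriv[OF av(1,2), unfolded continuous_on_def, rule_format, OF u0]
    continuous_on_transform[OF branch_prob[OF less_imp_le[OF \<epsilon>]], unfolded continuous_on_def, rule_format, OF u0]
  have "((\<lambda>u. ((transform (branch \<epsilon>) u - exp (fst u)) / \<epsilon>
      - of_real \<beta> * snd u * branch_deriv \<epsilon> u (0, 1)) / branch_deriv \<epsilon> u (1, 0)) \<longlongrightarrow> R u0) (at u0 within U)"
    unfolding R_formula[OF u0 \<epsilon> m1] using \<epsilon> m1 by (intro tendsto_intros lim) auto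
  moreover have "\<forall>\<^sub>F u in at u0 within U. ((transform (branch \<epsilon>) u - exp (fst u)) / \<epsilon>
      - of_real \<beta> * snd u * branch_deriv \<epsilon> u (0, 1)) / branch_deriv \<epsilon> u (1, 0) = R u"
    using tendsto_imp_eventually_ne[OF lim(1) m1] eventually_mem_at_within[of U u0]
    by eventually_elim (use R_formula[OF _ \<epsilon>] in auto)
  ultimately show "(R \<longlongrightarrow> R u0) (at u0 within U)" by (rule Lim_transform_eventually)
qed

text \<open>The moving average is the transform of the time average along the flow, differentiable
  by the chain rule, times the unknown \<open>transform (\<gamma> s) u\<close>;
  \<open>factor_deriv\<close> divides by the former.\<close>

lemma transform_\<gamma>_deriv:
  assumes t: "0 \<le> t" and u: "u \<in> U" and \<epsilon>: "0 < \<epsilon>" and nz: "transform (time_average \<epsilon> \<gamma>) (\<psi> t u) \<noteq> 0"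
    and d: "((\<lambda>s. \<psi> s u) has_vector_derivative d) (at t within {0..})"
  shows "((\<lambda>s. transform (\<gamma> s) u) has_vector_derivative
    ((transform (\<gamma> (t + \<epsilon>)) u - transform (\<gamma> t) u) / \<epsilon>
      - transform_deriv (time_average \<epsilon> \<gamma>) (\<psi> t u) d * transform (\<gamma> t) u)
      / transform (time_average \<epsilon> \<gamma>) (\<psi> t u)) (at t within {0..})"
proof (rule factor_deriv)
  note av = time_average_\<gamma>[OF \<epsilon>]
  have v: "\<psi> t u \<in> U" using t u by (rule \<psi>_mem_U)
  show "((\<lambda>s. integral {0..\<epsilon>} (\<lambda>r. transform (\<gamma> (r + s)) u) / \<epsilon>) has_vector_derivative
      (transform (\<gamma> (t + \<epsilon>)) u - transform (\<gamma> t) u) / \<epsilon>) (at t within {0..})"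
    by (intro has_vector_derivative_divide window_deriv[OF _ \<epsilon> t]
      weakly_continuous_transform[OF \<gamma>_weakly_continuous \<gamma>_prob u])
  show "integral {0..\<epsilon>} (\<lambda>r. transform (\<gamma> (r + s)) u) / \<epsilon> = transform (time_average \<epsilon> \<gamma>) (\<psi> s u) * transform (\<gamma> s) u"
    if "s \<in> {0..}" for s
  proof -
    have "integral {0..\<epsilon>} (\<lambda>r. transform (\<gamma> (r + s)) u) = integral {0..\<epsilon>} (\<lambda>r. transform (\<gamma> r) (\<psi> s u) * transform (\<gamma> s) u)"
      using that u by (intro integral_cong) (simp add: transform_\<gamma>_add)
    then show ?thesis using that u by (simp add: av(3) \<psi>_mem_U)
  qed
  have "(transform (time_average \<epsilon> \<gamma>) has_derivative transform_deriv (time_average \<epsilon> \<gamma>) (\<psi> t u)) (at (\<psi> t u) within (\<lambda>s. \<psi> s u) ` {0..})"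
    by (rule has_derivative_subset[OF transform_has_derivative[OF av(1,2) v]])
      (intro image_subsetI \<psi>_mem_U u, simp)
  from has_derivative_in_compose[OF d[unfolded has_vector_derivative_def] this]
  have "((\<lambda>s. transform (time_average \<epsilon> \<gamma>) (\<psi> s u)) has_derivative (\<lambda>s. transform_deriv (time_average \<epsilon> \<gamma>) (\<psi> t u) (s *\<^sub>R d))) (at t within {0..})" .
  moreover have "transform_deriv (time_average \<epsilon> \<gamma>) (\<psi> t u) (s *\<^sub>R d) = s *\<^sub>R transform_deriv (time_average \<epsilon> \<gamma>) (\<psi> t u) d" for s
    using transform_has_derivative[OF av(1,2) v]
    by (intro linear_scale bounded_linear.linear) (auto dest: has_derivative_bounded_linear)
  ultimately show "((\<lambda>s. transform (time_average \<epsilon> \<gamma>) (\<psi> s u)) has_vector_derivative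
      transform_deriv (time_average \<epsilon> \<gamma>) (\<psi> t u) d) (at t within {0..})"
    by (simp add: has_vector_derivative_def)
qed (use t nz in auto)

definition F :: "complex \<times> complex \<Rightarrow> complex" where
  "F u = vector_derivative (\<lambda>t. transform (\<gamma> t) u) (at 0 within {0..})"

lemma F_formula:
  assumes u: "u \<in> U" and \<epsilon>: "0 < \<epsilon>" and nz: "transform (time_average \<epsilon> \<gamma>) u \<noteq> 0"
  shows "F u = ((transform (\<gamma> \<epsilon>) u - 1) / \<epsilon> - transform_deriv (time_average \<epsilon> \<gamma>) u (R u, of_real \<beta> * snd u))
      / transform (time_average \<epsilon> \<gamma>) u"
  using transform_\<gamma>_deriv[OF order_refl u \<epsilon> _ \<psi>_deriv_0[OF u]] nz u
  by (auto simp: F_def \<psi>_time_0 transform_\<gamma>_0 intro!: vector_derivative_within[OF at_0_nontrivial])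

lemma continuous_on_F: "continuous_on U F"
  unfolding continuous_on_def
proof
  fix u0 assume u0: "u0 \<in> U"
  obtain \<epsilon> where \<epsilon>: "0 < \<epsilon>" and nz: "transform (time_average \<epsilon> \<gamma>) u0 \<noteq> 0"
    using time_average_\<gamma>_nonzero[OF u0] .
  note av = time_average_\<gamma>[OF \<epsilon>]
  \<comment> \<open>\<open>transform_deriv\<close> is known to be continuous in \<open>u\<close> for
    a fixed direction, while \<open>(R u, \<beta> * snd u)\<close> moves with \<open>u\<close>;
    expanding along the coordinate directions separates the two.\<close>
  define G where "G u = ((transform (\<gamma> \<epsilon>) u - 1) / \<epsilon> - (R u * transform_deriv (time_average \<epsilon> \<gamma>) u (1, 0)
      + of_real \<beta> * snd u * transform_deriv (time_average \<epsilon> \<gamma>) u (0, 1))) / transform (time_average \<epsilon> \<gamma>) u" for u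
  have FG: "F u = G u" if "u \<in> U" "transform (time_average \<epsilon> \<gamma>) u \<noteq> 0" for u
    using F_formula[OF that(1) \<epsilon> that(2)] transform_deriv_expand[OF av(1,2) that(1), of "(R u, of_real \<beta> * snd u)"]
    by (simp add: G_def)
  note lim = continuous_on_transform_deriv[OF av(1,2), unfolded continuous_on_def, rule_format, OF u0]
    continuous_on_transform[OF \<gamma>_prob[OF less_imp_le[OF \<epsilon>]], unfolded continuous_on_def, rule_format, OF u0]
    continuous_on_transform[OF av(1), unfolded continuous_on_def, rule_format, OF u0]
    continuous_on_R[unfolded continuous_on_def, rule_format, OF u0]
  have "(G \<longlongrightarrow> F u0) (at u0 within U)"
    unfolding FG[OF u0 nz] unfolding G_def using \<epsilon> nz by (intro tendsto_intros lim) auto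
  moreover have "\<forall>\<^sub>F u in at u0 within U. G u = F u"
    using tendsto_imp_eventually_ne[OF lim(3) nz] eventually_mem_at_within[of U u0]
    by eventually_elim (use FG in auto)
  ultimately show "(F \<longlongrightarrow> F u0) (at u0 within U)" by (rule Lim_transform_eventually)
qed

lemma transform_\<gamma>_differentiable:
  assumes t: "0 \<le> t" and u: "u \<in> U"
  obtains d where "((\<lambda>s. transform (\<gamma> s) u) has_vector_derivative d) (at t within {0..})"
proof -
  obtain d where d: "((\<lambda>s. fst (\<psi> s u)) has_vector_derivative d) (at t within {0..})"
    using \<psi>_deriv_exists[OF t u] .
  have "((\<lambda>s. \<psi> s u) has_vector_derivative (d, of_real \<beta> * snd (\<psi> t u))) (at t within {0..})"
    using has_vector_derivative_Pair[OF d snd_\<psi>_deriv[OF t u]] by simp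
  moreover obtain \<epsilon> where "0 < \<epsilon>" "transform (time_average \<epsilon> \<gamma>) (\<psi> t u) \<noteq> 0"
    using time_average_\<gamma>_nonzero[OF \<psi>_mem_U[OF t u]] .
  ultimately show ?thesis using that transform_\<gamma>_deriv[OF t u] by blast
qed

lemma F_deriv:
  assumes u: "u \<in> U"
  shows "((\<lambda>s. transform (\<gamma> s) u) has_vector_derivative F u) (at 0 within {0..})"
proof -
  obtain d where d: "((\<lambda>s. transform (\<gamma> s) u) has_vector_derivative d) (at 0 within {0..})"
    using transform_\<gamma>_differentiable[OF order_refl u] .
  moreover have "F u = d" unfolding F_def by (rule vector_derivative_within[OF at_0_nontrivial d])
  ultimately show ?thesis by simp
qed

text \<open>The derivative at \<open>t\<close> exists, so its value can be taken from the right,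
  where \<open>transform (\<gamma> s) u\<close> is
  \<open>transform (\<gamma> (s - t)) (\<psi> t u)\<close> times a constant and the derivative at
  time 0 applies.\<close>

lemma transform_\<gamma>_ode:
  assumes t: "0 \<le> t" and u: "u \<in> U"
  shows "((\<lambda>s. transform (\<gamma> s) u) has_vector_derivative F (\<psi> t u) * transform (\<gamma> t) u) (at t within {0..})"
proof -
  obtain d where d: "((\<lambda>s. transform (\<gamma> s) u) has_vector_derivative d) (at t within {0..})"
    using transform_\<gamma>_differentiable[OF t u] .
  have "((\<lambda>s. s - t) has_vector_derivative 1) (at t within {t..})"
    by (auto intro!: derivative_eq_intros)
  moreover have "(\<lambda>s. s - t) ` {t..} \<subseteq> {0..}" by auto
  then have "((\<lambda>s. transform (\<gamma> s) (\<psi> t u)) has_vector_derivative F (\<psi> t u)) (at (t - t) within (\<lambda>s. s - t) ` {t..})"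
    using F_deriv[OF \<psi>_mem_U[OF t u]] by (simp add: has_vector_derivative_within_subset)
  ultimately have "((\<lambda>s. transform (\<gamma> (s - t)) (\<psi> t u)) has_vector_derivative F (\<psi> t u)) (at t within {t..})"
    using vector_diff_chain_within[of "\<lambda>s. s - t" 1 t "{t..}" "\<lambda>s. transform (\<gamma> s) (\<psi> t u)" "F (\<psi> t u)"]
    by (simp add: o_def)
  then have *: "((\<lambda>s. transform (\<gamma> (s - t)) (\<psi> t u) * transform (\<gamma> t) u) has_vector_derivative F (\<psi> t u) * transform (\<gamma> t) u) (at t within {t..})"
    by (rule has_vector_derivative_mult_left)
  have "transform (\<gamma> s) u = transform (\<gamma> (s - t)) (\<psi> t u) * transform (\<gamma> t) u" if "s \<in> {t..}" for s
    using transform_\<gamma>_add[of "s - t" t u] that t u by simp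
  from has_vector_derivative_transform[OF _ this *]
  have "((\<lambda>s. transform (\<gamma> s) u) has_vector_derivative F (\<psi> t u) * transform (\<gamma> t) u) (at t within {t..})"
    by simp
  moreover have "((\<lambda>s. transform (\<gamma> s) u) has_vector_derivative d) (at t within {t..})"
    by (rule has_vector_derivative_within_subset[OF d]) (use t in auto)
  moreover have "at t within {t..} \<noteq> bot" by (simp add: at_within_Ici_at_right)
  ultimately have "d = F (\<psi> t u) * transform (\<gamma> t) u"
    using vector_derivative_unique_within by blast
  with d show ?thesis by simp
qed

section \<open>The exponential formula and infinite divisibility\<close>

lemma F_\<psi>_jointly_continuous: "continuous_on ({0..} \<times> U) (\<lambda>(t, u). F (\<psi> t u))"
  using continuous_on_compose2[OF continuous_on_F \<psi>_jointly_continuous] \<psi>_mem_U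
  by (simp add: split_beta' image_subset_iff mem_Times_iff)

lemma F_\<psi>_time_continuous: "u \<in> U \<Longrightarrow> continuous_on {0..t} (\<lambda>s. F (\<psi> s u))"
  by (rule continuous_on_compose2[OF continuous_on_F continuous_on_subset[OF \<psi>_time_continuous]])
    (auto intro: \<psi>_mem_U)

definition \<Phi> :: "real \<Rightarrow> complex \<times> complex \<Rightarrow> complex" where
  "\<Phi> t u = integral {0..t} (\<lambda>s. F (\<psi> s u))"

text \<open>The product of the transform with \<open>exp (- \<Phi> s u)\<close> has derivative 0 in
  time and starts at 1.\<close>

lemma transform_\<gamma>_eq_exp:
  assumes t: "0 \<le> t" and u: "u \<in> U"
  shows "transform (\<gamma> t) u = exp (\<Phi> t u)"
proof -
  obtain c where c: "\<And>s. s \<in> {0..t} \<Longrightarrow> transform (\<gamma> s) u * exp (- \<Phi> s u) = c"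
  proof (rule has_vector_derivative_zero_constant)
    fix s assume s: "s \<in> {0..t}"
    have 1: "((\<lambda>s. transform (\<gamma> s) u) has_vector_derivative F (\<psi> s u) * transform (\<gamma> s) u) (at s within {0..t})"
      by (rule has_vector_derivative_within_subset[OF transform_\<gamma>_ode[OF _ u]]) (use s in auto)
    have "((\<lambda>s. \<Phi> s u) has_vector_derivative F (\<psi> s u)) (at s within {0..t})"
      unfolding \<Phi>_def by (rule integral_has_vector_derivative[OF F_\<psi>_time_continuous[OF u] s])
    then have "((\<lambda>s. - \<Phi> s u) has_vector_derivative - F (\<psi> s u)) (at s within {0..t})"
      by (rule has_vector_derivative_minus)
    from field_vector_diff_chain_within[OF this DERIV_exp[THEN has_field_derivative_at_within]]
    have 2: "((\<lambda>s. exp (- \<Phi> s u)) has_vector_derivative - F (\<psi> s u) * exp (- \<Phi> s u)) (at s within {0..t})"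
      by (simp add: o_def)
    from has_vector_derivative_mult[OF 1 2]
    show "((\<lambda>s. transform (\<gamma> s) u * exp (- \<Phi> s u)) has_vector_derivative 0) (at s within {0..t})"
      by (simp add: algebra_simps)
  qed auto
  have "c = 1" using c[of 0] t by (simp add: \<Phi>_def transform_\<gamma>_0[OF u])
  then show ?thesis using c[of t] t by (simp add: exp_minus field_simps)
qed

lemma continuous_on_\<Phi>:
  assumes t: "0 \<le> t" shows "continuous_on U (\<Phi> t)"
proof -
  have "continuous_on (U \<times> cbox 0 t) (\<lambda>(u, s). F (\<psi> s u))"
  proof -
    have "continuous_on (U \<times> cbox 0 t) (\<lambda>x. (snd x, fst x))" by (intro continuous_intros)
    moreover have "(\<lambda>x. (snd x, fst x)) ` (U \<times> cbox 0 t) \<subseteq> {0..} \<times> U" by auto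
    ultimately show ?thesis
      using continuous_on_compose2[OF F_\<psi>_jointly_continuous] by (fastforce simp: split_beta')
  qed
  from integral_continuous_on_param[OF this] show ?thesis by (simp add: \<Phi>_def[abs_def])
qed

lemma F_0: "F 0 = 0"
proof -
  have "((\<lambda>s. transform (\<gamma> s) 0) has_vector_derivative 0) (at 0 within {0..})"
    by (rule has_vector_derivative_transform[OF _ _ has_vector_derivative_const[of 1]])
      (auto simp: transform_0 \<gamma>_prob)
  then show ?thesis unfolding F_def by (rule vector_derivative_within[OF at_0_nontrivial])
qed

lemma \<Phi>_0: "0 \<le> t \<Longrightarrow> \<Phi> t 0 = 0"
  unfolding \<Phi>_def by (subst integral_cong[where g = "\<lambda>_. 0"]) (auto simp: \<psi>_0 F_0)

text \<open>The division by \<open>k\<close> supplies at once a law for \<open>k = 1\<close> and its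
  convolution roots for the other \<open>k\<close>.\<close>

lemma exp_F_divided:
  assumes k: "0 < k"
  obtains \<nu> where "\<nu> \<in> space (prob_algebra MD)" "\<And>u. u \<in> U \<Longrightarrow> transform \<nu> u = exp (F u / of_nat k)"
proof (rule transform_continuity)
  \<comment> \<open>Chosen with \<open>real (Suc n) * s n = 1 / real k\<close>, so that the exponent
    \<open>of_nat (Suc n) * \<Phi> (s n) u\<close> is the difference quotient of \<Phi> at time 0
    divided by \<open>k\<close>.\<close>
  define s where "s n = 1 / (real (Suc n) * real k)" for n
  have s: "0 < s n" for n using k by (simp add: s_def)
  show "conv_power (\<gamma> (s n)) (Suc n) \<in> space (prob_algebra MD)" for n
    using s[of n] by (intro conv_power_prob_algebra \<gamma>_prob) simp
  show "continuous_on U (\<lambda>u. exp (F u / of_nat k))"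
    using k by (intro continuous_intros continuous_on_F) auto
  fix u assume u: "u \<in> U"
  have s_lim: "s \<longlonglongrightarrow> 0"
  proof -
    have "(\<lambda>n. (1 / real k) * (1 / real (Suc n))) \<longlonglongrightarrow> (1 / real k) * 0"
      by (intro tendsto_mult tendsto_const LIMSEQ_Suc[OF lim_1_over_n])
    then show ?thesis by (simp add: s_def[abs_def] mult.commute)
  qed
  have "((\<lambda>s. \<Phi> s u) has_vector_derivative F (\<psi> 0 u)) (at 0 within {0..1})"
    unfolding \<Phi>_def by (rule integral_has_vector_derivative[OF F_\<psi>_time_continuous[OF u]]) simp
  then have "((\<lambda>s. (\<Phi> s u - \<Phi> 0 u) /\<^sub>R (s - 0)) \<longlongrightarrow> F u) (at 0 within {0..})"
    using at_within_nonneg[of 0 1] by (simp add: has_vector_derivative_iff_quotient \<psi>_time_0[OF u])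
  from this[unfolded tendsto_at_iff_sequentially, rule_format, of s]
  have "((\<lambda>s. (\<Phi> s u - \<Phi> 0 u) /\<^sub>R (s - 0)) \<circ> s) \<longlonglongrightarrow> F u"
    using s s_lim by (simp add: less_imp_le less_imp_neq[OF s, symmetric])
  then have "(\<lambda>n. exp ((\<Phi> (s n) u) /\<^sub>R s n / of_nat k)) \<longlonglongrightarrow> exp (F u / of_nat k)"
    using k by (intro tendsto_intros) (auto simp: o_def \<Phi>_def)
  moreover have "exp ((\<Phi> (s n) u) /\<^sub>R s n / of_nat k) = transform (conv_power (\<gamma> (s n)) (Suc n)) u" for n
  proof -
    have "\<Phi> (s n) u /\<^sub>R s n / of_nat k = of_nat (Suc n) * \<Phi> (s n) u"
      using k by (simp add: s_def scaleR_conv_of_real field_simps del: of_nat_Suc)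
    moreover have "exp (of_nat (Suc n) * \<Phi> (s n) u) = transform (\<gamma> (s n)) u ^ Suc n"
      using transform_\<gamma>_eq_exp[OF less_imp_le[OF s] u] by (metis exp_of_nat_mult)
    ultimately show ?thesis
      using transform_conv_power[OF \<gamma>_prob[OF less_imp_le[OF s]] u, of n "Suc n"] by simp
  qed
  ultimately show "(\<lambda>n. transform (conv_power (\<gamma> (s n)) (Suc n)) u) \<longlonglongrightarrow> exp (F u / of_nat k)" by simp
qed (use that in blast)

text \<open>\<open>k = 1\<close> gives \<nu>, and \<open>k = n\<close> a measure whose
  \<open>n\<close>-th convolution power has the same transform; uniqueness identifies the
  two.\<close>

lemma \<gamma>_regular: "regular \<psi> \<gamma>"
proof -
  obtain \<nu> where \<nu>: "\<nu> \<in> space (prob_algebra MD)" "\<And>u. u \<in> U \<Longrightarrow> transform \<nu> u = exp (F u)"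
    using exp_F_divided[of 1] by auto
  have "\<exists>\<mu>\<in>space (prob_algebra MD). conv_power \<mu> n = \<nu>" if "1 \<le> n" for n
  proof -
    obtain \<mu> where \<mu>: "\<mu> \<in> space (prob_algebra MD)" "\<And>u. u \<in> U \<Longrightarrow> transform \<mu> u = exp (F u / of_nat n)"
      using exp_F_divided[of n] \<open>1 \<le> n\<close> by auto
    have "conv_power \<mu> n = \<nu>"
    proof (rule transform_unique[OF conv_power_prob_algebra[OF \<mu>(1)] \<nu>(1)])
      fix u assume u: "u \<in> U"
      have "exp (F u / of_nat n) ^ n = exp (F u)" using that by (simp flip: exp_of_nat_mult)
      then show "transform (conv_power \<mu> n) u = transform \<nu> u"
        by (simp add: transform_conv_power \<mu> \<nu> u)
    qed
    with \<mu> show ?thesis by blast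
  qed
  then have "infinitely_divisible \<nu>" using \<nu> by (simp add: infinitely_divisible_def)
  moreover have "continuous_log_on_U (transform \<nu>) F"
    by (simp add: continuous_log_on_U_def continuous_on_F F_0 \<nu>)
  moreover have "continuous_log_on_U (transform (\<gamma> t)) (\<Phi> t)" if "0 \<le> t" for t
    using that by (simp add: continuous_log_on_U_def continuous_on_\<Phi> \<Phi>_0 transform_\<gamma>_eq_exp)
  moreover have "set_integrable lborel {0..t} (\<lambda>s. F (\<psi> s u))" "\<Phi> t u = (LINT s:{0..t}|lborel. F (\<psi> s u))"
    if "0 \<le> t" "u \<in> U" for t u
  proof -
    show i: "set_integrable lborel {0..t} (\<lambda>s. F (\<psi> s u))"
      by (rule borel_integrable_atLeastAtMost'[OF F_\<psi>_time_continuous[OF that(2)]])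
    show "\<Phi> t u = (LINT s:{0..t}|lborel. F (\<psi> s u))"
      unfolding \<Phi>_def using set_borel_integral_eq_integral(2)[OF i] by simp
  qed
  ultimately show ?thesis unfolding regular_def by blast
qed

end

theorem theorem4p2:
  fixes Q :: "real \<Rightarrow> real \<times> real \<Rightarrow> (real \<times> real) measure"
    and \<psi> :: "real \<Rightarrow> complex \<times> complex \<Rightarrow> complex \<times> complex"
    and \<gamma> :: "real \<Rightarrow> (real \<times> real) measure"
    and h\<^sub>2 :: "real \<Rightarrow> real"
  assumes "HA_semigroup Q \<psi>"
    and "\<forall>x\<in>D. weakly_continuous (\<lambda>t. Q t x)"
    and "SC_semigroup Q \<gamma>"
    and "weakly_continuous \<gamma>"
    and "\<forall>t\<ge>0. \<forall>x\<in>D. (\<integral>\<^sup>+\<xi>. ennreal (norm \<xi>) \<partial>Q t x) < \<infinity>"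
    and "\<forall>t\<ge>0. (\<integral>\<^sup>+\<xi>. ennreal (norm \<xi>) \<partial>\<gamma> t) < \<infinity>"
    and "\<forall>t\<ge>0. h\<^sub>2 t = (LINT \<xi>|\<gamma> t. snd \<xi>)"
  shows "regular \<psi> \<gamma> \<longleftrightarrow> absolutely_continuous_on_nonneg h\<^sub>2"
proof -
  interpret affine_immigration Q \<psi> \<gamma>
    by unfold_locales (use assms in auto)
  have "absolutely_continuous_on_nonneg h\<^sub>2"
    by (rule h2_absolutely_continuous) (use assms(7) in \<open>simp add: h2_def\<close>)
  then show ?thesis using \<gamma>_regular by simp
qed

end
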